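(* Let $\mathbf A=\begin{pmatrix}0&1&1\\1&0&1\\1&1&0\end{pmatrix}$ and let $\mathcal{C}=L_2(\Sigma_{\mathbf A}^+;\mathbb{R})$ be the set of real-valued 2-locally constant functions on $\Sigma_{\mathbf A}^+$. Then the set $$\{f\in\mathcal{C}:[f]_3\subsetneq[f]_1\}$$ contains an open and dense subset of $\mathcal{C}$.
   Context: Let $N\ge 2$ and $\mathbf A$ an $N\times N$ aperiodic zero-one matrix (some power has all entries positive); here $N=3$. $\Sigma_{\mathbf A}^+=\{\omega=(\omega_n)_{n\ge 0}\in\{1,\dots,N\}^{\mathbb{N}\cup\{0\}}:\mathbf A_{\omega_n\omega_{n+1}}=1 \text{ for all } n\ge 0\}$, with metric $d(\omega,\omega')=\sum_{n\ge0}|\omega_n-\omega'_n|/2^n$; $\sigma_{\mathbf A}$ is the shift $(\sigma_{\mathbf A}\omega)_n=\omega_{n+1}$. A function $\phi$ on $\Sigma_{\mathbf A}^+$ is $n$-locally constant if $\phi(\omega)=\phi(\omega')$ whenever $\omega_k=\omega'_k$ for $0\le k\le n-1$. $\mathcal{C}$ is a finite-dimensional real vector space with its usual topology. Cylinders: $C_n(\omega)=\{\omega'\in\Sigma_{\mathbf A}^+:\omega'_k=\omega_k,\ 0\le k\le n-1\}$, $C_0(\omega)=\Sigma_{\mathbf A}^+$. Gibbs measures: a $\sigma_{\mathbf A}$-invariant Borel probability measure $\mu$ is a Gibbs measure for continuous $f:\Sigma_{\mathbf A}^+\to\mathbb{R}$ if there are $C>0$, $P\in\mathbb{R}$ with $C^{-1}\le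 \mu(C_n(\omega))/\exp(-nP+\sum_{k=0}^{n-1}f(\sigma_{\mathbf A}^k\omega))\le C$ for all $\omega$ and $n\ge1$. Each Hölder continuous real $f$ (in particular each locally constant one) has a unique Gibbs measure $\mu_f$. Entropy spectrum: $E_\alpha^{(\mu)}=\{\omega:\lim_{n\to\infty}-\frac1n\log\mu(C_n(\omega))=\alpha\}$ and $\mathcal{E}^{(\mu)}(\alpha)=h(\sigma_{\mathbf A}|E_\alpha^{(\mu)})$ for $\alpha\in\mathbb{R}$. Here $h(\sigma_{\mathbf A}|Z)$ is Bowen's topological entropy of a subset $Z$: the infimum of all $s\ge0$ such that $\lim_{n\to\infty}\inf\sum_i e^{-s n_i}=0$, the infimum over countable covers of $Z$ by cylinders $C_{n_i}(\omega^{(i)})$ with all $n_i\ge n$; $h(\sigma_{\mathbf A}|\emptyset)=0$. Isomorphic: $(\Sigma_{\mathbf A}^+,\sigma_{\mathbf A},\mu_f)$ and $(\Sigma_{\mathbf A}^+,\sigma_{\mathbf A},\mu_g)$ are isomorphic if there exist Borel sets $X,Y\subset\Sigma_{\mathbf A}^+$ and a bijection $\Phi:X\to Y$ with $\sigma_{\mathbf A}(X)\subset X$, $\sigma_{\mathbf A}(Y)\subset Y$, $\mu_f(X)=\mu_g(Y)=1$; $\Phi,\Phi^{-1}$ Borel measurable; $\Phi\circ\sigma_{\mathbf A}=\sigma_{\mathbf A}\circ\Phi$ on $X$; $\mu_f=\mu_g\circ\Phi$ (i.e. $\mu_f(B)=\mu_g(\Phi(B))$ for Borel $B\subset X$). Classes: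 for $f\in\mathcal{C}$, $[f]_1=\{g\in\mathcal{C}:\mathcal{E}^{(\mu_f)}=\mathcal{E}^{(\mu_g)}\}$ and $[f]_3=\{g\in\mathcal{C}:(\Sigma_{\mathbf A}^+,\sigma_{\mathbf A},\mu_f)\text{ and }(\Sigma_{\mathbf A}^+,\sigma_{\mathbf A},\mu_g)\text{ are isomorphic}\}$. *)

theory Defs
  imports "HOL-Probability.Probability"
begin

definition SFT :: "nat \<Rightarrow> (nat \<Rightarrow> nat \<Rightarrow> nat) \<Rightarrow> (nat \<Rightarrow> nat) set" where
  "SFT N A = {\<omega>. \<forall>n. \<omega> n \<in> {1..N} \<and> A (\<omega> n) (\<omega> (Suc n)) = 1}"

definition shift :: "(nat \<Rightarrow> nat) \<Rightarrow> nat \<Rightarrow> nat" where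
  "shift \<omega> = (\<lambda>n. \<omega> (Suc n))"

definition cylinder :: "(nat \<Rightarrow> nat) set \<Rightarrow> nat \<Rightarrow> (nat \<Rightarrow> nat) \<Rightarrow> (nat \<Rightarrow> nat) set" where
  "cylinder S n \<omega> = {\<omega>' \<in> S. \<forall>k<n. \<omega>' k = \<omega> k}"

text \<open>\<^const>\<open>infsum\<close> is 0 for divergent series, so that this is nonnegative
  for all arguments, as the locale \<^locale>\<open>Metric_space\<close> demands; on sequences
  over a finite alphabet the series converges.\<close>

definition seq_dist :: "(nat \<Rightarrow> nat) \<Rightarrow> (nat \<Rightarrow> nat) \<Rightarrow> real" where
  "seq_dist \<omega> \<omega>' = (\<Sum>\<^sub>\<infinity>n. \<bar>real (\<omega> n) - real (\<omega>' n)\<bar> / 2 ^ n)"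

definition seq_topology :: "(nat \<Rightarrow> nat) set \<Rightarrow> (nat \<Rightarrow> nat) topology" where
  "seq_topology S = Metric_space.mtopology S seq_dist"

definition seq_borel :: "(nat \<Rightarrow> nat) set \<Rightarrow> (nat \<Rightarrow> nat) measure" where
  "seq_borel S = sigma S {U. openin (seq_topology S) U}"

text \<open>A function on \<open>S\<close> is an element of \<open>S \<rightarrow>\<^sub>E UNIV\<close>, i.e. \<^const>\<open>undefined\<close> outside \<open>S\<close>.\<close>

definition locally_const :: "(nat \<Rightarrow> nat) set \<Rightarrow> nat \<Rightarrow> ((nat \<Rightarrow> nat) \<Rightarrow> real) set" where
  "locally_const S n = {f \<in> S \<rightarrow>\<^sub>E UNIV.
     \<forall>\<omega>\<in>S. \<forall>\<omega>'\<in>S. (\<forall>k<n. \<omega> k = \<omega>' k) \<longrightarrow> f \<omega> = f \<omega>'}"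

text \<open>The distance of the sup norm. It induces the usual topology on any
  finite-dimensional space of bounded functions. The guard only serves to make it
  nonnegative for all arguments.\<close>

definition sup_dist :: "'a set \<Rightarrow> ('a \<Rightarrow> real) \<Rightarrow> ('a \<Rightarrow> real) \<Rightarrow> real" where
  "sup_dist S f g =
     (if S \<noteq> {} \<and> bdd_above ((\<lambda>x. \<bar>f x - g x\<bar>) ` S) then SUP x\<in>S. \<bar>f x - g x\<bar> else 0)"

definition gibbs_for ::
  "(nat \<Rightarrow> nat) set \<Rightarrow> ((nat \<Rightarrow> nat) \<Rightarrow> real) \<Rightarrow> (nat \<Rightarrow> nat) measure \<Rightarrow> bool" where
  "gibbs_for S f \<mu> \<longleftrightarrow>
     continuous_map (seq_topology S) euclideanreal f \<and>
     sets \<mu> = sets (seq_borel S) \<and> prob_space \<mu> \<and> distr \<mu> \<mu> shift = \<mu> \<and>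
     (\<exists>C>0. \<exists>P. \<forall>\<omega>\<in>S. \<forall>n\<ge>1.
        let q = measure \<mu> (cylinder S n \<omega>) / exp (- real n * P + (\<Sum>k<n. f ((shift ^^ k) \<omega>)))
        in inverse C \<le> q \<and> q \<le> C)"

definition gibbs_measure ::
  "(nat \<Rightarrow> nat) set \<Rightarrow> ((nat \<Rightarrow> nat) \<Rightarrow> real) \<Rightarrow> (nat \<Rightarrow> nat) measure" where
  "gibbs_measure S f = (THE \<mu>. gibbs_for S f \<mu>)"

text \<open>The sums \<open>\<Sum>\<^sub>i exp (- s * n\<^sub>i)\<close> over the covers \<open>(C n\<^sub>i \<omega>\<^sub>i)\<^sub>i\<^sub>\<in>\<^sub>I\<close> of \<open>Z\<close>
  with all \<open>n\<^sub>i \<ge> n\<close>, where \<open>I\<close> may be any set of naturals (finite, infinite or,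
  for \<open>Z = {}\<close>, empty).\<close>

definition cover_sums ::
  "(nat \<Rightarrow> nat) set \<Rightarrow> (nat \<Rightarrow> nat) set \<Rightarrow> real \<Rightarrow> nat \<Rightarrow> ennreal set" where
  "cover_sums S Z s n =
     {(\<Sum>\<^sub>\<infinity>i\<in>I. ennreal (exp (- s * real (m i)))) | (I :: nat set) m w.
        (\<forall>i\<in>I. w i \<in> S \<and> n \<le> m i) \<and> Z \<subseteq> (\<Union>i\<in>I. cylinder S (m i) (w i))}"

definition bowen_entropy :: "(nat \<Rightarrow> nat) set \<Rightarrow> (nat \<Rightarrow> nat) set \<Rightarrow> real" where
  "bowen_entropy S Z = Inf {s. 0 \<le> s \<and> (\<lambda>n. Inf (cover_sums S Z s n)) \<longlonglongrightarrow> 0}"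

definition level_set ::
  "(nat \<Rightarrow> nat) set \<Rightarrow> (nat \<Rightarrow> nat) measure \<Rightarrow> real \<Rightarrow> (nat \<Rightarrow> nat) set" where
  "level_set S \<mu> \<alpha> =
     {\<omega> \<in> S. (\<lambda>n. - (1 / real n) * ln (measure \<mu> (cylinder S n \<omega>))) \<longlonglongrightarrow> \<alpha>}"

definition entropy_spectrum ::
  "(nat \<Rightarrow> nat) set \<Rightarrow> (nat \<Rightarrow> nat) measure \<Rightarrow> real \<Rightarrow> real" where
  "entropy_spectrum S \<mu> = (\<lambda>\<alpha>. bowen_entropy S (level_set S \<mu> \<alpha>))"

definition shift_isomorphic ::
  "(nat \<Rightarrow> nat) set \<Rightarrow> (nat \<Rightarrow> nat) measure \<Rightarrow> (nat \<Rightarrow> nat) measure \<Rightarrow> bool" where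
  "shift_isomorphic S \<mu> \<nu> \<longleftrightarrow>
     (\<exists>X \<in> sets (seq_borel S). \<exists>Y \<in> sets (seq_borel S). \<exists>\<Phi>.
        bij_betw \<Phi> X Y \<and> shift ` X \<subseteq> X \<and> shift ` Y \<subseteq> Y \<and>
        measure \<mu> X = 1 \<and> measure \<nu> Y = 1 \<and>
        \<Phi> \<in> restrict_space (seq_borel S) X \<rightarrow>\<^sub>M restrict_space (seq_borel S) Y \<and>
        inv_into X \<Phi> \<in> restrict_space (seq_borel S) Y \<rightarrow>\<^sub>M restrict_space (seq_borel S) X \<and>
        (\<forall>\<omega>\<in>X. \<Phi> (shift \<omega>) = shift (\<Phi> \<omega>)) \<and>
        (\<forall>B \<in> sets (seq_borel S). B \<subseteq> X \<longrightarrow> measure \<mu> B = measure \<nu> (\<Phi> ` B)))"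

definition spectrum_class ::
  "(nat \<Rightarrow> nat) set \<Rightarrow> ((nat \<Rightarrow> nat) \<Rightarrow> real) set \<Rightarrow> ((nat \<Rightarrow> nat) \<Rightarrow> real)
     \<Rightarrow> ((nat \<Rightarrow> nat) \<Rightarrow> real) set" where
  "spectrum_class S \<C> f =
     {g \<in> \<C>. entropy_spectrum S (gibbs_measure S f) = entropy_spectrum S (gibbs_measure S g)}"

definition isomorphism_class ::
  "(nat \<Rightarrow> nat) set \<Rightarrow> ((nat \<Rightarrow> nat) \<Rightarrow> real) set \<Rightarrow> ((nat \<Rightarrow> nat) \<Rightarrow> real)
     \<Rightarrow> ((nat \<Rightarrow> nat) \<Rightarrow> real) set" where
  "isomorphism_class S \<C> f =
     {g \<in> \<C>. shift_isomorphic S (gibbs_measure S f) (gibbs_measure S g)}"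

definition matA :: "nat \<Rightarrow> nat \<Rightarrow> nat" where
  "matA i j = [[0, 1, 1],
               [1, 0, 1],
               [1, 1, 0]] ! (i - 1) ! (j - 1)"

abbreviation SigmaA :: "(nat \<Rightarrow> nat) set" where
  "SigmaA \<equiv> SFT 3 matA"

abbreviation L2 :: "((nat \<Rightarrow> nat) \<Rightarrow> real) set" where
  "L2 \<equiv> locally_const SigmaA 2"

definition L2_topology :: "((nat \<Rightarrow> nat) \<Rightarrow> real) topology" where
  "L2_topology = Metric_space.mtopology L2 (sup_dist SigmaA)"

lemma seq_dist_summable:
  assumes "\<omega> \<in> SFT N A" "\<omega>' \<in> SFT N A"
  shows "(\<lambda>n. \<bar>real (\<omega> n) - real (\<omega>' n)\<bar> / 2 ^ n) summable_on UNIV"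
proof -
  have "summable (\<lambda>n. real N * (1 / 2) ^ n)"
    by (intro summable_mult summable_geometric) auto
  moreover have "norm (\<bar>real (\<omega> n) - real (\<omega>' n)\<bar> / 2 ^ n) \<le> real N * (1 / 2) ^ n" for n
  proof -
    have "\<omega> n \<le> N" "\<omega>' n \<le> N"
      using assms by (auto simp: SFT_def)
    then have "\<bar>real (\<omega> n) - real (\<omega>' n)\<bar> \<le> real N" by linarith
    then show ?thesis by (simp add: power_one_over divide_right_mono)
  qed
  ultimately have "summable (\<lambda>n. norm (\<bar>real (\<omega> n) - real (\<omega>' n)\<bar> / 2 ^ n))"
    by (intro summable_comparison_test[of "\<lambda>n. norm (\<bar>real (\<omega> n) - real (\<omega>' n)\<bar> / 2 ^ n)"])
      (auto simp only: real_norm_def abs_abs)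
  then show ?thesis by (rule norm_summable_imp_summable_on)
qed

lemma Metric_space_SFT: "Metric_space (SFT N A) seq_dist"
proof
  show "0 \<le> seq_dist x y" for x y
    unfolding seq_dist_def by (rule infsum_nonneg) auto
  show "seq_dist x y = seq_dist y x" for x y
    unfolding seq_dist_def by (simp add: abs_minus_commute)
  show "seq_dist x y = 0 \<longleftrightarrow> x = y" if "x \<in> SFT N A" "y \<in> SFT N A" for x y
  proof
    assume "seq_dist x y = 0"
    then have "\<bar>real (x n) - real (y n)\<bar> / 2 ^ n = 0" for n
      unfolding seq_dist_def
      by (intro nonneg_infsum_le_0D[OF _ seq_dist_summable[OF that]]) auto
    then show "x = y" by auto
  qed (simp add: seq_dist_def)
  show "seq_dist x z \<le> seq_dist x y + seq_dist y z"
    if "x \<in> SFT N A" "y \<in> SFT N A" "z \<in> SFT N A" for x y z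
  proof -
    note s = seq_dist_summable[of _ N A]
    have "seq_dist x z \<le>
        (\<Sum>\<^sub>\<infinity>n. \<bar>real (x n) - real (y n)\<bar> / 2 ^ n + \<bar>real (y n) - real (z n)\<bar> / 2 ^ n)"
      unfolding seq_dist_def
      by (intro infsum_mono s summable_on_add that)
        (auto simp flip: add_divide_distrib intro!: divide_right_mono)
    also have "\<dots> = seq_dist x y + seq_dist y z"
      unfolding seq_dist_def by (intro infsum_add s that)
    finally show ?thesis .
  qed
qed

lemma finite_range_locally_const:
  assumes "f \<in> locally_const (SFT N A) n"
  shows "finite (f ` SFT N A)"
proof -
  let ?r = "\<lambda>\<omega>. restrict \<omega> {..<n}"
  have "?r ` SFT N A \<subseteq> {..<n} \<rightarrow>\<^sub>E {1..N}"
    by (rule image_subsetI, rule restrict_PiE_iff[THEN iffD2]) (auto simp: SFT_def)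
  then have fin: "finite (?r ` SFT N A)"
    by (rule finite_subset) (auto intro!: finite_PiE)
  have "f \<omega> = f (inv_into (SFT N A) ?r (?r \<omega>))" if "\<omega> \<in> SFT N A" for \<omega>
  proof -
    let ?v = "inv_into (SFT N A) ?r (?r \<omega>)"
    have r: "?r \<omega> \<in> ?r ` SFT N A" using that by (rule imageI)
    have "?v \<in> SFT N A" using r by (rule inv_into_into)
    moreover have "?r ?v = ?r \<omega>" using r by (rule f_inv_into_f)
    then have "\<forall>k<n. \<omega> k = ?v k" by (metis lessThan_iff restrict_apply')
    ultimately show ?thesis using assms that unfolding locally_const_def by blast
  qed
  then have "f ` SFT N A \<subseteq> (\<lambda>u. f (inv_into (SFT N A) ?r u)) ` ?r ` SFT N A"
    by auto
  then show ?thesis using fin finite_subset by blast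
qed

lemma Metric_space_locally_const:
  "Metric_space (locally_const (SFT N A) n) (sup_dist (SFT N A))"
proof
  let ?S = "SFT N A"
  have bdd: "bdd_above ((\<lambda>x. \<bar>f x - g x\<bar>) ` ?S)"
    if "f \<in> locally_const ?S n" "g \<in> locally_const ?S n" for f g
  proof -
    have "(\<lambda>x. \<bar>f x - g x\<bar>) ` ?S \<subseteq> (\<lambda>(a, b). \<bar>a - b\<bar>) ` (f ` ?S \<times> g ` ?S)"
      by auto
    then show ?thesis
      using that by (meson finite_range_locally_const bdd_above_finite finite_SigmaI
          finite_imageI finite_subset)
  qed
  have upper: "\<bar>f x - g x\<bar> \<le> sup_dist ?S f g"
    if "f \<in> locally_const ?S n" "g \<in> locally_const ?S n" "x \<in> ?S" for f g x
    using bdd[OF that(1,2)] that(3) by (auto simp: sup_dist_def intro!: cSUP_upper)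
  show nn: "0 \<le> sup_dist ?S f g" for f g
    by (auto simp: sup_dist_def intro: cSUP_upper2)
  show "sup_dist ?S f g = sup_dist ?S g f" for f g
    by (simp add: sup_dist_def abs_minus_commute)
  show "sup_dist ?S f g = 0 \<longleftrightarrow> f = g"
    if fg: "f \<in> locally_const ?S n" "g \<in> locally_const ?S n" for f g
  proof
    assume "sup_dist ?S f g = 0"
    then have eq: "f x = g x" if "x \<in> ?S" for x
      using upper[OF fg that] by auto
    have "f \<in> ?S \<rightarrow>\<^sub>E UNIV" "g \<in> ?S \<rightarrow>\<^sub>E UNIV"
      using fg by (simp_all add: locally_const_def)
    then show "f = g" by (rule PiE_ext) (rule eq)
  next
    assume "f = g"
    then show "sup_dist ?S f g = 0" by (simp add: sup_dist_def)
  qed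
  show "sup_dist ?S f h \<le> sup_dist ?S f g + sup_dist ?S g h"
    if fgh: "f \<in> locally_const ?S n" "g \<in> locally_const ?S n" "h \<in> locally_const ?S n" for f g h
  proof (cases "?S = {}")
    case False
    have "\<bar>f x - h x\<bar> \<le> sup_dist ?S f g + sup_dist ?S g h" if x: "x \<in> ?S" for x
      using upper[OF fgh(1,2) x] upper[OF fgh(2,3) x] by linarith
    then have "(SUP x\<in>?S. \<bar>f x - h x\<bar>) \<le> sup_dist ?S f g + sup_dist ?S g h"
      using False by (intro cSUP_least) auto
    then show ?thesis using nn[of f g] nn[of g h] by (simp add: sup_dist_def[of _ f h])
  qed (simp add: sup_dist_def)
qed

end

theory Submission
  imports Defs
begin

text \<open>
  The Gibbs measure of a 2-locally constant \<open>f\<close> is the Markov measure built from the Perron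
  eigenvectors of the matrix \<open>exp f(i, j)\<close>, and the Jacobian of the shift for it depends on the
  first two letters only. If its six values are distinct, they determine the point, so an isomorphism
  onto another such system, which preserves Jacobians, comes from a permutation of the alphabet;
  such a permutation preserves the entropy spectrum.

  The matrix of the reversed potential \<open>f(j, i)\<close> is the transpose. Writing longer and longer blocks
  of a point backwards, with one connecting letter each, maps the level sets of \<open>f\<close> into those of
  the reversed potential and changes the length of the cylinders only by a factor tending to 1,
  so that both have the same entropy spectrum. The two systems are not isomorphic
  if the weights of the three cycles of length 2 are distinct and those of the two cycles of length 3 are too.

  These conditions are open by the continuity of the eigenvectors. They are dense since the
  inverse Jacobian can be perturbed freely, with fixed eigenvalue and left eigenvector.
\<close>

subsection \<open>Uniqueness of quasi-Bernoulli weights on words\<close>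

text \<open>Since \<open>gibbs_measure\<close> is a definite description, nothing can be computed
  before the Gibbs measure is known to be unique. In place of ergodic theorems, the density of one
  Gibbs measure with respect to another is treated as a bounded martingale on words whose second
  moment is squeezed to 1.

  The obstacle throughout is that a letter must not follow itself, so words cannot always be joined
  directly. One letter in between suffices, because three letters leave one that differs from two
  given ones; the independence estimate and the reversal of blocks both spend it.

  Equality of the spectra is obtained without pressure functions: level sets are sets of points with
  given Birkhoff averages, and an explicit map between them compares covers. A one-sided sequence
  has no reversal as a whole, hence the blocks. Their lengths 2 k + 1 add up to squares, and the
  number of blocks is of the order of the square root of the length, so that connectors and
  incomplete blocks are negligible.

  Reversal keeps the weight of each cycle of length 2 and exchanges those of the two cycles of
  length 3; this is what tells \<open>f\<close> from its reversal.\<close>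

definition words :: "nat \<Rightarrow> nat list set" where
  "words n = {w. length w = n \<and> set w \<subseteq> {1..3}}"

lemma words_0 [simp]: "words 0 = {[]}"
  by (auto simp: words_def)

lemma words_Suc: "words (Suc n) = (\<lambda>(x, w). x # w) ` ({1..3} \<times> words n)"
  by (auto simp: words_def length_Suc_conv image_iff)

lemma finite_words [simp]: "finite (words n)"
  by (induction n) (auto simp: words_Suc)

lemma sum_words_Suc: "(\<Sum>w\<in>words (Suc n). g w) = (\<Sum>x=1..3. \<Sum>w\<in>words n. g (x # w))"
  unfolding words_Suc sum.cartesian_product
  by (subst sum.reindex) (auto simp: inj_on_def intro!: sum.cong)

lemma sum_words_append:
  "(\<Sum>w\<in>words (m + n). g w) = (\<Sum>v\<in>words m. \<Sum>u\<in>words n. g (v @ u))"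
  by (induction m arbitrary: g) (simp_all add: sum_words_Suc)

lemma sum_words_1: "(\<Sum>w\<in>words 1. g w) = (\<Sum>x=1..3. g [x])"
  unfolding One_nat_def sum_words_Suc by simp

lemma word_additive_left:
  fixes U :: "nat list \<Rightarrow> real"
  assumes "\<And>w. (\<Sum>x=1..3. U (x # w)) = U w"
  shows "(\<Sum>v\<in>words n. U (v @ u)) = U u"
proof (induction n)
  case (Suc n)
  have "(\<Sum>v\<in>words (Suc n). U (v @ u)) = (\<Sum>w\<in>words n. \<Sum>x=1..3. U (x # w @ u))"
    unfolding sum_words_Suc by (subst sum.swap) simp
  then show ?case by (simp only: assms Suc)
qed simp

lemma word_additive_right:
  fixes U :: "nat list \<Rightarrow> real"
  assumes "\<And>w. (\<Sum>x=1..3. U (w @ [x])) = U w"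
  shows "(\<Sum>u\<in>words n. U (v @ u)) = U v"
proof (induction n arbitrary: v)
  case (Suc n)
  have "(\<Sum>u\<in>words (Suc n). U (v @ u)) = (\<Sum>x=1..3. \<Sum>u\<in>words n. U ((v @ [x]) @ u))"
    unfolding sum_words_Suc by simp
  then show ?case by (simp only: assms Suc)
qed simp

text \<open>\<open>U\<close> and \<open>V\<close> stand for the cylinder weights of two invariant
  measures, hence the additivity on both sides. Independence is required only up to one free letter
  \<open>x\<close>, since \<open>U (v @ u)\<close> vanishes when \<open>u\<close> begins with the
  last letter of \<open>v\<close>. The domination is asked of nonempty words, where Gibbs bounds are
  available.\<close>

locale word_measures =
  fixes U V :: "nat list \<Rightarrow> real" and K c :: real
  assumes U_nonneg: "0 \<le> U w"
    and V_nonneg: "0 \<le> V w"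
    and U_Nil: "U [] = 1"
    and V_Nil: "V [] = 1"
    and U_left: "(\<Sum>x=1..3. U (x # w)) = U w"
    and U_right: "(\<Sum>x=1..3. U (w @ [x])) = U w"
    and V_left: "(\<Sum>x=1..3. V (x # w)) = V w"
    and V_right: "(\<Sum>x=1..3. V (w @ [x])) = V w"
    and V_le: "w \<noteq> [] \<Longrightarrow> V w \<le> K * U w"
    and c_pos: "0 < c"
    and quasi_bernoulli: "v \<noteq> [] \<Longrightarrow> u \<noteq> [] \<Longrightarrow> c * U v * U u \<le> (\<Sum>x=1..3. U (v @ [x] @ u))"
begin

text \<open>The density of \<open>V\<close> with respect to \<open>U\<close> on cylinders. Where
  \<open>U w = 0\<close> the quotient is 0, which is harmless because \<open>V w\<close> vanishes
  there too.\<close>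

definition "dens w = V w / U w"

definition "energy n = (\<Sum>w\<in>words n. (V w)\<^sup>2 / U w)"

lemma V_zero: "U w = 0 \<Longrightarrow> V w = 0"
  using V_le[of w] V_nonneg[of w] U_Nil by (cases "w = []") auto

lemma dens_mult: "U w * dens w = V w"
  using V_zero[of w] by (cases "U w = 0") (auto simp: dens_def)

lemma energy_alt: "energy n = (\<Sum>w\<in>words n. U w * (dens w)\<^sup>2)"
  unfolding energy_def
  by (intro sum.cong refl) (auto simp: dens_def power2_eq_square)

lemma sum_U: "(\<Sum>w\<in>words n. U w) = 1" and sum_V: "(\<Sum>w\<in>words n. V w) = 1"
  using word_additive_left[OF U_left, of "[]" n] word_additive_left[OF V_left, of "[]" n] U_Nil V_Nil
  by simp_all

lemma square_expand: "U w * (dens w - t)\<^sup>2 = U w * (dens w)\<^sup>2 - 2 * t * V w + U w * t\<^sup>2"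
  by (simp add: dens_mult[symmetric] power2_eq_square algebra_simps)

text \<open>Orthogonality of martingale increments: the density on \<open>v\<close> is the
  \<open>U\<close>-average of the densities on the extensions \<open>v @ u\<close>.\<close>

lemma energy_diff_left:
  "(\<Sum>v\<in>words m. \<Sum>u\<in>words n. U (v @ u) * (dens (v @ u) - dens v)\<^sup>2) = energy (m + n) - energy m"
proof -
  have "(\<Sum>u\<in>words n. U (v @ u) * (dens (v @ u) - dens v)\<^sup>2)
      = (\<Sum>u\<in>words n. U (v @ u) * (dens (v @ u))\<^sup>2) - U v * (dens v)\<^sup>2" for v
    unfolding square_expand sum.distrib sum_subtractf sum_distrib_left[symmetric]
      sum_distrib_right[symmetric]
    by (simp add: word_additive_right[OF U_right] word_additive_right[OF V_right])
      (simp add: dens_mult[symmetric] power2_eq_square)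
  then show ?thesis
    by (simp add: sum_subtractf energy_alt sum_words_append)
qed

text \<open>The same with extensions to the left. It rests on \<open>U_left\<close> and
  \<open>V_left\<close>, that is, on invariance under the shift.\<close>

lemma energy_diff_right:
  "(\<Sum>v\<in>words m. \<Sum>u\<in>words n. U (v @ u) * (dens (v @ u) - dens u)\<^sup>2) = energy (m + n) - energy n"
proof -
  have "(\<Sum>v\<in>words m. U (v @ u) * (dens (v @ u) - dens u)\<^sup>2)
      = (\<Sum>v\<in>words m. U (v @ u) * (dens (v @ u))\<^sup>2) - U u * (dens u)\<^sup>2" for u
    unfolding square_expand sum.distrib sum_subtractf sum_distrib_left[symmetric]
      sum_distrib_right[symmetric]
    by (simp add: word_additive_left[OF U_left] word_additive_left[OF V_left])
      (simp add: dens_mult[symmetric] power2_eq_square)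
  then show ?thesis
    unfolding energy_alt sum_words_append[of _ m n]
    by (subst (1 2) sum.swap) (simp add: sum_subtractf)
qed

lemma energy_mono: "m \<le> n \<Longrightarrow> energy m \<le> energy n"
proof -
  assume "m \<le> n"
  moreover have "0 \<le> energy (m + (n - m)) - energy m"
    unfolding energy_diff_left[symmetric] by (intro sum_nonneg mult_nonneg_nonneg U_nonneg) auto
  ultimately show ?thesis by simp
qed

lemma energy_le: "0 < n \<Longrightarrow> energy n \<le> K"
proof -
  assume "0 < n"
  have "U w * (dens w)\<^sup>2 \<le> K * V w" if "w \<in> words n" for w
  proof -
    have "w \<noteq> []" using that \<open>0 < n\<close> by (auto simp: words_def)
    then have "V w * V w \<le> K * U w * V w" by (intro mult_right_mono V_le V_nonneg)
    then show ?thesis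
      using U_nonneg[of w] V_zero[of w]
      by (cases "U w = 0") (auto simp: dens_def power2_eq_square divide_simps mult.commute mult.left_commute)
  qed
  then have "energy n \<le> (\<Sum>w\<in>words n. K * V w)"
    unfolding energy_alt by (rule sum_mono)
  then show ?thesis by (simp add: sum_distrib_left[symmetric] sum_V)
qed

text \<open>For two independent words drawn according to \<open>U\<close>, the mean squared
  difference of the densities is twice the variance; the mean density is 1.\<close>

lemma variance_identity:
  "(\<Sum>v\<in>words n. \<Sum>u\<in>words n. U v * U u * (dens v - dens u)\<^sup>2) = 2 * (energy n - 1)"
proof -
  have "(\<Sum>u\<in>words n. U v * U u * (dens v - dens u)\<^sup>2)
      = U v * (dens v)\<^sup>2 - 2 * V v + U v * energy n" for v
  proof -
    have "U v * U u * (dens v - dens u)\<^sup>2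
        = U v * (dens v)\<^sup>2 * U u - 2 * (U v * dens v) * (U u * dens u) + U v * (U u * (dens u)\<^sup>2)" for u
      by (simp add: power2_eq_square algebra_simps)
    then show ?thesis
      by (simp add: sum.distrib sum_subtractf sum_distrib_left[symmetric] sum_U energy_alt[symmetric]
          dens_mult sum_V)
  qed
  then show ?thesis
    by (simp add: sum.distrib sum_subtractf sum_distrib_left[symmetric] sum_distrib_right[symmetric]
      sum_U sum_V energy_alt[symmetric])
qed

text \<open>The density of \<open>V\<close> with respect to \<open>U\<close> on \<open>v x u\<close> is, in the mean square, close both
  to its value on \<open>v\<close> and to its value on \<open>u\<close>; as \<open>v\<close> and \<open>u\<close> are nearly independent, it is
  nearly constant.\<close>

lemma energy_gap:
  assumes "0 < n"
  shows "c * (energy n - 1) \<le> 2 * (energy (n + 1 + n) - energy n)"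
proof -
  let ?g = "\<lambda>v x u. U (v @ [x] @ u)"
  have L: "(\<Sum>v\<in>words n. \<Sum>x=1..3. \<Sum>u\<in>words n. ?g v x u * (dens (v @ [x] @ u) - dens v)\<^sup>2)
      = energy (n + 1 + n) - energy n"
    using energy_diff_left[where m=n and n="1 + n", unfolded sum_words_append[of _ 1 n] sum_words_1]
    by (simp only: add.assoc)
  have R: "(\<Sum>v\<in>words n. \<Sum>x=1..3. \<Sum>u\<in>words n. ?g v x u * (dens (v @ [x] @ u) - dens u)\<^sup>2)
      = energy (n + 1 + n) - energy n"
    using energy_diff_right[where m="n + 1" and n=n, unfolded sum_words_append[of _ n 1] sum_words_1]
    by (simp only: append_assoc)
  have ineq: "p * (a - b)\<^sup>2 \<le> 2 * (p * (d - a)\<^sup>2) + 2 * (p * (d - b)\<^sup>2)" if "0 \<le> p" for p a b d :: real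
  proof -
    have "(a - b)\<^sup>2 \<le> 2 * (d - a)\<^sup>2 + 2 * (d - b)\<^sup>2"
      using zero_le_power2[of "(d - a) + (d - b)"] by (simp add: power2_eq_square algebra_simps)
    from mult_left_mono[OF this that] show ?thesis by (simp add: algebra_simps)
  qed
  have "2 * c * (energy n - 1)
      = (\<Sum>v\<in>words n. \<Sum>u\<in>words n. (c * U v * U u) * (dens v - dens u)\<^sup>2)"
    using variance_identity[of n] by (simp add: sum_distrib_left[symmetric] mult.assoc)
  also have "\<dots> \<le> (\<Sum>v\<in>words n. \<Sum>u\<in>words n. (\<Sum>x=1..3. ?g v x u) * (dens v - dens u)\<^sup>2)"
    using assms by (intro sum_mono mult_right_mono quasi_bernoulli) (auto simp: words_def)
  also have "\<dots> = (\<Sum>v\<in>words n. \<Sum>x=1..3. \<Sum>u\<in>words n. ?g v x u * (dens v - dens u)\<^sup>2)"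
    unfolding sum_distrib_right by (intro sum.cong[OF refl] sum.swap)
  also have "\<dots> \<le> (\<Sum>v\<in>words n. \<Sum>x=1..3. \<Sum>u\<in>words n.
      2 * (?g v x u * (dens (v @ [x] @ u) - dens v)\<^sup>2) + 2 * (?g v x u * (dens (v @ [x] @ u) - dens u)\<^sup>2))"
    by (intro sum_mono ineq U_nonneg)
  also have "\<dots> = 4 * (energy (n + 1 + n) - energy n)"
    unfolding sum.distrib sum_distrib_left[symmetric] L R by simp
  finally show ?thesis by simp
qed

text \<open>The energies increase and are bounded, so they have a limit \<open>e\<close>. Along
  lengths k and 2 k + 1 the right side of \<open>energy_gap\<close> tends to 0, which leaves
  \<open>c * (e - 1) \<le> 0\<close>. The lower bound 1 is the nonnegativity of the
  variance.\<close>

lemma energy_eq_1: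
  assumes "0 < n"
  shows "energy n = 1"
proof -
  have "incseq (\<lambda>k. energy (k + n))"
    by (auto simp: incseq_def intro: energy_mono)
  moreover have "\<And>k. energy (k + n) \<le> K" using assms by (intro energy_le) auto
  ultimately obtain e where e: "(\<lambda>k. energy (k + n)) \<longlonglongrightarrow> e"
    using incseq_convergent by blast
  then have e': "energy \<longlonglongrightarrow> e" by (rule LIMSEQ_offset)
  have "(\<lambda>k. energy (k + 1 + k)) \<longlonglongrightarrow> e"
    using LIMSEQ_subseq_LIMSEQ[OF e', of "\<lambda>k. k + 1 + k"] by (simp add: strict_mono_def o_def)
  then have "(\<lambda>k. 2 * (energy (k + 1 + k) - energy k)) \<longlonglongrightarrow> 2 * (e - e)"
    by (intro tendsto_intros e')
  moreover have "(\<lambda>k. c * (energy k - 1)) \<longlonglongrightarrow> c * (e - 1)"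
    by (intro tendsto_intros e')
  moreover have "\<exists>N. \<forall>k\<ge>N. c * (energy k - 1) \<le> 2 * (energy (k + 1 + k) - energy k)"
    using energy_gap by (intro exI[of _ 1]) auto
  ultimately have "c * (e - 1) \<le> 2 * (e - e)"
    by (meson LIMSEQ_le)
  then have "e \<le> 1" using c_pos by (simp add: mult_le_0_iff)
  moreover have "energy n \<le> e"
    using incseq_le[OF \<open>incseq _\<close> e, of 0] by simp
  moreover have "0 \<le> (\<Sum>v\<in>words n. \<Sum>u\<in>words n. U v * U u * (dens v - dens u)\<^sup>2)"
    by (intro sum_nonneg mult_nonneg_nonneg U_nonneg) auto
  then have "1 \<le> energy n" unfolding variance_identity by simp
  ultimately show ?thesis by simp
qed

text \<open>An energy of 1 means that the density has variance 0 around its mean 1.\<close>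

lemma V_eq_U:
  assumes "w \<in> words n"
  shows "V w = U w"
proof (cases "n = 0")
  case True
  then show ?thesis using assms U_Nil V_Nil by (simp add: words_def)
next
  case False
  have "(\<Sum>w\<in>words n. U w * (dens w - 1)\<^sup>2) = 0"
    using energy_eq_1[of n] False unfolding square_expand
    by (simp add: sum.distrib sum_subtractf sum_distrib_left[symmetric] energy_alt[symmetric] sum_U sum_V)
  then have "U w * (dens w - 1)\<^sup>2 = 0"
    using assms by (subst (asm) sum_nonneg_eq_0_iff) (auto intro: mult_nonneg_nonneg U_nonneg)
  then show ?thesis using dens_mult[of w] by auto
qed

end

section \<open>Letters and admissible sequences\<close>

lemma alphabet: "(i::nat) \<in> {1..3} \<longleftrightarrow> i = 1 \<or> i = 2 \<or> i = 3"
  by auto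

lemma matA_eq_1_iff: "i \<in> {1..3} \<Longrightarrow> j \<in> {1..3} \<Longrightarrow> matA i j = 1 \<longleftrightarrow> i \<noteq> j"
  unfolding alphabet by (elim disjE) (simp_all add: matA_def)

lemma SigmaA_iff: "\<omega> \<in> SigmaA \<longleftrightarrow> (\<forall>n. \<omega> n \<in> {1..3} \<and> \<omega> n \<noteq> \<omega> (Suc n))"
proof
  assume "\<omega> \<in> SigmaA"
  then have m: "\<omega> n \<in> {1..3}" and a: "matA (\<omega> n) (\<omega> (Suc n)) = 1" for n
    unfolding SFT_def by blast+
  have "\<omega> n \<noteq> \<omega> (Suc n)" for n
    using a[of n] unfolding matA_eq_1_iff[OF m m] .
  with m show "\<forall>n. \<omega> n \<in> {1..3} \<and> \<omega> n \<noteq> \<omega> (Suc n)" by blast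
next
  assume *: "\<forall>n. \<omega> n \<in> {1..3} \<and> \<omega> n \<noteq> \<omega> (Suc n)"
  then have m: "\<omega> n \<in> {1..3}" for n by blast
  have "matA (\<omega> n) (\<omega> (Suc n)) = 1" for n
    unfolding matA_eq_1_iff[OF m m] using * by blast
  with m show "\<omega> \<in> SigmaA" unfolding SFT_def by blast
qed

lemma SigmaA_mem: "\<omega> \<in> SigmaA \<Longrightarrow> \<omega> n \<in> {1..3}"
  unfolding SigmaA_iff by blast

lemma SigmaA_neq: "\<omega> \<in> SigmaA \<Longrightarrow> \<omega> n \<noteq> \<omega> (Suc n)"
  unfolding SigmaA_iff by blast

lemma shift_pow: "(shift ^^ k) \<omega> n = \<omega> (n + k)"
  by (induction k arbitrary: n) (simp_all add: shift_def)

lemma shift_pow_SigmaA: "\<omega> \<in> SigmaA \<Longrightarrow> (shift ^^ k) \<omega> \<in> SigmaA"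
  unfolding SigmaA_iff shift_pow by simp

lemma shift_SigmaA: "\<omega> \<in> SigmaA \<Longrightarrow> shift \<omega> \<in> SigmaA"
  unfolding SigmaA_iff shift_def by simp

subsection \<open>Comparison of Bowen entropies\<close>

lemma cover_sumsI:
  fixes I :: "nat set"
  assumes "Z \<subseteq> (\<Union>i\<in>I. cylinder S (m i) (w i))" "\<forall>i\<in>I. w i \<in> S \<and> n \<le> m i"
  shows "(\<Sum>\<^sub>\<infinity>i\<in>I. ennreal (exp (- s * real (m i)))) \<in> cover_sums S Z s n"
  unfolding cover_sums_def mem_Collect_eq
  by (intro exI[of _ I] exI[of _ m] exI[of _ w] conjI refl assms)

text \<open>A cover of \<open>Z'\<close> is pulled back along \<Psi>: all points of \<open>Z\<close>
  that are mapped into one cylinder of length \<open>m\<close> share their first \<open>r m\<close>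
  letters, so they lie in one cylinder of that length. By \<open>r\<close>, no summand grows when
  \<open>s\<close> is replaced by \<open>s'\<close>.\<close>

lemma cover_sums_image_le:
  fixes r :: "nat \<Rightarrow> nat"
  assumes Z: "Z \<subseteq> S" and maps: "\<Psi> ` Z \<subseteq> Z'"
    and agree: "\<And>\<omega> \<omega>' n. \<omega> \<in> Z \<Longrightarrow> \<omega>' \<in> Z \<Longrightarrow> \<forall>k<n. \<Psi> \<omega> k = \<Psi> \<omega>' k \<Longrightarrow> \<forall>k<r n. \<omega> k = \<omega>' k"
    and r: "\<And>m. N \<le> m \<Longrightarrow> n \<le> r m \<and> s * real m \<le> s' * real (r m)"
    and T: "T \<in> cover_sums S Z' s N"
  shows "Inf (cover_sums S Z s' n) \<le> T"
proof -
  from T obtain I :: "nat set" and m w where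
    T_eq: "T = (\<Sum>\<^sub>\<infinity>i\<in>I. ennreal (exp (- s * real (m i))))"
    and mw: "\<And>i. i \<in> I \<Longrightarrow> w i \<in> S \<and> N \<le> m i"
    and cov: "Z' \<subseteq> (\<Union>i\<in>I. cylinder S (m i) (w i))"
    unfolding cover_sums_def by blast
  \<comment> \<open>The new cylinders are centred at points of \<open>Z\<close>, so cylinders that
    meet no image point are dropped.\<close>
  define J where "J = {i \<in> I. \<exists>\<omega>\<in>Z. \<Psi> \<omega> \<in> cylinder S (m i) (w i)}"
  define v where "v i = (SOME \<omega>. \<omega> \<in> Z \<and> \<Psi> \<omega> \<in> cylinder S (m i) (w i))" for i
  have v: "v i \<in> Z \<and> \<Psi> (v i) \<in> cylinder S (m i) (w i)" if "i \<in> J" for i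
    unfolding v_def using that by (intro someI_ex[where P = "\<lambda>\<omega>. \<omega> \<in> Z \<and> \<Psi> \<omega> \<in> cylinder S (m i) (w i)"])
      (auto simp: J_def)
  have "Z \<subseteq> (\<Union>i\<in>J. cylinder S (r (m i)) (v i))"
  proof
    fix \<omega> assume \<omega>: "\<omega> \<in> Z"
    then obtain i where i: "i \<in> I" "\<Psi> \<omega> \<in> cylinder S (m i) (w i)" using maps cov by blast
    then have "i \<in> J" using \<omega> by (auto simp: J_def)
    moreover have "\<forall>k<r (m i). \<omega> k = v i k"
      using v[OF \<open>i \<in> J\<close>] i by (intro agree \<omega>) (auto simp: cylinder_def)
    ultimately show "\<omega> \<in> (\<Union>i\<in>J. cylinder S (r (m i)) (v i))"
      using \<omega> Z by (auto simp: cylinder_def)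
  qed
  moreover have "\<forall>i\<in>J. v i \<in> S \<and> n \<le> r (m i)"
    using v mw r Z by (auto simp: J_def)
  ultimately have "(\<Sum>\<^sub>\<infinity>i\<in>J. ennreal (exp (- s' * real (r (m i))))) \<in> cover_sums S Z s' n"
    by (rule cover_sumsI)
  then have "Inf (cover_sums S Z s' n) \<le> (\<Sum>\<^sub>\<infinity>i\<in>J. ennreal (exp (- s' * real (r (m i)))))"
    by (rule Inf_lower)
  also have "\<dots> \<le> (\<Sum>\<^sub>\<infinity>i\<in>I. ennreal (exp (- s * real (m i))))"
  proof (rule infsum_mono_neutral)
    show "ennreal (exp (- s' * real (r (m i)))) \<le> ennreal (exp (- s * real (m i)))" if "i \<in> J \<inter> I" for i
      using r[of "m i"] mw[of i] that by (intro ennreal_leI) auto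
  qed (auto simp: J_def nonneg_summable_on_complete)
  finally show ?thesis unfolding T_eq .
qed

lemma card_prefixes_le: "finite ((\<lambda>\<omega>. map \<omega> [0..<n]) ` SigmaA)"
  "card ((\<lambda>\<omega>. map \<omega> [0..<n]) ` SigmaA) \<le> 3 ^ n"
proof -
  let ?L = "{w. set w \<subseteq> {1..3::nat} \<and> length w = n}"
  have sub: "(\<lambda>\<omega>. map \<omega> [0..<n]) ` SigmaA \<subseteq> ?L"
    using SigmaA_mem by fastforce
  have "finite ?L" by (intro finite_lists_length_eq) simp
  with sub show "finite ((\<lambda>\<omega>. map \<omega> [0..<n]) ` SigmaA)" by (rule finite_subset)
  have "card ?L = 3 ^ n" using card_lists_length_eq[of "{1..3::nat}" n] by simp
  then show "card ((\<lambda>\<omega>. map \<omega> [0..<n]) ` SigmaA) \<le> 3 ^ n"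
    using card_mono[OF \<open>finite ?L\<close> sub] by simp
qed

text \<open>Shows that the infimum in \<open>bowen_entropy\<close> is taken over a nonempty set. At
  most \<open>3 ^ n\<close> cylinders of length \<open>n\<close> cover everything, so the exponent
  \<open>ln 4\<close> gives sums of at most \<open>(3 / 4) ^ n\<close>.\<close>

lemma Inf_cover_sums_ln_4:
  assumes "Z \<subseteq> SigmaA"
  shows "(\<lambda>n. Inf (cover_sums SigmaA Z (ln 4) n)) \<longlonglongrightarrow> 0"
proof -
  have le: "Inf (cover_sums SigmaA Z (ln 4) n) \<le> ennreal ((3 / 4) ^ n)" for n
  proof -
    let ?p = "\<lambda>\<omega>. map \<omega> [0..<n]"
    obtain e where e: "bij_betw e {0..<card (?p ` SigmaA)} (?p ` SigmaA)"
      using ex_bij_betw_nat_finite[OF card_prefixes_le(1)] by blast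
    let ?I = "{0..<card (?p ` SigmaA)}"
    define w where "w i = (SOME \<omega>. \<omega> \<in> SigmaA \<and> ?p \<omega> = e i)" for i
    have w: "w i \<in> SigmaA \<and> ?p (w i) = e i" if "i \<in> ?I" for i
    proof -
      have "e i \<in> ?p ` SigmaA" using bij_betwE[OF e] that by blast
      then have "\<exists>\<omega>. \<omega> \<in> SigmaA \<and> ?p \<omega> = e i" by (elim imageE) metis
      then show ?thesis unfolding w_def by (rule someI_ex)
    qed
    have "Z \<subseteq> (\<Union>i\<in>?I. cylinder SigmaA n (w i))"
    proof
      fix \<omega> assume "\<omega> \<in> Z"
      then have \<omega>: "\<omega> \<in> SigmaA" using assms by auto
      then have "?p \<omega> \<in> e ` ?I" using bij_betw_imp_surj_on[OF e] by blast
      then obtain i where i: "?p \<omega> = e i" "i \<in> ?I" by (rule imageE)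
      then have "?p (w i) = ?p \<omega>" using w[OF i(2)] by simp
      then have "\<forall>k<n. \<omega> k = w i k" by simp
      then have "\<omega> \<in> cylinder SigmaA n (w i)"
        using \<omega> unfolding cylinder_def by blast
      then show "\<omega> \<in> (\<Union>i\<in>?I. cylinder SigmaA n (w i))"
        using i(2) by blast
    qed
    moreover have "\<forall>i\<in>?I. w i \<in> SigmaA \<and> n \<le> n" using w by blast
    ultimately have "(\<Sum>\<^sub>\<infinity>i\<in>?I. ennreal (exp (- ln 4 * real n))) \<in> cover_sums SigmaA Z (ln 4) n"
      by (rule cover_sumsI)
    then have "Inf (cover_sums SigmaA Z (ln 4) n) \<le> (\<Sum>\<^sub>\<infinity>i\<in>?I. ennreal (exp (- ln 4 * real n)))"
      by (rule Inf_lower)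
    also have "\<dots> = ennreal (real (card (?p ` SigmaA)) * exp (- ln 4 * real n))"
      by (simp add: ennreal_mult ennreal_of_nat_eq_real_of_nat)
    also have "\<dots> \<le> ennreal (3 ^ n * (1 / 4) ^ n)"
    proof (intro ennreal_leI mult_mono)
      show "real (card (?p ` SigmaA)) \<le> 3 ^ n"
        using card_prefixes_le(2)[of n] by (metis of_nat_le_iff of_nat_numeral of_nat_power)
      have "exp (- ln 4 * real n) = (exp (- ln 4)) ^ n"
        by (simp add: exp_of_nat_mult[symmetric] mult.commute)
      then show "exp (- ln 4 * real n) \<le> (1 / 4) ^ n" by (simp add: exp_minus inverse_eq_divide)
    qed auto
    finally show ?thesis by (simp add: power_mult_distrib[symmetric])
  qed
  have "(\<lambda>n. ennreal ((3 / 4) ^ n)) \<longlonglongrightarrow> ennreal 0"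
    by (intro tendsto_ennrealI LIMSEQ_realpow_zero) auto
  then have lim: "(\<lambda>n. ennreal ((3 / 4) ^ n)) \<longlonglongrightarrow> 0" by simp
  show ?thesis
    by (rule tendsto_sandwich[OF _ _ tendsto_const lim]) (simp_all add: le)
qed

text \<open>\<Psi> loses only a vanishing fraction of the letters, so an exponent admissible for
  \<open>Z'\<close> is admissible for \<open>Z\<close> after an arbitrarily small increase. The map
  need be neither continuous nor onto; only the recovery of prefixes counts.\<close>

lemma bowen_entropy_le:
  fixes r :: "nat \<Rightarrow> nat"
  assumes Z: "Z \<subseteq> SigmaA" and Z': "Z' \<subseteq> SigmaA" and maps: "\<Psi> ` Z \<subseteq> Z'"
    and agree: "\<And>\<omega> \<omega>' n. \<omega> \<in> Z \<Longrightarrow> \<omega>' \<in> Z \<Longrightarrow> \<forall>k<n. \<Psi> \<omega> k = \<Psi> \<omega>' k \<Longrightarrow> \<forall>k<r n. \<omega> k = \<omega>' k"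
    and r: "(\<lambda>n. real (r n) / real n) \<longlonglongrightarrow> 1"
  shows "bowen_entropy SigmaA Z \<le> bowen_entropy SigmaA Z'"
proof -
  let ?H = "\<lambda>Z. {s. 0 \<le> s \<and> (\<lambda>n. Inf (cover_sums SigmaA Z s n)) \<longlonglongrightarrow> 0}"
  have bdd: "bdd_below (?H Z)" by (rule bdd_belowI[of _ 0]) simp
  have ne: "?H Z' \<noteq> {}" using Inf_cover_sums_ln_4[OF Z'] by fastforce
  have key: "s' \<in> ?H Z" if s: "s \<in> ?H Z'" and "s < s'" for s s'
  proof -
    have "0 \<le> s" using s by simp
    then have "0 < s'" using \<open>s < s'\<close> by simp
    have "Inf (cover_sums SigmaA Z s' n) = 0" for n
    proof -
      \<comment> \<open>The bound \<open>s / s'\<close> yields \<open>s * m \<le> s' * r m\<close>;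
        the bound 1 / 2 makes \<open>r m\<close> at least \<open>n\<close> once \<open>m\<close> is
        at least \<open>2 * n\<close>.\<close>
      define t where "t = max (s / s') (1 / 2)"
      have "t < 1" using \<open>0 \<le> s\<close> \<open>s < s'\<close> by (simp add: t_def)
      then have "\<forall>\<^sub>F m in sequentially. t < real (r m) / real m"
        by (rule order_tendstoD(1)[OF r])
      moreover have "\<forall>\<^sub>F m in sequentially. max 1 (2 * n) \<le> m"
        by (rule eventually_ge_at_top)
      ultimately have "\<forall>\<^sub>F m in sequentially. n \<le> r m \<and> s * real m \<le> s' * real (r m)"
      proof eventually_elim
        fix m assume m: "t < real (r m) / real m" "max 1 (2 * n) \<le> m"
        then have "t * real m < real (r m)" by (simp add: pos_less_divide_eq)
        moreover have "s / s' \<le> t" "1 / 2 \<le> t" by (auto simp: t_def)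
        then have "s / s' * real m \<le> t * real m" "1 / 2 * real m \<le> t * real m"
          by (intro mult_right_mono; simp)+
        ultimately have "s / s' * real m < real (r m)" "1 / 2 * real m < real (r m)" by linarith+
        then have "s * real m \<le> s' * real (r m)" "real m < 2 * real (r m)"
          using \<open>0 < s'\<close> by (auto simp: field_simps)
        then show "n \<le> r m \<and> s * real m \<le> s' * real (r m)" using m by auto
      qed
      then obtain N where N: "\<And>m. N \<le> m \<Longrightarrow> n \<le> r m \<and> s * real m \<le> s' * real (r m)"
        by (auto simp: eventually_sequentially)
      have "Inf (cover_sums SigmaA Z s' n) \<le> Inf (cover_sums SigmaA Z' s M)" if "N \<le> M" for M
        using that N
        by (intro Inf_greatest cover_sums_image_le[OF Z maps agree, where N = M]) auto
      then have "\<forall>\<^sub>F M in sequentially. Inf (cover_sums SigmaA Z s' n) \<le> Inf (cover_sums SigmaA Z' s M)"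
        by (auto simp: eventually_sequentially)
      then have "Inf (cover_sums SigmaA Z s' n) \<le> 0"
        using s by (intro tendsto_lowerbound) auto
      then show ?thesis by simp
    qed
    then show ?thesis using \<open>0 < s'\<close> by simp
  qed
  show ?thesis
    unfolding bowen_entropy_def
  proof (rule cInf_greatest[OF ne])
    fix s assume s: "s \<in> ?H Z'"
    show "Inf (?H Z) \<le> s"
      by (rule dense_ge) (rule cInf_lower[OF key[OF s] bdd])
  qed
qed

section \<open>Birkhoff averages of functions of two letters\<close>

definition birkhoff :: "(nat \<Rightarrow> nat \<Rightarrow> real) \<Rightarrow> (nat \<Rightarrow> nat) \<Rightarrow> nat \<Rightarrow> real" where
  "birkhoff a \<omega> n = (\<Sum>k<n. a (\<omega> k) (\<omega> (Suc k)))"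

definition average_set :: "(nat \<Rightarrow> nat \<Rightarrow> real) \<Rightarrow> real \<Rightarrow> (nat \<Rightarrow> nat) set" where
  "average_set a \<alpha> = {\<omega> \<in> SigmaA. (\<lambda>n. birkhoff a \<omega> n / real n) \<longlonglongrightarrow> \<alpha>}"

subsection \<open>Reversal of blocks\<close>

definition connector :: "nat \<Rightarrow> nat \<Rightarrow> nat" where
  "connector i j = (SOME k. k \<in> {1..3} \<and> k \<noteq> i \<and> k \<noteq> j)"

lemma connector: "connector i j \<in> {1..3} \<and> connector i j \<noteq> i \<and> connector i j \<noteq> j"
proof -
  have "\<exists>k\<in>{1, 2, 3}. k \<noteq> i \<and> k \<noteq> j" by auto
  then have "\<exists>k. k \<in> {1..3} \<and> k \<noteq> i \<and> k \<noteq> j" unfolding alphabet by blast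
  then show ?thesis unfolding connector_def by (rule someI_ex)
qed

text \<open>The number of the output block that contains position \<open>t\<close>. Block
  \<open>i\<close> takes 2 i + 2 positions, its connector included, so the blocks before block
  \<open>k\<close> fill 2 + 4 + ... + 2 k = k (k + 1) positions.\<close>

definition block :: "nat \<Rightarrow> nat" where
  "block t = (LEAST k. t < (k + 1) * (k + 2))"

lemma block: "block t * (block t + 1) \<le> t" "t < (block t + 1) * (block t + 2)"
proof -
  have "t < (t + 1) * (t + 2)" by simp
  then show *: "t < (block t + 1) * (block t + 2)"
    unfolding block_def by (rule LeastI)
  show "block t * (block t + 1) \<le> t"
  proof (cases "block t")
    case (Suc k)
    then have "\<not> t < (k + 1) * (k + 2)"
      using not_less_Least[of k "\<lambda>k. t < (k + 1) * (k + 2)"] by (simp add: block_def)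
    then show ?thesis using Suc by simp
  qed simp
qed

lemma block_eqI:
  assumes "j < 2 * k + 2"
  shows "block (k * (k + 1) + j) = k"
  unfolding block_def
proof (rule Least_equality)
  show "k * (k + 1) + j < (k + 1) * (k + 2)" using assms by (simp add: algebra_simps)
  fix i assume i: "k * (k + 1) + j < (i + 1) * (i + 2)"
  show "k \<le> i"
  proof (rule ccontr)
    assume "\<not> k \<le> i"
    then have "(i + 1) * (i + 2) \<le> k * (k + 1)" by (intro mult_le_mono) auto
    with i show False by simp
  qed
qed

text \<open>The block of \<open>\<omega>\<close> at the positions from \<open>k\<^sup>2\<close> to \<open>k\<^sup>2 + 2 k\<close> is written backwards
  from position \<open>k (k + 1)\<close> on, followed by one letter that makes the transition to the next
  block admissible.\<close>

definition rev_blocks :: "(nat \<Rightarrow> nat) \<Rightarrow> nat \<Rightarrow> nat" where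
  "rev_blocks \<omega> t = (let k = block t; j = t - k * (k + 1) in
     if j \<le> 2 * k then \<omega> (k\<^sup>2 + (2 * k - j)) else connector (\<omega> (k\<^sup>2)) (\<omega> ((k + 1)\<^sup>2 + 2 * (k + 1))))"

lemma rev_blocks_letter: "j \<le> 2 * k \<Longrightarrow> rev_blocks \<omega> (k * (k + 1) + j) = \<omega> (k\<^sup>2 + (2 * k - j))"
  by (simp only: rev_blocks_def block_eqI Let_def) simp

lemma rev_blocks_connector:
  "rev_blocks \<omega> (k * (k + 1) + (2 * k + 1)) = connector (\<omega> (k\<^sup>2)) (\<omega> ((k + 1)\<^sup>2 + 2 * (k + 1)))"
  by (simp only: rev_blocks_def block_eqI Let_def) simp

lemma block_cases:
  fixes t :: nat
  obtains k j :: nat where "t = k * (k + 1) + j" "j < 2 * k + 2"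
proof
  show "t = block t * (block t + 1) + (t - block t * (block t + 1))"
    using block[of t] by simp
  show "t - block t * (block t + 1) < 2 * block t + 2"
    using block[of t] by (simp add: algebra_simps)
qed

text \<open>Within a block, neighbours in the output are neighbours in \<omega> in the opposite
  order, and the transition rule is symmetric. At a seam, the connector differs from the letter
  written last in block \<open>k\<close> and from the letter written first in block
  \<open>k + 1\<close>.\<close>

lemma rev_blocks_SigmaA:
  assumes \<omega>: "\<omega> \<in> SigmaA"
  shows "rev_blocks \<omega> \<in> SigmaA"
  unfolding SigmaA_iff
proof
  fix t :: nat
  obtain k j where t: "t = k * (k + 1) + j" and j: "j < 2 * k + 2" by (rule block_cases)
  consider "j < 2 * k" | "j = 2 * k" | "j = 2 * k + 1" using j by linarith
  then show "rev_blocks \<omega> t \<in> {1..3} \<and> rev_blocks \<omega> t \<noteq> rev_blocks \<omega> (Suc t)"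
  proof cases
    case 1
    have e: "2 * k - j = Suc (2 * k - Suc j)" using 1 by simp
    have "rev_blocks \<omega> t = \<omega> (Suc (k\<^sup>2 + (2 * k - Suc j)))"
      unfolding t by (subst rev_blocks_letter) (use 1 in \<open>simp_all add: e\<close>)
    moreover have "rev_blocks \<omega> (Suc t) = \<omega> (k\<^sup>2 + (2 * k - Suc j))"
      using rev_blocks_letter[of "Suc j" k \<omega>] 1 by (simp add: t)
    ultimately show ?thesis using SigmaA_mem[OF \<omega>] SigmaA_neq[OF \<omega>] by metis
  next
    case 2
    have "rev_blocks \<omega> t = \<omega> (k\<^sup>2)"
      using rev_blocks_letter[of j k \<omega>] 2 by (simp add: t)
    moreover have "rev_blocks \<omega> (Suc t) = connector (\<omega> (k\<^sup>2)) (\<omega> ((k + 1)\<^sup>2 + 2 * (k + 1)))"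
      using rev_blocks_connector[of \<omega> k] 2 by (simp add: t)
    ultimately show ?thesis using SigmaA_mem[OF \<omega>] connector by metis
  next
    case 3
    have "rev_blocks \<omega> t = connector (\<omega> (k\<^sup>2)) (\<omega> ((k + 1)\<^sup>2 + 2 * (k + 1)))"
      unfolding t 3 by (rule rev_blocks_connector)
    moreover have "Suc t = (k + 1) * (k + 1 + 1) + 0"
      unfolding t 3 by (simp add: algebra_simps)
    then have "rev_blocks \<omega> (Suc t) = \<omega> ((k + 1)\<^sup>2 + 2 * (k + 1))"
      using rev_blocks_letter[of 0 "k + 1" \<omega>] by simp
    ultimately show ?thesis using connector by metis
  qed
qed

text \<open>The first \<open>n\<close> output letters contain the blocks before
  \<open>block n\<close> completely, and these blocks together display the first
  \<open>(block n)\<^sup>2\<close> letters of \<omega>.\<close>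

lemma rev_blocks_agree:
  assumes agree: "\<forall>t<n. rev_blocks \<omega> t = rev_blocks \<omega>' t"
  shows "\<forall>p<(block n)\<^sup>2. \<omega> p = \<omega>' p"
proof (intro allI impI)
  fix p assume p: "p < (block n)\<^sup>2"
  \<comment> \<open>The block of \<omega> that contains position \<open>p\<close>; below,
    \<open>j\<close> is the place of that letter in the reversed block.\<close>
  define i where "i = floor_sqrt p"
  have i: "i\<^sup>2 \<le> p" "p < (Suc i)\<^sup>2"
    unfolding i_def by (rule floor_sqrt_power2_le, rule Suc_floor_sqrt_power2_gt)
  have "i < block n"
    using order.strict_trans1[OF i(1) p] by (rule power_less_imp_less_base) simp
  define j where "j = 2 * i - (p - i\<^sup>2)"
  have r: "p - i\<^sup>2 \<le> 2 * i" using i by (simp add: power2_eq_square)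
  have j: "j \<le> 2 * i" "i\<^sup>2 + (2 * i - j) = p"
    using r i(1) by (auto simp: j_def)
  have "i * (i + 1) + j < (i + 1) * (i + 2)" using j by (simp add: algebra_simps)
  also have "\<dots> \<le> block n * (block n + 1)"
    using \<open>i < block n\<close> by (intro mult_le_mono) auto
  also have "\<dots> \<le> n" by (rule block)
  finally show "\<omega> p = \<omega>' p"
    using agree rev_blocks_letter[OF j(1), of \<omega>] rev_blocks_letter[OF j(1), of \<omega>'] j(2) by simp
qed

lemma birkhoff_add: "birkhoff a \<omega> (m + n) = birkhoff a \<omega> m + (\<Sum>k<n. a (\<omega> (m + k)) (\<omega> (Suc (m + k))))"
  unfolding birkhoff_def by (induction n) auto

text \<open>The transposed function gives a transition traversed backwards its original value, so
  whole blocks contribute equally. Each block adds three unmatched terms: the transitions into and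
  out of the connector, and the transition of \<omega> to its next block.\<close>

lemma birkhoff_rev_blocks:
  assumes A: "\<And>i j. \<bar>a i j\<bar> \<le> A"
  shows "\<bar>birkhoff (\<lambda>i j. a j i) (rev_blocks \<omega>) (k * (k + 1)) - birkhoff a \<omega> (k\<^sup>2)\<bar> \<le> 3 * A * real k"
proof (induction k)
  case (Suc k)
  let ?\<Psi> = "rev_blocks \<omega>" and ?b = "\<lambda>i j. a j i" and ?s = "k * (k + 1)"
  have e1: "Suc k * (Suc k + 1) = ?s + (2 * k + 2)" and e2: "(Suc k)\<^sup>2 = k\<^sup>2 + (2 * k + 1)"
    by (simp_all add: power2_eq_square)
  have "(\<Sum>j<2 * k. ?b (?\<Psi> (?s + j)) (?\<Psi> (Suc (?s + j))))
      = (\<Sum>j<2 * k. a (\<omega> (k\<^sup>2 + (2 * k - Suc j))) (\<omega> (Suc (k\<^sup>2 + (2 * k - Suc j)))))"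
  proof (intro sum.cong refl)
    fix j assume "j \<in> {..<2 * k}"
    then have j: "j < 2 * k" by simp
    then have e: "2 * k - j = Suc (2 * k - Suc j)" by simp
    show "?b (?\<Psi> (?s + j)) (?\<Psi> (Suc (?s + j)))
      = a (\<omega> (k\<^sup>2 + (2 * k - Suc j))) (\<omega> (Suc (k\<^sup>2 + (2 * k - Suc j))))"
      using rev_blocks_letter[of j k \<omega>] rev_blocks_letter[of "Suc j" k \<omega>] j by (simp add: e)
  qed
  also have "\<dots> = (\<Sum>j<2 * k. a (\<omega> (k\<^sup>2 + j)) (\<omega> (Suc (k\<^sup>2 + j))))"
    by (rule sum.nat_diff_reindex[of "\<lambda>j. a (\<omega> (k\<^sup>2 + j)) (\<omega> (Suc (k\<^sup>2 + j)))"])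
  finally have "birkhoff ?b ?\<Psi> (Suc k * (Suc k + 1)) - birkhoff a \<omega> ((Suc k)\<^sup>2)
    = (birkhoff ?b ?\<Psi> ?s - birkhoff a \<omega> (k\<^sup>2))
      + ?b (?\<Psi> (?s + 2 * k)) (?\<Psi> (Suc (?s + 2 * k)))
      + ?b (?\<Psi> (?s + Suc (2 * k))) (?\<Psi> (Suc (?s + Suc (2 * k))))
      - a (\<omega> (k\<^sup>2 + 2 * k)) (\<omega> (Suc (k\<^sup>2 + 2 * k)))"
    unfolding e1 e2 birkhoff_add by simp
  moreover have "\<bar>x + p + q - r\<bar> \<le> 3 * A * real (Suc k)"
    if "\<bar>x\<bar> \<le> 3 * A * real k" "\<bar>p\<bar> \<le> A" "\<bar>q\<bar> \<le> A" "\<bar>r\<bar> \<le> A" for x p q r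
    using that by (simp add: algebra_simps abs_le_iff)
  ultimately show ?case using Suc A by simp
qed (simp add: birkhoff_def)

text \<open>With \<open>k = block n\<close>, the bounds
  \<open>k * (k + 1) \<le> n < (k + 1) * (k + 2)\<close> place \<open>n\<close> between
  \<open>k\<^sup>2\<close> and \<open>k\<^sup>2 + 3 * k + 2\<close>.\<close>

lemma block_asymp: "(\<lambda>n. real ((block n)\<^sup>2) / real n) \<longlonglongrightarrow> 1" "(\<lambda>n. real (block n) / real n) \<longlonglongrightarrow> 0"
  "filterlim block at_top sequentially"
proof -
  have le: "(real (block n))\<^sup>2 \<le> real n" for n
  proof -
    have "(block n)\<^sup>2 \<le> n"
      using block(1)[of n] by (simp add: power2_eq_square)
    then show ?thesis by (metis of_nat_le_iff of_nat_power)
  qed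
  have ge: "real n \<le> (real (block n))\<^sup>2 + 3 * real (block n) + 2" for n
    using less_imp_le[OF block(2)[of n], THEN of_nat_mono[where 'a = real]]
    by (simp add: power2_eq_square algebra_simps)
  have b: "real (block n) \<le> sqrt (real n)" for n
    using le[of n] by (intro real_le_rsqrt)
  have s: "(\<lambda>n. sqrt (real n) / real n) \<longlonglongrightarrow> 0"
    by real_asymp
  show 0: "(\<lambda>n. real (block n) / real n) \<longlonglongrightarrow> 0"
    by (rule tendsto_sandwich[OF _ _ tendsto_const s])
      (auto intro!: always_eventually divide_right_mono b)
  have "(\<lambda>n. 1 - (3 * (real (block n) / real n) + 2 / real n)) \<longlonglongrightarrow> 1 - (3 * 0 + 0)"
    by (intro tendsto_intros 0 lim_const_over_n)
  then have l: "(\<lambda>n. 1 - (3 * (real (block n) / real n) + 2 / real n)) \<longlonglongrightarrow> 1" by simp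
  show "(\<lambda>n. real ((block n)\<^sup>2) / real n) \<longlonglongrightarrow> 1"
  proof (rule tendsto_sandwich[OF _ _ l tendsto_const])
    show "\<forall>\<^sub>F n in sequentially. 1 - (3 * (real (block n) / real n) + 2 / real n) \<le> real ((block n)\<^sup>2) / real n"
      using eventually_gt_at_top[of 0]
    proof eventually_elim
      case (elim n)
      have "1 - (3 * (real (block n) / real n) + 2 / real n)
          = (real n - (3 * real (block n) + 2)) / real n"
        using elim by (simp add: diff_divide_distrib add_divide_distrib)
      also have "\<dots> \<le> real ((block n)\<^sup>2) / real n"
        using ge[of n] by (intro divide_right_mono) auto
      finally show ?case .
    qed
    show "\<forall>\<^sub>F n in sequentially. real ((block n)\<^sup>2) / real n \<le> 1"
      using eventually_gt_at_top[of 0]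
      by eventually_elim (use le in \<open>simp add: field_simps\<close>)
  qed
  show "filterlim block at_top sequentially"
    unfolding filterlim_at_top
  proof
    fix K
    show "\<forall>\<^sub>F n in sequentially. K \<le> block n"
      using eventually_ge_at_top[of "(K + 1) * (K + 2)"]
    proof eventually_elim
      fix n assume n: "(K + 1) * (K + 2) \<le> n"
      show "K \<le> block n"
      proof (rule ccontr)
        assume "\<not> K \<le> block n"
        then have "(block n + 1) * (block n + 2) \<le> (K + 1) * (K + 2)" by (intro mult_le_mono) auto
        with n block(2)[of n] show False by linarith
      qed
    qed
  qed
qed

lemma rev_blocks_average:
  assumes A: "\<And>i j. \<bar>a i j\<bar> \<le> A" and \<omega>: "\<omega> \<in> average_set a \<alpha>"
  shows "rev_blocks \<omega> \<in> average_set (\<lambda>i j. a j i) \<alpha>"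
proof -
  let ?T = "birkhoff (\<lambda>i j. a j i) (rev_blocks \<omega>)" and ?S = "birkhoff a \<omega>"
  have A0: "0 \<le> A" using A[of 0 0] by linarith
  \<comment> \<open>Complete blocks cost \<open>3 * A * k\<close>, and the at most
    \<open>2 * k + 2\<close> transitions of the incomplete one cost \<open>A\<close> each.\<close>
  have err: "\<bar>?T n - ?S ((block n)\<^sup>2)\<bar> \<le> 5 * A * real (block n) + 2 * A" for n
  proof -
    define k where "k = block n"
    define d where "d = n - k * (k + 1)"
    have n: "n = k * (k + 1) + d" and d: "d \<le> 2 * k + 2"
      using block[of n] by (auto simp: k_def d_def algebra_simps)
    have "\<bar>?T n - ?T (k * (k + 1))\<bar> \<le> (\<Sum>j<d. A)"
    proof -
      let ?g = "\<lambda>j. a (rev_blocks \<omega> (Suc (k * (k + 1) + j))) (rev_blocks \<omega> (k * (k + 1) + j))"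
      have "\<bar>\<Sum>j<d. ?g j\<bar> \<le> (\<Sum>j<d. \<bar>?g j\<bar>)" by (rule sum_abs)
      also have "\<dots> \<le> (\<Sum>j<d. A)" by (intro sum_mono A)
      finally show ?thesis unfolding n birkhoff_add by simp
    qed
    also have "\<dots> \<le> A * real (2 * k + 2)"
      using d A0 by (simp add: mult.commute mult_left_mono del: of_nat_add of_nat_mult)
    finally show ?thesis
      using birkhoff_rev_blocks[of a A \<omega> k, OF A] unfolding k_def[symmetric]
      by (simp add: algebra_simps)
  qed
  have lim: "(\<lambda>n. ?S n / real n) \<longlonglongrightarrow> \<alpha>" and \<omega>S: "\<omega> \<in> SigmaA"
    using \<omega> by (auto simp: average_set_def)
  have "filterlim (\<lambda>n. (block n)\<^sup>2) at_top sequentially"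
    by (rule filterlim_at_top_mono[OF block_asymp(3)]) (auto simp: power2_nat_le_imp_le intro!: always_eventually le_square simp: power2_eq_square)
  from filterlim_compose[OF lim this]
  have "(\<lambda>n. ?S ((block n)\<^sup>2) / real ((block n)\<^sup>2) * (real ((block n)\<^sup>2) / real n)) \<longlonglongrightarrow> \<alpha> * 1"
    by (intro tendsto_mult block_asymp)
  \<comment> \<open>If \<open>block n = 0\<close>, the first quotient is 0 / 0 = 0 and the sum on
    the right is empty.\<close>
  moreover have "(\<lambda>n. ?S ((block n)\<^sup>2) / real ((block n)\<^sup>2) * (real ((block n)\<^sup>2) / real n) ) = (\<lambda>n. ?S ((block n)\<^sup>2) / real n)"
  proof
    show "?S ((block n)\<^sup>2) / real ((block n)\<^sup>2) * (real ((block n)\<^sup>2) / real n) = ?S ((block n)\<^sup>2) / real n" for n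
      by (cases "block n = 0") (simp_all add: birkhoff_def)
  qed
  ultimately have main: "(\<lambda>n. ?S ((block n)\<^sup>2) / real n) \<longlonglongrightarrow> \<alpha>"
    by (simp only: mult_1_right)
  have "(\<lambda>n. 5 * A * (real (block n) / real n) + 2 * A / real n) \<longlonglongrightarrow> 5 * A * 0 + 0"
    by (intro tendsto_intros block_asymp lim_const_over_n)
  then have b: "(\<lambda>n. 5 * A * (real (block n) / real n) + 2 * A / real n) \<longlonglongrightarrow> 0" by simp
  have "(\<lambda>n. ?T n / real n - ?S ((block n)\<^sup>2) / real n) \<longlonglongrightarrow> 0"
  proof (rule Lim_null_comparison[OF always_eventually b], rule allI)
    fix n
    have "\<bar>?T n - ?S ((block n)\<^sup>2)\<bar> / real n \<le> (5 * A * real (block n) + 2 * A) / real n"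
      by (intro divide_right_mono err) simp
    then show "norm (?T n / real n - ?S ((block n)\<^sup>2) / real n) \<le> 5 * A * (real (block n) / real n) + 2 * A / real n"
      by (simp add: diff_divide_distrib[symmetric] add_divide_distrib)
  qed
  from tendsto_add[OF this main] have "(\<lambda>n. ?T n / real n) \<longlonglongrightarrow> \<alpha>" by simp
  then show ?thesis using rev_blocks_SigmaA[OF \<omega>S] by (simp add: average_set_def)
qed

lemma average_set_SigmaA: "average_set a \<alpha> \<subseteq> SigmaA"
  by (auto simp: average_set_def)

lemma bowen_entropy_average_reverse_le:
  assumes A: "\<And>i j. \<bar>a i j\<bar> \<le> A"
  shows "bowen_entropy SigmaA (average_set a \<alpha>) \<le> bowen_entropy SigmaA (average_set (\<lambda>i j. a j i) \<alpha>)"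
proof (rule bowen_entropy_le[where \<Psi> = rev_blocks and r = "\<lambda>n. (block n)\<^sup>2"])
  show "rev_blocks ` average_set a \<alpha> \<subseteq> average_set (\<lambda>i j. a j i) \<alpha>"
    using rev_blocks_average[of a A, OF A] by blast
qed (use average_set_SigmaA rev_blocks_agree block_asymp(1) in \<open>auto simp del: of_nat_power\<close>)

text \<open>Transposing twice gives \<open>a\<close> back, so the inequality applies in both
  directions.\<close>

lemma bowen_entropy_average_reverse:
  assumes A: "\<And>i j. \<bar>a i j\<bar> \<le> A"
  shows "bowen_entropy SigmaA (average_set a \<alpha>) = bowen_entropy SigmaA (average_set (\<lambda>i j. a j i) \<alpha>)"
  using bowen_entropy_average_reverse_le[of a A] bowen_entropy_average_reverse_le[of "\<lambda>i j. a j i" A] A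
  by (intro order_antisym) auto

subsection \<open>Cylinders of words and the Borel sets\<close>

text \<open>Cylinders are indexed by words instead of points. Inadmissible words have empty
  cylinders, so that sums can run over all words of a given length.\<close>

definition wcyl :: "nat list \<Rightarrow> (nat \<Rightarrow> nat) set" where
  "wcyl w = {\<omega> \<in> SigmaA. \<forall>k<length w. \<omega> k = w ! k}"

lemma cylinder_eq_wcyl: "cylinder SigmaA n \<omega> = wcyl (map \<omega> [0..<n])"
  by (auto simp: cylinder_def wcyl_def)

lemma wcyl_subset: "wcyl w \<subseteq> SigmaA"
  by (auto simp: wcyl_def)

lemma wcyl_Nil [simp]: "wcyl [] = SigmaA"
  by (auto simp: wcyl_def)

lemma mem_wcyl_Cons: "\<omega> \<in> wcyl (x # w) \<longleftrightarrow> \<omega> \<in> SigmaA \<and> \<omega> 0 = x \<and> shift \<omega> \<in> wcyl w"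
proof -
  have "(\<forall>k<length (x # w). \<omega> k = (x # w) ! k) \<longleftrightarrow> \<omega> 0 = x \<and> (\<forall>k<length w. \<omega> (Suc k) = w ! k)"
    by (simp add: All_less_Suc2)
  then show ?thesis using shift_SigmaA by (auto simp: wcyl_def shift_def)
qed

lemma mem_wcyl_snoc: "\<omega> \<in> wcyl (w @ [x]) \<longleftrightarrow> \<omega> \<in> wcyl w \<and> \<omega> (length w) = x"
  by (auto simp: wcyl_def nth_append less_Suc_eq)

lemma mem_wcyl_prefix: "\<omega> \<in> SigmaA \<Longrightarrow> \<omega> \<in> wcyl (map \<omega> [0..<n])"
  by (simp add: wcyl_def)

lemma wcyl_eq_prefix: "\<omega> \<in> wcyl w \<Longrightarrow> map \<omega> [0..<length w] = w"
  by (auto simp: wcyl_def intro: nth_equalityI)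

lemma prefix_in_words: "\<omega> \<in> SigmaA \<Longrightarrow> map \<omega> [0..<n] \<in> words n"
  using SigmaA_mem by (fastforce simp: words_def)

lemma wcyl_empty: "w \<notin> words (length w) \<Longrightarrow> wcyl w = {}"
proof (rule ccontr)
  assume "w \<notin> words (length w)" "wcyl w \<noteq> {}"
  then obtain \<omega> where "\<omega> \<in> wcyl w" by blast
  then show False
    using prefix_in_words[of \<omega> "length w"] wcyl_eq_prefix[of \<omega> w] wcyl_subset \<open>w \<notin> _\<close> by auto
qed

lemma wcyl_inter: "wcyl v \<inter> wcyl w \<in> {wcyl v, wcyl w, {}}"
proof -
  have *: "wcyl v \<inter> wcyl w \<in> {wcyl v, {}}" if "length w \<le> length v" for v w
  proof (cases "\<forall>k<length w. v ! k = w ! k")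
    case True
    then have "wcyl v \<inter> wcyl w = wcyl v" using that by (auto simp: wcyl_def)
    then show ?thesis by simp
  next
    case False
    then have "wcyl v \<inter> wcyl w = {}" using that by (fastforce simp: wcyl_def)
    then show ?thesis by simp
  qed
  show ?thesis
    using *[of w v] *[of v w] by (cases "length w \<le> length v") (auto simp: Int_commute)
qed

text \<open>As 0 is not a letter, the empty set is itself a cylinder, which makes the family of
  cylinders stable under intersection.\<close>

lemma wcyl_0: "wcyl [0] = {}"
  by (rule wcyl_empty) (simp add: words_def)

lemma Int_stable_wcyl: "Int_stable (range wcyl)"
proof (rule Int_stableI)
  fix a b assume "a \<in> range wcyl" "b \<in> range wcyl"
  then obtain v w where "a = wcyl v" "b = wcyl w" by blast
  then have "a \<inter> b \<in> {wcyl v, wcyl w, wcyl [0]}" using wcyl_inter[of v w] by (simp only: wcyl_0)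
  then show "a \<inter> b \<in> range wcyl" by blast
qed

interpretation SigmaA: Metric_space SigmaA seq_dist
  by (rule Metric_space_SFT)

lemma seq_dist_less_imp_agree:
  assumes "\<omega> \<in> SigmaA" "\<omega>' \<in> SigmaA" "seq_dist \<omega> \<omega>' < 1 / 2 ^ n"
  shows "\<omega>' \<in> cylinder SigmaA n \<omega>"
proof -
  have "\<omega>' k = \<omega> k" if "k < n" for k
  proof (rule ccontr)
    assume "\<omega>' k \<noteq> \<omega> k"
    then have "1 \<le> \<bar>real (\<omega> k) - real (\<omega>' k)\<bar>" by linarith
    have "1 / 2 ^ n \<le> (1::real) / 2 ^ k" using that by (intro divide_left_mono power_increasing) auto
    also have "\<dots> \<le> \<bar>real (\<omega> k) - real (\<omega>' k)\<bar> / 2 ^ k"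
      by (intro divide_right_mono \<open>1 \<le> _\<close>) simp
    also have "\<dots> = (\<Sum>n\<in>{k}. \<bar>real (\<omega> n) - real (\<omega>' n)\<bar> / 2 ^ n)" by simp
    also have "\<dots> \<le> seq_dist \<omega> \<omega>'"
      unfolding seq_dist_def using assms by (intro finite_sum_le_infsum seq_dist_summable) auto
    finally show False using assms(3) by simp
  qed
  then show ?thesis using assms(2) by (simp add: cylinder_def)
qed

text \<open>Factoring 1 / 2 ^ k as (2 / 3) ^ k times (3 / 4) ^ k extracts a factor that tends to 0
  with \<open>n\<close> and leaves a series that still converges. The constant 3 bounds the
  difference of two letters.\<close>

lemma cylinder_imp_seq_dist_le:
  assumes "\<omega> \<in> SigmaA" "\<omega>' \<in> cylinder SigmaA n \<omega>"
  shows "seq_dist \<omega> \<omega>' \<le> (2 / 3) ^ n * (\<Sum>\<^sub>\<infinity>k. 3 * (3 / 4) ^ k)"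
proof -
  have \<omega>': "\<omega>' \<in> SigmaA" using assms by (simp add: cylinder_def)
  have "summable (\<lambda>k. norm (3 * (3 / 4) ^ k :: real))"
    by (simp add: norm_mult norm_power summable_mult summable_geometric)
  then have s: "(\<lambda>k. 3 * (3 / 4) ^ k :: real) summable_on UNIV"
    by (rule norm_summable_imp_summable_on)
  have "seq_dist \<omega> \<omega>' \<le> (\<Sum>\<^sub>\<infinity>k. (2 / 3) ^ n * (3 * (3 / 4) ^ k))"
    unfolding seq_dist_def
  proof (rule infsum_mono[OF seq_dist_summable[OF assms(1) \<omega>'] summable_on_cmult_right[OF s]])
    fix k :: nat
    show "\<bar>real (\<omega> k) - real (\<omega>' k)\<bar> / 2 ^ k \<le> (2 / 3) ^ n * (3 * (3 / 4) ^ k)"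
    proof (cases "k < n")
      case True
      then show ?thesis using assms(2) by (simp add: cylinder_def)
    next
      case False
      have "\<bar>real (\<omega> k) - real (\<omega>' k)\<bar> \<le> 3"
      proof -
        have "\<omega> k \<le> 3" "\<omega>' k \<le> 3" using SigmaA_mem assms(1) \<omega>' by auto
        then have "real (\<omega> k) \<le> 3" "real (\<omega>' k) \<le> 3" by linarith+
        then show ?thesis by linarith
      qed
      then have "\<bar>real (\<omega> k) - real (\<omega>' k)\<bar> / 2 ^ k \<le> 3 / 2 ^ k" by (rule divide_right_mono) simp
      also have "\<dots> = (2 / 3) ^ k * (3 * (3 / 4) ^ k)"
        by (simp add: power_divide field_simps flip: power_mult_distrib)
      also have "\<dots> \<le> (2 / 3) ^ n * (3 * (3 / 4) ^ k)"
        using False by (intro mult_right_mono power_decreasing) auto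
      finally show ?thesis .
    qed
  qed
  then show ?thesis by (simp only: infsum_cmult_right'[symmetric])
qed

lemma openin_seq_topology:
  "openin (seq_topology SigmaA) U \<longleftrightarrow> U \<subseteq> SigmaA \<and> (\<forall>\<omega>\<in>U. \<exists>n. cylinder SigmaA n \<omega> \<subseteq> U)"
proof (cases "U \<subseteq> SigmaA")
  case U: True
  have "(\<exists>r>0. SigmaA.mball \<omega> r \<subseteq> U) \<longleftrightarrow> (\<exists>n. cylinder SigmaA n \<omega> \<subseteq> U)" if \<omega>: "\<omega> \<in> SigmaA" for \<omega>
  proof
    assume "\<exists>r>0. SigmaA.mball \<omega> r \<subseteq> U"
    then obtain r where r: "0 < r" "SigmaA.mball \<omega> r \<subseteq> U" by blast
    have "(\<lambda>n. (2 / 3 :: real) ^ n * (\<Sum>\<^sub>\<infinity>k. 3 * (3 / 4) ^ k)) \<longlonglongrightarrow> 0 * (\<Sum>\<^sub>\<infinity>k. 3 * (3 / 4) ^ k)"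
      by (intro tendsto_intros LIMSEQ_power_zero) auto
    then have "(\<lambda>n. (2 / 3 :: real) ^ n * (\<Sum>\<^sub>\<infinity>k. 3 * (3 / 4) ^ k)) \<longlonglongrightarrow> 0" by simp
    from order_tendstoD(2)[OF this r(1)]
    obtain n where n: "(2 / 3 :: real) ^ n * (\<Sum>\<^sub>\<infinity>k. 3 * (3 / 4) ^ k) < r"
      by (auto simp: eventually_sequentially)
    have "cylinder SigmaA n \<omega> \<subseteq> SigmaA.mball \<omega> r"
    proof
      fix \<omega>' assume c: "\<omega>' \<in> cylinder SigmaA n \<omega>"
      show "\<omega>' \<in> SigmaA.mball \<omega> r"
        using cylinder_imp_seq_dist_le[OF \<omega> c] n c \<omega> by (simp add: cylinder_def)
    qed
    with r show "\<exists>n. cylinder SigmaA n \<omega> \<subseteq> U" by blast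
  next
    assume "\<exists>n. cylinder SigmaA n \<omega> \<subseteq> U"
    then obtain n where n: "cylinder SigmaA n \<omega> \<subseteq> U" by blast
    have "SigmaA.mball \<omega> (1 / 2 ^ n) \<subseteq> cylinder SigmaA n \<omega>"
      using seq_dist_less_imp_agree by auto
    with n show "\<exists>r>0. SigmaA.mball \<omega> r \<subseteq> U" by (intro exI[of _ "1 / 2 ^ n"]) auto
  qed
  then show ?thesis
    using U unfolding seq_topology_def SigmaA.openin_mtopology by blast
qed (simp add: seq_topology_def SigmaA.openin_mtopology)

lemma openin_wcyl: "openin (seq_topology SigmaA) (wcyl w)"
  unfolding openin_seq_topology
proof (intro conjI ballI wcyl_subset)
  fix \<omega> assume "\<omega> \<in> wcyl w"
  then have "cylinder SigmaA (length w) \<omega> = wcyl w" by (simp only: cylinder_eq_wcyl wcyl_eq_prefix)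
  then show "\<exists>n. cylinder SigmaA n \<omega> \<subseteq> wcyl w" by blast
qed

lemma space_seq_borel [simp]: "space (seq_borel S) = S"
  by (simp add: seq_borel_def space_measure_of_conv)

text \<open>There are countably many words, so an open set, being the union of the cylinders inside
  it, is a countable union of cylinders.\<close>

lemma sets_seq_borel: "sets (seq_borel SigmaA) = sigma_sets SigmaA (range wcyl)"
proof -
  have pow: "{U. openin (seq_topology SigmaA) U} \<subseteq> Pow SigmaA"
    by (auto simp: openin_seq_topology)
  have "sigma_sets SigmaA {U. openin (seq_topology SigmaA) U} = sigma_sets SigmaA (range wcyl)"
  proof (rule sigma_sets_eqI)
    fix U assume "U \<in> {U. openin (seq_topology SigmaA) U}"
    then have U: "U \<subseteq> SigmaA" "\<And>\<omega>. \<omega> \<in> U \<Longrightarrow> \<exists>n. cylinder SigmaA n \<omega> \<subseteq> U"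
      by (auto simp: openin_seq_topology)
    have "U = \<Union> (wcyl ` {w. wcyl w \<subseteq> U})"
    proof
      show "U \<subseteq> \<Union> (wcyl ` {w. wcyl w \<subseteq> U})"
      proof
        fix \<omega> assume "\<omega> \<in> U"
        then obtain n where "wcyl (map \<omega> [0..<n]) \<subseteq> U" using U(2) cylinder_eq_wcyl by metis
        moreover have "\<omega> \<in> wcyl (map \<omega> [0..<n])" using \<open>\<omega> \<in> U\<close> U(1) by (intro mem_wcyl_prefix) auto
        ultimately show "\<omega> \<in> \<Union> (wcyl ` {w. wcyl w \<subseteq> U})" by blast
      qed
    qed blast
    also have "\<dots> \<in> sigma_sets SigmaA (range wcyl)"
      by (rule sigma_sets_UNION) auto
    finally show "U \<in> sigma_sets SigmaA (range wcyl)" .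
  next
    fix U assume "U \<in> range wcyl"
    then show "U \<in> sigma_sets SigmaA {U. openin (seq_topology SigmaA) U}"
      using openin_wcyl by auto
  qed
  then show ?thesis unfolding seq_borel_def using pow by (simp add: sets_measure_of)
qed

lemma wcyl_sets [measurable, simp]: "wcyl w \<in> sets (seq_borel SigmaA)"
  unfolding sets_seq_borel by (rule sigma_sets.Basic) blast

lemma measurable_into_seq_borel:
  assumes "f \<in> space M \<rightarrow> SigmaA" "\<And>w. f -` wcyl w \<inter> space M \<in> sets M"
  shows "f \<in> M \<rightarrow>\<^sub>M seq_borel SigmaA"
  by (rule measurable_sigma_sets[OF sets_seq_borel]) (use assms wcyl_subset in auto)

lemma shift_vimage_wcyl: "shift -` wcyl w \<inter> SigmaA = (\<Union>x\<in>{1..3}. wcyl (x # w))"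
proof (intro set_eqI iffI)
  fix \<omega> assume "\<omega> \<in> shift -` wcyl w \<inter> SigmaA"
  then have "\<omega> \<in> wcyl (\<omega> 0 # w)" "\<omega> 0 \<in> {1..3}" using SigmaA_mem by (simp_all add: mem_wcyl_Cons)
  then show "\<omega> \<in> (\<Union>x\<in>{1..3}. wcyl (x # w))" by blast
next
  fix \<omega> assume "\<omega> \<in> (\<Union>x\<in>{1..3}. wcyl (x # w))"
  then show "\<omega> \<in> shift -` wcyl w \<inter> SigmaA" by (simp add: mem_wcyl_Cons Bex_def)
qed

lemma shift_measurable [measurable]: "shift \<in> seq_borel SigmaA \<rightarrow>\<^sub>M seq_borel SigmaA"
  by (rule measurable_into_seq_borel) (auto simp: shift_vimage_wcyl shift_SigmaA)

lemma measure_eqI_wcyl: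
  assumes "sets M = sets (seq_borel SigmaA)" "sets N = sets (seq_borel SigmaA)"
    and "finite_measure M" and eq: "\<And>w. emeasure M (wcyl w) = emeasure N (wcyl w)"
  shows "M = N"
proof (rule measure_eqI_generator_eq[OF Int_stable_wcyl, where \<Omega> = SigmaA and A = "\<lambda>_. SigmaA"])
  show "range wcyl \<subseteq> Pow SigmaA" using wcyl_subset by blast
  show "range (\<lambda>_. SigmaA) \<subseteq> range wcyl" using wcyl_Nil by blast
  show "emeasure M SigmaA \<noteq> \<infinity>" using assms(3) by (simp add: finite_measure.emeasure_finite)
qed (use assms in \<open>auto simp: sets_seq_borel\<close>)

lemma wcyl_split_right: "wcyl w = (\<Union>x\<in>{1..3}. wcyl (w @ [x]))"
proof (intro set_eqI iffI)
  fix \<omega> assume \<omega>: "\<omega> \<in> wcyl w"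
  then have "\<omega> (length w) \<in> {1..3}" using wcyl_subset SigmaA_mem by blast
  moreover have "\<omega> \<in> wcyl (w @ [\<omega> (length w)])" using \<omega> by (simp add: mem_wcyl_snoc)
  ultimately show "\<omega> \<in> (\<Union>x\<in>{1..3}. wcyl (w @ [x]))" by blast
next
  fix \<omega> assume "\<omega> \<in> (\<Union>x\<in>{1..3}. wcyl (w @ [x]))"
  then obtain x where "\<omega> \<in> wcyl (w @ [x])" by blast
  then show "\<omega> \<in> wcyl w" by (simp only: mem_wcyl_snoc)
qed

lemma measure_wcyl_right:
  assumes "finite_measure \<mu>" "sets \<mu> = sets (seq_borel SigmaA)"
  shows "(\<Sum>x=1..3. measure \<mu> (wcyl (w @ [x]))) = measure \<mu> (wcyl w)"
proof -
  interpret finite_measure \<mu> by fact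
  have "disjoint_family_on (\<lambda>x. wcyl (w @ [x])) {1..3}"
    unfolding disjoint_family_on_def disjoint_iff mem_wcyl_snoc by blast
  moreover have "(\<lambda>x. wcyl (w @ [x])) ` {1..3} \<subseteq> sets \<mu>"
    unfolding assms(2) using wcyl_sets by blast
  ultimately have "measure \<mu> (\<Union>x\<in>{1..3}. wcyl (w @ [x])) = (\<Sum>x=1..3. measure \<mu> (wcyl (w @ [x])))"
    by (intro finite_measure_finite_Union) simp_all
  then show ?thesis unfolding wcyl_split_right[of w, symmetric] by simp
qed

lemma measure_wcyl_left:
  assumes "finite_measure \<mu>" "sets \<mu> = sets (seq_borel SigmaA)" "distr \<mu> \<mu> shift = \<mu>"
  shows "(\<Sum>x=1..3. measure \<mu> (wcyl (x # w))) = measure \<mu> (wcyl w)"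
proof -
  interpret finite_measure \<mu> by fact
  have sp: "space \<mu> = SigmaA" using sets_eq_imp_space_eq[OF assms(2)] by simp
  have m: "shift \<in> \<mu> \<rightarrow>\<^sub>M \<mu>"
    using shift_measurable measurable_cong_sets[OF assms(2) assms(2)] by blast
  have "disjoint_family_on (\<lambda>x. wcyl (x # w)) {1..3}"
    unfolding disjoint_family_on_def disjoint_iff mem_wcyl_Cons by blast
  moreover have "(\<lambda>x. wcyl (x # w)) ` {1..3} \<subseteq> sets \<mu>"
    unfolding assms(2) using wcyl_sets by blast
  ultimately have "(\<Sum>x=1..3. measure \<mu> (wcyl (x # w))) = measure \<mu> (\<Union>x\<in>{1..3}. wcyl (x # w))"
    by (intro finite_measure_finite_Union[symmetric]) simp_all
  also have "\<dots> = measure (distr \<mu> \<mu> shift) (wcyl w)"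
    unfolding shift_vimage_wcyl[symmetric] sp[symmetric]
    by (rule measure_distr[OF m, symmetric]) (simp add: assms(2))
  finally show ?thesis using assms(3) by simp
qed

subsection \<open>Markov measures\<close>

primrec chain :: "(nat \<Rightarrow> nat \<Rightarrow> real) \<Rightarrow> nat \<Rightarrow> nat list \<Rightarrow> real" where
  "chain W i [] = 1"
| "chain W i (x # w) = W i x * chain W x w"

lemma chain_eq_prod: "chain W i w = (\<Prod>k<length w. W ((i # w) ! k) (w ! k))"
  by (induction w arbitrary: i) (simp_all add: prod.lessThan_Suc_shift del: prod.lessThan_Suc)

lemma chain_zero:
  assumes "\<And>i. W i i = 0" "\<not> distinct_adj w"
  shows "chain W i w = 0"
  using assms(2)
proof (induction w arbitrary: i)
  case (Cons x w)
  show ?case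
  proof (cases "w \<noteq> [] \<and> hd w = x")
    case True
    then obtain v where "w = x # v" by (cases w) auto
    then show ?thesis by (simp add: assms(1))
  next
    case False
    then show ?thesis using Cons by (auto simp: distinct_adj_Cons)
  qed
qed simp

text \<open>The chain is run with independent random tables: in state \<open>i\<close> at time \<open>n\<close> it moves
  to the entry \<open>(n, i)\<close>. The state \<open>0\<close> is the initial one.\<close>

primrec state :: "(nat \<times> nat \<Rightarrow> nat) \<Rightarrow> nat \<Rightarrow> nat" where
  "state u 0 = 0"
| "state u (Suc n) = u (n, state u n)"

text \<open>If the path follows \<open>w\<close>, its state at time \<open>k\<close> is known in
  advance: it is the preceding letter of \<open>w\<close>, or 0 at the start. Following
  \<open>w\<close> therefore fixes one entry of each table at a place that does not depend on
  \<open>u\<close>.\<close>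

lemma state_iff_table:
  "(\<forall>k<n. state u (Suc k) = w k) \<longleftrightarrow> (\<forall>k<n. u (k, case_nat 0 w k) = w k)"
proof (induction n)
  case (Suc n)
  have "state u (Suc n) = u (n, case_nat 0 w n)" if "\<forall>k<n. state u (Suc k) = w k"
    using that by (cases n) auto
  then show ?case using Suc by (auto simp: less_Suc_eq simp del: state.simps)
qed simp

text \<open>The image of the product measure on tables under the path map. By
  \<open>state_iff_table\<close> the preimage of a cylinder is a finite-dimensional rectangle, whose
  measure is the product of the transition weights.\<close>

lemma Markov_measure_exists:
  fixes W :: "nat \<Rightarrow> nat \<Rightarrow> real"
  assumes nonneg: "\<And>i j. 0 \<le> W i j" and diag: "\<And>i. W i i = 0"
    and sum: "\<And>i. i \<le> 3 \<Longrightarrow> (\<Sum>j\<in>{1..3} - {i}. W i j) = 1"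
  obtains \<mu> where "prob_space \<mu>" "sets \<mu> = sets (seq_borel SigmaA)"
    "\<And>n w. w \<in> words n \<Longrightarrow> measure \<mu> (wcyl w) = chain W 0 w"
proof -
  \<comment> \<open>Every factor of the product must be a probability measure, also for indices that
    are no states; \<open>mod 4\<close> provides for that. Leaving the current letter out of the
    space makes every path admissible, not just almost every one.\<close>
  define M :: "nat \<times> nat \<Rightarrow> nat measure"
    where "M p = point_measure ({1..3} - {snd p mod 4}) (\<lambda>j. ennreal (W (snd p mod 4) j))" for p
  have sp: "space (M p) = {1..3} - {snd p mod 4}" for p
    by (simp add: M_def space_point_measure)
  have prob: "prob_space (M p)" for p
  proof (rule prob_spaceI)
    have "(\<Sum>j\<in>{1..3} - {snd p mod 4}. ennreal (W (snd p mod 4) j))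
        = ennreal (\<Sum>j\<in>{1..3} - {snd p mod 4}. W (snd p mod 4) j)"
      by (rule sum_ennreal) (rule nonneg)
    also have "\<dots> = 1" by (subst sum) auto
    finally show "emeasure (M p) (space (M p)) = 1"
      unfolding sp unfolding M_def by (subst emeasure_point_measure_finite) auto
  qed
  interpret product_prob_space M UNIV
    using prob by (intro product_prob_space.intro product_sigma_finite.intro
        product_prob_space_axioms.intro prob_space_imp_sigma_finite)
  define P where "P = PiM UNIV M"
  define X where "X u = (\<lambda>n. state u (Suc n))" for u
  have table: "u p \<in> {1..3} - {snd p mod 4}" if "u \<in> space P" for u p
  proof -
    have "u p \<in> space (M p)" using that unfolding P_def space_PiM by (rule PiE_mem) simp
    then show ?thesis unfolding sp .
  qed
  have state: "state u n \<le> 3 \<and> state u (Suc n) \<in> {1..3} - {state u n}" if u: "u \<in> space P" for u n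
  proof -
    have le: "state u n \<le> 3"
    proof (cases n)
      case (Suc k)
      then show ?thesis using table[OF u, of "(k, state u k)"] by (simp only: state.simps) simp
    qed simp
    then have "state u n mod 4 = state u n" by simp
    then show ?thesis using le table[OF u, of "(n, state u n)"] by (simp only: snd_conv state.simps)
  qed
  have X: "X \<in> space P \<rightarrow> SigmaA"
  proof
    fix u assume u: "u \<in> space P"
    have "X u n \<in> {1..3} \<and> X u n \<noteq> X u (Suc n)" for n
      using state[OF u, of n] state[OF u, of "Suc n"] unfolding X_def by (metis DiffE insertCI)
    then show "X u \<in> SigmaA" unfolding SigmaA_iff by blast
  qed
  have vimage: "X -` wcyl w \<inter> space P \<in> sets P \<and> measure P (X -` wcyl w \<inter> space P) = chain W 0 w"
    if w: "w \<in> words (length w)" for w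
  proof (cases "distinct_adj w")
    case True
    let ?J = "(\<lambda>k. (k, (0 # w) ! k)) ` {..<length w}" and ?A = "\<lambda>p. {w ! fst p}"
    have letter: "w ! k \<in> {1..3} - {(0 # w) ! k}" "(0 # w) ! k \<le> 3" if "k < length w" for k
    proof -
      have mem: "w ! i \<in> {1..3}" if "i < length w" for i
        using w that nth_mem[of i w] unfolding words_def by blast
      have "w ! k \<noteq> (0 # w) ! k \<and> (0 # w) ! k \<le> 3"
      proof (cases k)
        case (Suc i)
        then show ?thesis
          using True that mem[of i] unfolding distinct_adj_conv_nth by fastforce
      qed (use mem[OF that] in auto)
      with mem[OF that] show "w ! k \<in> {1..3} - {(0 # w) ! k}" "(0 # w) ! k \<le> 3" by auto
    qed
    have A_sets: "?A p \<in> sets (M p)" if p: "p \<in> ?J" for p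
    proof -
      obtain k where k: "k < length w" "p = (k, (0 # w) ! k)" using p by blast
      then show ?thesis using letter[OF k(1)] by (auto simp: M_def sets_point_measure)
    qed
    have "X u \<in> wcyl w \<longleftrightarrow> (\<forall>p\<in>?J. u p = w ! fst p)" if u: "u \<in> space P" for u
    proof -
      have c: "case_nat 0 ((!) w) k = (0 # w) ! k" for k by (cases k) simp_all
      have "X u \<in> wcyl w \<longleftrightarrow> (\<forall>k<length w. state u (Suc k) = w ! k)"
        using X u unfolding wcyl_def X_def by blast
      then show ?thesis unfolding state_iff_table c by auto
    qed
    then have emb: "X -` wcyl w \<inter> space P = prod_emb UNIV M ?J (Pi\<^sub>E ?J ?A)"
      unfolding prod_emb_def P_def space_PiM by (auto simp: PiE_iff restrict_def extensional_def)
    have "prod_emb UNIV M ?J (Pi\<^sub>E ?J ?A) \<in> sets P"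
      unfolding P_def using A_sets by (intro sets_PiM_I ballI) auto
    moreover have "measure P (prod_emb UNIV M ?J (Pi\<^sub>E ?J ?A)) = (\<Prod>p\<in>?J. measure (M p) (?A p))"
      unfolding P_def by (intro measure_PiM_emb A_sets) auto
    moreover have "\<dots> = (\<Prod>k<length w. measure (M (k, (0 # w) ! k)) {w ! k})"
      by (subst prod.reindex) (auto simp: inj_on_def)
    moreover have "\<dots> = chain W 0 w"
      unfolding chain_eq_prod
    proof (intro prod.cong refl)
      fix k assume "k \<in> {..<length w}"
      then have k: "k < length w" by simp
      have "(0 # w) ! k mod 4 = (0 # w) ! k" using letter[OF k] by simp
      then show "measure (M (k, (0 # w) ! k)) {w ! k} = W ((0 # w) ! k) (w ! k)"
        using letter[OF k] nonneg unfolding M_def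
        by (simp add: measure_def emeasure_point_measure_finite)
    qed
    ultimately show ?thesis unfolding emb by simp
  next
    case False
    then have "wcyl w = {}"
    proof -
      obtain i where i: "Suc i < length w" "w ! i = w ! Suc i"
        using False unfolding distinct_adj_conv_nth by blast
      have "\<omega> \<notin> wcyl w" for \<omega>
        using i SigmaA_neq[of \<omega> i] unfolding wcyl_def by (metis (mono_tags, lifting) Suc_lessD mem_Collect_eq)
      then show ?thesis by blast
    qed
    then show ?thesis using chain_zero[of W w 0] diag False by simp
  qed
  have "X -` wcyl w \<inter> space P \<in> sets P" for w
    using vimage[of w] wcyl_empty[of w] by (cases "w \<in> words (length w)") auto
  then have Xm: "X \<in> P \<rightarrow>\<^sub>M seq_borel SigmaA" using X by (intro measurable_into_seq_borel)
  show thesis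
  proof (rule that[of "distr P (seq_borel SigmaA) X"])
    show "prob_space (distr P (seq_borel SigmaA) X)"
      unfolding P_def by (rule P.prob_space_distr) (use Xm in \<open>simp add: P_def\<close>)
    show "measure (distr P (seq_borel SigmaA) X) (wcyl w) = chain W 0 w" if "w \<in> words n" for w n
      using vimage[of w] that by (subst measure_distr[OF Xm]) (auto simp: words_def)
  qed simp
qed

text \<open>The eigendata are parameters, so that transposing the matrix amounts to exchanging
  \<open>l\<close> and \<open>h\<close>, and different eigenvectors can be supplied for the same
  matrix.\<close>

locale perron =
  fixes m :: "nat \<Rightarrow> nat \<Rightarrow> real" and lam :: real and l h :: "nat \<Rightarrow> real"
  assumes m_pos: "\<And>i j. i \<in> {1..3} \<Longrightarrow> j \<in> {1..3} \<Longrightarrow> i \<noteq> j \<Longrightarrow> 0 < m i j"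
    and m_diag: "\<And>i. m i i = 0"
    and lam_pos: "0 < lam"
    and l_pos: "\<And>i. i \<in> {1..3} \<Longrightarrow> 0 < l i"
    and h_pos: "\<And>i. i \<in> {1..3} \<Longrightarrow> 0 < h i"
    and left: "\<And>j. j \<in> {1..3} \<Longrightarrow> (\<Sum>i=1..3. l i * m i j) = lam * l j"
    and right: "\<And>i. i \<in> {1..3} \<Longrightarrow> (\<Sum>j=1..3. m i j * h j) = lam * h i"
    and norm: "(\<Sum>i=1..3. l i * h i) = 1"
begin

text \<open>Together with the factor \<open>l\<close> of the first letter, this is the Markov weight
  of a word: \<open>l\<close> at the first letter, the product of the entries
  \<open>m x y / lam\<close> along the word, and \<open>h\<close> at the last letter.\<close>

fun tail_weight :: "nat list \<Rightarrow> real" where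
  "tail_weight [] = 1"
| "tail_weight [x] = h x"
| "tail_weight (x # y # w) = m x y / lam * tail_weight (y # w)"

definition weight :: "nat list \<Rightarrow> real" where
  "weight w = (case w of [] \<Rightarrow> 1 | x # _ \<Rightarrow> l x * tail_weight w)"

lemma weight_simps [simp]: "weight [] = 1" "weight (x # w) = l x * tail_weight (x # w)"
  by (simp_all add: weight_def)

lemma m_nonneg: "i \<in> {1..3} \<Longrightarrow> j \<in> {1..3} \<Longrightarrow> 0 \<le> m i j"
  using m_pos[of i j] m_diag[of i] by (cases "i = j") auto

lemma tail_weight_append:
  assumes "v \<noteq> []" "u \<noteq> []" "last v \<in> {1..3}"
  shows "tail_weight (v @ u) = tail_weight v * (m (last v) (hd u) / (lam * h (last v))) * tail_weight u"
  using assms(1,3)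
proof (induction v rule: tail_weight.induct)
  case (2 x)
  then show ?case using assms(2) h_pos[of x] by (cases u) auto
qed auto

lemma weight_append:
  assumes "v \<noteq> []" "u \<noteq> []" "last v \<in> {1..3}" "hd u \<in> {1..3}"
  shows "weight (v @ u) = weight v * (m (last v) (hd u) / (lam * h (last v) * l (hd u))) * weight u"
  using tail_weight_append[OF assms(1-3)] assms l_pos[OF assms(4)]
  by (cases v; cases u) (auto simp: field_simps)

lemma weight_left:
  assumes "w \<in> words n"
  shows "(\<Sum>x=1..3. weight (x # w)) = weight w"
proof (cases w)
  case Nil
  then show ?thesis using norm by simp
next
  case (Cons y v)
  then have y: "y \<in> {1..3}" using assms by (auto simp: words_def)
  have "(\<Sum>x=1..3. weight (x # w)) = (\<Sum>x=1..3. l x * m x y) * (tail_weight w / lam)"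
    unfolding sum_distrib_right by (rule sum.cong) (simp_all add: Cons)
  also have "\<dots> = weight w" using left[OF y] lam_pos Cons by simp
  finally show ?thesis .
qed

lemma weight_prefix:
  assumes \<omega>: "\<omega> \<in> SigmaA"
  shows "weight (map \<omega> [0..<Suc n]) = l (\<omega> 0) * (\<Prod>k<n. m (\<omega> k) (\<omega> (Suc k)) / lam) * h (\<omega> n)"
proof (induction n)
  case (Suc n)
  have e: "map \<omega> [0..<Suc (Suc n)] = map \<omega> [0..<Suc n] @ [\<omega> (Suc n)]"
    "last (map \<omega> [0..<Suc n]) = \<omega> n" by simp_all
  have "weight (map \<omega> [0..<Suc (Suc n)]) = weight (map \<omega> [0..<Suc n])
      * (m (\<omega> n) (\<omega> (Suc n)) / (lam * h (\<omega> n) * l (\<omega> (Suc n)))) * weight [\<omega> (Suc n)]"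
    using weight_append[of "map \<omega> [0..<Suc n]" "[\<omega> (Suc n)]"] SigmaA_mem[OF \<omega>] unfolding e
    by simp
  then show ?case
    unfolding Suc using l_pos[OF SigmaA_mem[OF \<omega>, of "Suc n"]] h_pos[OF SigmaA_mem[OF \<omega>, of n]]
    by (simp add: field_simps)
qed simp

text \<open>Row 0 is the stationary distribution, used as the initial one; the other rows are those
  of \<open>m\<close> made stochastic by the right eigenvector.\<close>

definition trans :: "nat \<Rightarrow> nat \<Rightarrow> real" where
  "trans i j = (if j \<in> {1..3} then
     if i = 0 then l j * h j else if i \<in> {1..3} then m i j * h j / (lam * h i) else 0 else 0)"

lemma tail_weight_chain: "set (x # w) \<subseteq> {1..3} \<Longrightarrow> h x * chain trans x w = tail_weight (x # w)"
proof (induction w arbitrary: x)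
  case (Cons y w)
  have IH: "h y * chain trans y w = tail_weight (y # w)" using Cons by simp
  have xy: "x \<in> {1..3}" "y \<in> {1..3}" "x \<noteq> 0" using Cons.prems by auto
  have "h x * chain trans x (y # w) = h x * (m x y * h y / (lam * h x)) * chain trans y w"
    using xy by (simp add: trans_def)
  also have "\<dots> = m x y / lam * (h y * chain trans y w)"
    using h_pos[OF xy(1)] by simp
  finally show ?case unfolding IH by simp
qed simp

lemma weight_chain: "w \<in> words n \<Longrightarrow> chain trans 0 w = weight w"
proof (cases w)
  case (Cons x v)
  assume "w \<in> words n"
  then have "set (x # v) \<subseteq> {1..3}" by (simp add: words_def Cons)
  from tail_weight_chain[OF this] show ?thesis
    using \<open>set (x # v) \<subseteq> {1..3}\<close> by (simp add: Cons trans_def mult.assoc)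
qed simp

lemma sum_trans:
  assumes "i \<le> 3"
  shows "(\<Sum>j\<in>{1..3} - {i}. trans i j) = 1"
proof (cases "i = 0")
  case True
  then have "(\<Sum>j\<in>{1..3} - {i}. trans i j) = (\<Sum>j=1..3. l j * h j)"
    by (intro sum.cong) (auto simp: trans_def)
  then show ?thesis using norm by simp
next
  case False
  then have i: "i \<in> {1..3}" using assms by simp
  have "(\<Sum>j\<in>{1..3} - {i}. trans i j) = (\<Sum>j=1..3. trans i j)"
    using m_diag[of i] i by (intro sum.mono_neutral_left) (auto simp: trans_def)
  also have "\<dots> = (\<Sum>j=1..3. m i j * h j) / (lam * h i)"
    unfolding sum_divide_distrib using i by (intro sum.cong) (auto simp: trans_def)
  also have "\<dots> = 1" using right[OF i] lam_pos h_pos[OF i] by simp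
  finally show ?thesis .
qed

lemma trans_nonneg: "0 \<le> trans i j"
proof -
  have "0 \<le> m i j * h j / (lam * h i)" if "i \<in> {1..3}" "j \<in> {1..3}"
    using that m_nonneg[of i j] h_pos[of i] h_pos[of j] lam_pos
    by (intro divide_nonneg_nonneg mult_nonneg_nonneg) auto
  moreover have "0 \<le> l j * h j" if "j \<in> {1..3}"
    using that l_pos[of j] h_pos[of j] by simp
  ultimately show ?thesis by (simp add: trans_def)
qed

lemma trans_diag: "trans i i = 0"
  by (simp add: trans_def m_diag)

lemma weight_nonneg: "w \<in> words n \<Longrightarrow> 0 \<le> weight w"
  unfolding weight_chain[symmetric] chain_eq_prod by (intro prod_nonneg trans_nonneg)

text \<open>Invariance need only be checked on cylinders, where it is \<open>weight_left\<close>,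
  the equation of the left eigenvector.\<close>

lemma invariant_measure_exists:
  obtains \<mu> where "prob_space \<mu>" "sets \<mu> = sets (seq_borel SigmaA)" "distr \<mu> \<mu> shift = \<mu>"
    "\<And>n w. w \<in> words n \<Longrightarrow> measure \<mu> (wcyl w) = weight w"
proof -
  obtain \<mu> where prob: "prob_space \<mu>" and sets: "sets \<mu> = sets (seq_borel SigmaA)"
    and w: "\<And>n w. w \<in> words n \<Longrightarrow> measure \<mu> (wcyl w) = weight w"
    using Markov_measure_exists[of trans] trans_nonneg trans_diag sum_trans weight_chain by metis
  interpret prob_space \<mu> by fact
  have sp: "space \<mu> = SigmaA" using sets_eq_imp_space_eq[OF sets] by simp
  have m: "shift \<in> \<mu> \<rightarrow>\<^sub>M \<mu>"
    using shift_measurable measurable_cong_sets[OF sets sets] by blast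
  have eq: "measure \<mu> (shift -` wcyl w \<inter> SigmaA) = measure \<mu> (wcyl w)" for w
  proof (cases "w \<in> words (length w)")
    case True
    have "(\<lambda>x. wcyl (x # w)) ` {1..3} \<subseteq> sets \<mu>" unfolding sets using wcyl_sets by blast
    moreover have "disjoint_family_on (\<lambda>x. wcyl (x # w)) {1..3}"
      unfolding disjoint_family_on_def disjoint_iff mem_wcyl_Cons by blast
    ultimately have "measure \<mu> (\<Union>x\<in>{1..3}. wcyl (x # w)) = (\<Sum>x=1..3. measure \<mu> (wcyl (x # w)))"
      by (intro finite_measure_finite_Union) simp_all
    also have "\<dots> = (\<Sum>x=1..3. weight (x # w))"
      using True by (intro sum.cong refl w[of _ "Suc (length w)"]) (auto simp: words_def)
    also have "\<dots> = measure \<mu> (wcyl w)"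
      unfolding weight_left[OF True] w[OF True] ..
    finally show ?thesis unfolding shift_vimage_wcyl .
  next
    case False
    then show ?thesis using wcyl_empty by simp
  qed
  have "distr \<mu> \<mu> shift = \<mu>"
  proof (rule measure_eqI_wcyl)
    show "finite_measure (distr \<mu> \<mu> shift)" by (rule finite_measure_distr[OF m])
    fix w
    have "emeasure (distr \<mu> \<mu> shift) (wcyl w) = emeasure \<mu> (shift -` wcyl w \<inter> SigmaA)"
      unfolding sp[symmetric] by (rule emeasure_distr[OF m]) (simp add: sets)
    then show "emeasure (distr \<mu> \<mu> shift) (wcyl w) = emeasure \<mu> (wcyl w)"
      by (simp add: emeasure_eq_measure eq)
  qed (simp_all add: sets)
  with prob sets w show thesis by (intro that)
qed

end

subsection \<open>Gibbs measures\<close>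

text \<open>To read off the value of \<open>f\<close> for two first letters, a point starting with
  them is needed; the alternating one is admissible for any two distinct letters.\<close>

definition edge :: "((nat \<Rightarrow> nat) \<Rightarrow> real) \<Rightarrow> nat \<Rightarrow> nat \<Rightarrow> real" where
  "edge f i j = f (\<lambda>n. if even n then i else j)"

definition weight_matrix :: "((nat \<Rightarrow> nat) \<Rightarrow> real) \<Rightarrow> nat \<Rightarrow> nat \<Rightarrow> real" where
  "weight_matrix f i j = (if i \<in> {1..3} \<and> j \<in> {1..3} \<and> i \<noteq> j then exp (edge f i j) else 0)"

lemma alternating_SigmaA:
  "i \<in> {1..3} \<Longrightarrow> j \<in> {1..3} \<Longrightarrow> i \<noteq> j \<Longrightarrow> (\<lambda>n. if even n then i else j) \<in> SigmaA"
  unfolding SigmaA_iff by simp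

lemma L2_agree:
  assumes "f \<in> L2" "\<omega> \<in> SigmaA" "\<omega>' \<in> SigmaA" "\<omega> 0 = \<omega>' 0" "\<omega> 1 = \<omega>' 1"
  shows "f \<omega> = f \<omega>'"
proof -
  have "\<forall>k<2. \<omega> k = \<omega>' k" using assms(4,5) by (auto simp: less_2_cases_iff)
  then show ?thesis using assms(1-3) unfolding locally_const_def by blast
qed

lemma L2_eq_edge:
  assumes "f \<in> L2" "\<omega> \<in> SigmaA"
  shows "f \<omega> = edge f (\<omega> 0) (\<omega> 1)"
  unfolding edge_def
proof (rule L2_agree[OF assms])
  show "(\<lambda>n. if even n then \<omega> 0 else \<omega> 1) \<in> SigmaA"
    using SigmaA_mem[OF assms(2)] SigmaA_neq[OF assms(2), of 0] by (intro alternating_SigmaA) auto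
qed auto

lemma L2_sum_eq_birkhoff:
  assumes "f \<in> L2" "\<omega> \<in> SigmaA"
  shows "(\<Sum>k<n. f ((shift ^^ k) \<omega>)) = birkhoff (edge f) \<omega> n"
  unfolding birkhoff_def
  by (intro sum.cong refl) (simp add: L2_eq_edge[OF assms(1) shift_pow_SigmaA[OF assms(2)]] shift_pow)

lemma continuous_map_L2:
  assumes "f \<in> L2"
  shows "continuous_map (seq_topology SigmaA) euclideanreal f"
proof -
  have top: "topspace (seq_topology SigmaA) = SigmaA"
    by (simp add: seq_topology_def)
  have "openin (seq_topology SigmaA) {\<omega> \<in> SigmaA. f \<omega> \<in> U}" for U
    unfolding openin_seq_topology
  proof (intro conjI ballI)
    fix \<omega> assume "\<omega> \<in> {\<omega> \<in> SigmaA. f \<omega> \<in> U}"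
    then have \<omega>: "\<omega> \<in> SigmaA" "f \<omega> \<in> U" by auto
    have "cylinder SigmaA 2 \<omega> \<subseteq> {\<omega> \<in> SigmaA. f \<omega> \<in> U}"
      using L2_agree[OF assms _ \<omega>(1)] \<omega>(2) by (auto simp: cylinder_def)
    then show "\<exists>n. cylinder SigmaA n \<omega> \<subseteq> {\<omega> \<in> SigmaA. f \<omega> \<in> U}" by blast
  qed blast
  then show ?thesis by (simp add: continuous_map_def top)
qed

section \<open>Uniqueness of Gibbs measures\<close>

lemma gibbs_forD:
  assumes "gibbs_for SigmaA f \<mu>"
  shows "sets \<mu> = sets (seq_borel SigmaA)" "prob_space \<mu>" "distr \<mu> \<mu> shift = \<mu>"
  using assms by (auto simp: gibbs_for_def)

text \<open>The two measures may a priori come with different constants \<open>P\<close>;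
  \<open>d\<close> is their difference and enters exponentially.\<close>

lemma gibbs_for_comparable:
  assumes "gibbs_for SigmaA f \<mu>" "gibbs_for SigmaA f \<nu>"
  obtains D d where "0 < D"
    "\<And>w. w \<noteq> [] \<Longrightarrow> measure \<nu> (wcyl w) \<le> D * exp (real (length w) * d) * measure \<mu> (wcyl w)"
    "\<And>w. w \<noteq> [] \<Longrightarrow> measure \<mu> (wcyl w) \<le> D * exp (- real (length w) * d) * measure \<nu> (wcyl w)"
proof -
  let ?E = "\<lambda>P n \<omega>. exp (- real n * P + (\<Sum>k<n. f ((shift ^^ k) \<omega>)))"
  have bounds: "\<exists>C>0. \<exists>P. \<forall>\<omega>\<in>SigmaA. \<forall>n\<ge>1. ?E P n \<omega> \<le> C * measure \<mu> (cylinder SigmaA n \<omega>)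
      \<and> measure \<mu> (cylinder SigmaA n \<omega>) \<le> C * ?E P n \<omega>" if g: "gibbs_for SigmaA f \<mu>" for \<mu>
  proof -
    from g obtain C P where "0 < C" and b: "\<And>\<omega> n. \<omega> \<in> SigmaA \<Longrightarrow> 1 \<le> n \<Longrightarrow>
        inverse C \<le> measure \<mu> (cylinder SigmaA n \<omega>) / ?E P n \<omega>
        \<and> measure \<mu> (cylinder SigmaA n \<omega>) / ?E P n \<omega> \<le> C"
      unfolding gibbs_for_def Let_def by blast
    have "?E P n \<omega> \<le> C * measure \<mu> (cylinder SigmaA n \<omega>)
      \<and> measure \<mu> (cylinder SigmaA n \<omega>) \<le> C * ?E P n \<omega>" if "\<omega> \<in> SigmaA" "1 \<le> n" for \<omega> n
    proof -
      have pos: "0 < ?E P n \<omega>" by simp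
      show ?thesis using b[OF that] \<open>0 < C\<close>
        unfolding pos_le_divide_eq[OF pos] pos_divide_le_eq[OF pos]
        by (simp add: field_simps)
    qed
    then show ?thesis using \<open>0 < C\<close> by blast
  qed
  obtain C P where C: "0 < C" and b: "\<And>\<omega> n. \<omega> \<in> SigmaA \<Longrightarrow> 1 \<le> n \<Longrightarrow>
      ?E P n \<omega> \<le> C * measure \<mu> (cylinder SigmaA n \<omega>) \<and> measure \<mu> (cylinder SigmaA n \<omega>) \<le> C * ?E P n \<omega>"
    using bounds[OF assms(1)] by blast
  obtain C' P' where C': "0 < C'" and b': "\<And>\<omega> n. \<omega> \<in> SigmaA \<Longrightarrow> 1 \<le> n \<Longrightarrow>
      ?E P' n \<omega> \<le> C' * measure \<nu> (cylinder SigmaA n \<omega>) \<and> measure \<nu> (cylinder SigmaA n \<omega>) \<le> C' * ?E P' n \<omega>"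
    using bounds[OF assms(2)] by blast
  have E: "?E P' n \<omega> = exp (real n * (P - P')) * ?E P n \<omega>" "?E P n \<omega> = exp (- real n * (P - P')) * ?E P' n \<omega>" for n \<omega>
    by (simp_all add: exp_add[symmetric] algebra_simps)
  have main: "measure \<nu> (wcyl w) \<le> C * C' * exp (real (length w) * (P - P')) * measure \<mu> (wcyl w)
      \<and> measure \<mu> (wcyl w) \<le> C * C' * exp (- real (length w) * (P - P')) * measure \<nu> (wcyl w)"
    if "w \<noteq> []" for w
  proof (cases "wcyl w = {}")
    case False
    then obtain \<omega> where "\<omega> \<in> wcyl w" by blast
    then have \<omega>: "\<omega> \<in> SigmaA" and c: "cylinder SigmaA (length w) \<omega> = wcyl w"
      using wcyl_subset by (auto simp: cylinder_eq_wcyl wcyl_eq_prefix)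
    have n: "1 \<le> length w" using that by (cases w) auto
    have "measure \<nu> (wcyl w) \<le> C' * (exp (real (length w) * (P - P')) * ?E P (length w) \<omega>)"
      using b'[OF \<omega> n] unfolding c E(1) by blast
    also have "\<dots> \<le> C' * (exp (real (length w) * (P - P')) * (C * measure \<mu> (wcyl w)))"
      using b[OF \<omega> n] C' unfolding c by (intro mult_left_mono) auto
    finally have 1: "measure \<nu> (wcyl w) \<le> C * C' * exp (real (length w) * (P - P')) * measure \<mu> (wcyl w)"
      by (simp add: ac_simps)
    have "measure \<mu> (wcyl w) \<le> C * (exp (- real (length w) * (P - P')) * ?E P' (length w) \<omega>)"
      using b[OF \<omega> n] unfolding c E(2) by blast
    also have "\<dots> \<le> C * (exp (- real (length w) * (P - P')) * (C' * measure \<nu> (wcyl w)))"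
      using b'[OF \<omega> n] C unfolding c by (intro mult_left_mono) auto
    finally have 2: "measure \<mu> (wcyl w) \<le> C * C' * exp (- real (length w) * (P - P')) * measure \<nu> (wcyl w)"
      by (simp add: ac_simps)
    from 1 2 show ?thesis ..
  qed simp
  show thesis
    by (rule that[of "C * C'" "P - P'"]) (use main C C' in auto)
qed

lemma sum_measure_wcyl:
  assumes "prob_space \<mu>" "sets \<mu> = sets (seq_borel SigmaA)"
  shows "(\<Sum>w\<in>words n. measure \<mu> (wcyl w)) = 1"
proof -
  interpret prob_space \<mu> by fact
  have "space \<mu> = SigmaA" using sets_eq_imp_space_eq[OF assms(2)] by simp
  then have "measure \<mu> (wcyl []) = 1" using prob_space by simp
  then show ?thesis
    using word_additive_right[OF measure_wcyl_right[OF finite_measure_axioms assms(2)], where n = n and v = "[]"] by simp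
qed

lemma linear_bound_nonneg:
  fixes a d :: real
  assumes "\<And>n. 0 < n \<Longrightarrow> 1 \<le> a * exp (real n * d)" "0 < a"
  shows "0 \<le> d"
proof (rule ccontr)
  assume "\<not> 0 \<le> d"
  then obtain n where n: "ln a < real n * (- d)" using ex_less_of_nat_mult[of "- d" "ln a"] by auto
  have "1 \<le> a * exp (real (Suc n) * d)" by (rule assms(1)) simp
  then have "0 \<le> ln (a * exp (real (Suc n) * d))" by simp
  then have "0 \<le> ln a + real (Suc n) * d" using assms(2) by (simp add: ln_mult)
  with n \<open>\<not> 0 \<le> d\<close> show False by (simp add: algebra_simps)
qed

text \<open>Summed over all words of length \<open>n\<close>, the comparison involves total masses 1
  on both sides, which forces \<open>d = 0\<close>. The measures are then comparable up to the
  constant \<open>D\<close>, and the energy argument applies.\<close>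

lemma gibbs_for_unique:
  assumes \<mu>: "gibbs_for SigmaA f \<mu>" and \<nu>: "gibbs_for SigmaA f \<nu>" and c: "0 < c"
    and qb: "\<And>v u. v \<noteq> [] \<Longrightarrow> u \<noteq> [] \<Longrightarrow>
      c * measure \<mu> (wcyl v) * measure \<mu> (wcyl u) \<le> (\<Sum>x=1..3. measure \<mu> (wcyl (v @ [x] @ u)))"
  shows "\<nu> = \<mu>"
proof -
  note M = gibbs_forD[OF \<mu>] and N = gibbs_forD[OF \<nu>]
  interpret M: prob_space \<mu> by (rule M)
  interpret N: prob_space \<nu> by (rule N)
  obtain D d where D: "0 < D"
    and le1: "\<And>w. w \<noteq> [] \<Longrightarrow> measure \<nu> (wcyl w) \<le> D * exp (real (length w) * d) * measure \<mu> (wcyl w)"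
    and le2: "\<And>w. w \<noteq> [] \<Longrightarrow> measure \<mu> (wcyl w) \<le> D * exp (- real (length w) * d) * measure \<nu> (wcyl w)"
    using gibbs_for_comparable[OF \<mu> \<nu>] by blast
  have s1: "1 \<le> D * exp (real n * d)" if "0 < n" for n
  proof -
    have "(\<Sum>w\<in>words n. measure \<nu> (wcyl w)) \<le> (\<Sum>w\<in>words n. D * exp (real n * d) * measure \<mu> (wcyl w))"
      using that le1 by (intro sum_mono) (fastforce simp: words_def)
    then show ?thesis
      unfolding sum_distrib_left[symmetric] sum_measure_wcyl[OF M(2,1)] sum_measure_wcyl[OF N(2,1)] by simp
  qed
  have s2: "1 \<le> D * exp (real n * (- d))" if "0 < n" for n
  proof -
    have "(\<Sum>w\<in>words n. measure \<mu> (wcyl w)) \<le> (\<Sum>w\<in>words n. D * exp (real n * (- d)) * measure \<nu> (wcyl w))"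
      using that le2 by (intro sum_mono) (fastforce simp: words_def)
    then show ?thesis
      unfolding sum_distrib_left[symmetric] sum_measure_wcyl[OF M(2,1)] sum_measure_wcyl[OF N(2,1)] by simp
  qed
  have "d = 0" using linear_bound_nonneg[OF s1 D] linear_bound_nonneg[OF s2 D] by simp
  have Nil: "measure \<mu> (wcyl []) = 1" "measure \<nu> (wcyl []) = 1"
    using sum_measure_wcyl[OF M(2,1), of 0] sum_measure_wcyl[OF N(2,1), of 0] by simp_all
  interpret word_measures "\<lambda>w. measure \<mu> (wcyl w)" "\<lambda>w. measure \<nu> (wcyl w)" D c
  proof
    show "measure \<nu> (wcyl w) \<le> D * measure \<mu> (wcyl w)" if "w \<noteq> []" for w
      using le1[OF that] \<open>d = 0\<close> by simp
  qed (use Nil c qb measure_wcyl_left[OF M.finite_measure_axioms M(1,3)] measure_wcyl_left[OF N.finite_measure_axioms N(1,3)]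
      measure_wcyl_right[OF M.finite_measure_axioms M(1)] measure_wcyl_right[OF N.finite_measure_axioms N(1)] in \<open>simp_all\<close>)
  show ?thesis
  proof (rule measure_eqI_wcyl[OF N(1) M(1) N.finite_measure_axioms])
    show "emeasure \<nu> (wcyl w) = emeasure \<mu> (wcyl w)" for w
      using V_eq_U[of w "length w"] wcyl_empty[of w]
      by (cases "w \<in> words (length w)") (simp_all add: M.emeasure_eq_measure N.emeasure_eq_measure)
  qed
qed

context perron
begin

lemma weight_middle:
  assumes "v \<noteq> []" "u \<noteq> []" "x \<in> {1..3}" "last v \<in> {1..3}" "hd u \<in> {1..3}"
  shows "weight (v @ [x] @ u) = (m (last v) x * m x (hd u) / (lam\<^sup>2 * h (last v) * l (hd u))) * weight v * weight u"
proof -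
  have 1: "weight (v @ ([x] @ u)) = weight v
      * (m (last v) (hd ([x] @ u)) / (lam * h (last v) * l (hd ([x] @ u)))) * weight ([x] @ u)"
    by (rule weight_append) (use assms in auto)
  have 2: "weight ([x] @ u) = weight [x] * (m (last [x]) (hd u) / (lam * h (last [x]) * l (hd u))) * weight u"
    by (rule weight_append) (use assms in auto)
  show ?thesis unfolding 1 2 using l_pos[OF assms(3)] h_pos[OF assms(3)] lam_pos
    by (simp add: field_simps power2_eq_square)
qed

text \<open>The weight of \<open>v\<close> and \<open>u\<close> joined by a letter, relative to the
  product of their weights, depends only on the last letter of \<open>v\<close> and the first of
  \<open>u\<close>; this is the minimum over these two, after summing over the joining
  letter.\<close>

definition "mixing_const = Min ((\<lambda>(i, j). \<Sum>x=1..3. m i x * m x j / (lam\<^sup>2 * h i * l j)) ` ({1..3} \<times> {1..3}))"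

text \<open>The \<open>connector\<close> of the two letters contributes a positive term to each
  sum.\<close>

lemma mixing_const_pos: "0 < mixing_const"
proof -
  have "0 < (\<Sum>x=1..3. m i x * m x j / (lam\<^sup>2 * h i * l j))" if ij: "i \<in> {1..3}" "j \<in> {1..3}" for i j
  proof -
    have "connector i j \<in> {1..3}" "connector i j \<noteq> i" "connector i j \<noteq> j"
      using connector[of i j] by auto
    then have "0 < m i (connector i j) * m (connector i j) j / (lam\<^sup>2 * h i * l j)"
      using ij m_pos[of i "connector i j"] m_pos[of "connector i j" j] lam_pos l_pos h_pos by simp
    moreover have "0 \<le> m i x * m x j / (lam\<^sup>2 * h i * l j)" if "x \<in> {1..3}" for x
      using that ij m_nonneg[of i x] m_nonneg[of x j] l_pos[of j] h_pos[of i] by simp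
    ultimately show ?thesis
      using \<open>connector i j \<in> _\<close> by (intro sum_pos2[where i = "connector i j"]) auto
  qed
  then show ?thesis unfolding mixing_const_def by (subst Min_gr_iff) auto
qed

lemma weight_quasi_bernoulli:
  assumes "v \<in> words j" "u \<in> words k" "v \<noteq> []" "u \<noteq> []"
  shows "mixing_const * weight v * weight u \<le> (\<Sum>x=1..3. weight (v @ [x] @ u))"
proof -
  have v: "last v \<in> {1..3}" and u: "hd u \<in> {1..3}"
    using assms last_in_set[of v] hd_in_set[of u] unfolding words_def by blast+
  have "mixing_const \<le> (\<Sum>x=1..3. m (last v) x * m x (hd u) / (lam\<^sup>2 * h (last v) * l (hd u)))"
    unfolding mixing_const_def using u v
    by (intro Min_le) (auto intro!: image_eqI[where x = "(last v, hd u)"])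
  then have "mixing_const * (weight v * weight u)
      \<le> (\<Sum>x=1..3. m (last v) x * m x (hd u) / (lam\<^sup>2 * h (last v) * l (hd u))) * (weight v * weight u)"
    using weight_nonneg[OF assms(1)] weight_nonneg[OF assms(2)] by (intro mult_right_mono) auto
  also have "\<dots> = (\<Sum>x=1..3. weight (v @ [x] @ u))"
    unfolding sum_distrib_right
    by (intro sum.cong refl) (simp add: weight_middle[OF assms(3,4) _ v u, simplified] mult.assoc)
  finally show ?thesis by (simp add: mult.assoc)
qed

end

section \<open>Gibbs measures of 2-locally constant potentials\<close>

locale perron_potential = perron "weight_matrix f" lam l h
  for f lam l h +
  assumes f: "f \<in> L2"
begin

abbreviation "m \<equiv> weight_matrix f"

lemma m_eq_exp: "\<omega> \<in> SigmaA \<Longrightarrow> m (\<omega> k) (\<omega> (Suc k)) = exp (edge f (\<omega> k) (\<omega> (Suc k)))"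
  using SigmaA_mem SigmaA_neq by (simp add: weight_matrix_def)

text \<open>The Gibbs quotient for the constant \<open>P = ln lam\<close>. A Birkhoff sum over
  \<open>n + 1\<close> terms includes the transition out of the last letter of the cylinder, which
  the weight does not see; hence the denominator on the right.\<close>

lemma weight_ratio:
  assumes \<omega>: "\<omega> \<in> SigmaA"
  shows "weight (map \<omega> [0..<Suc n]) / exp (- real (Suc n) * ln lam + birkhoff (edge f) \<omega> (Suc n))
    = l (\<omega> 0) * h (\<omega> n) * lam / m (\<omega> n) (\<omega> (Suc n))"
proof -
  have 1: "(\<Prod>k<n. m (\<omega> k) (\<omega> (Suc k)) / lam) = exp (birkhoff (edge f) \<omega> n) / lam ^ n"
    by (simp add: prod_dividef m_eq_exp[OF \<omega>] exp_sum birkhoff_def)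
  have 2: "exp (- real (Suc n) * ln lam + birkhoff (edge f) \<omega> (Suc n))
      = exp (birkhoff (edge f) \<omega> n) * m (\<omega> n) (\<omega> (Suc n)) / (lam ^ n * lam)"
  proof -
    have "exp (- real (Suc n) * ln lam) = inverse (lam ^ Suc n)"
      using lam_pos exp_of_nat_mult[of "Suc n" "ln lam"] by (simp add: exp_minus del: of_nat_Suc power_Suc)
    then show ?thesis
      unfolding birkhoff_def sum.lessThan_Suc exp_add m_eq_exp[OF \<omega>]
      by (simp add: inverse_eq_divide)
  qed
  show ?thesis
    unfolding weight_prefix[OF \<omega>] 1 2 using lam_pos by (simp add: m_eq_exp[OF \<omega>] field_simps)
qed

text \<open>The quotient takes finitely many values, all positive; \<open>C\<close> exceeds each of
  them and each of their inverses.\<close>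

lemma ratio_bounds:
  obtains C where "0 < C" "\<And>\<omega> n. \<omega> \<in> SigmaA \<Longrightarrow>
    inverse C \<le> l (\<omega> 0) * h (\<omega> n) * lam / m (\<omega> n) (\<omega> (Suc n)) \<and>
    l (\<omega> 0) * h (\<omega> n) * lam / m (\<omega> n) (\<omega> (Suc n)) \<le> C"
proof -
  let ?g = "\<lambda>(i, j, k). l i * h j * lam / m j k"
  let ?T = "{(i :: nat, j :: nat, k :: nat). i \<in> {1..3} \<and> j \<in> {1..3} \<and> k \<in> {1..3} \<and> j \<noteq> k}"
  have fin: "finite ?T"
    by (rule finite_subset[of _ "{1..3} \<times> {1..3} \<times> {1..3}"]) auto
  have pos: "0 < ?g t" if "t \<in> ?T" for t
    using that l_pos h_pos m_pos lam_pos by (auto intro!: divide_pos_pos mult_pos_pos)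
  define C where "C = 1 + (\<Sum>t\<in>?T. ?g t + inverse (?g t))"
  have C: "?g t + inverse (?g t) \<le> C" if "t \<in> ?T" for t
  proof -
    have "?g t + inverse (?g t) \<le> (\<Sum>t\<in>?T. ?g t + inverse (?g t))"
      by (rule member_le_sum[OF that _ fin]) (use pos in \<open>simp add: less_imp_le\<close>)
    then show ?thesis unfolding C_def by linarith
  qed
  have "0 \<le> (\<Sum>t\<in>?T. ?g t + inverse (?g t))"
    using pos by (intro sum_nonneg add_nonneg_nonneg) (auto simp: less_imp_le)
  then have "0 < C" unfolding C_def by linarith
  moreover have "inverse C \<le> ?g t \<and> ?g t \<le> C" if t: "t \<in> ?T" for t
  proof -
    have p: "0 < ?g t" "0 < inverse (?g t)" using pos[OF t] by auto
    then have "inverse (?g t) \<le> C" "?g t \<le> C" using C[OF t] by linarith+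
    moreover have "inverse C \<le> inverse (inverse (?g t))"
      by (rule le_imp_inverse_le) fact+
    ultimately show ?thesis by simp
  qed
  moreover have "(\<omega> 0, \<omega> n, \<omega> (Suc n)) \<in> ?T" if "\<omega> \<in> SigmaA" for \<omega> n
    using SigmaA_mem[OF that] SigmaA_neq[OF that] by simp
  ultimately show thesis
    by (intro that[of C]) fastforce+
qed

text \<open>The Markov measure is a Gibbs measure for \<open>f\<close> by
  \<open>weight_ratio\<close> and \<open>ratio_bounds\<close>, and it is quasi-Bernoulli, so
  uniqueness identifies it with the definite description.\<close>

lemma gibbs_measure_weight:
  shows gibbs: "gibbs_for SigmaA f (gibbs_measure SigmaA f)"
    and measure_gibbs: "w \<in> words n \<Longrightarrow> measure (gibbs_measure SigmaA f) (wcyl w) = weight w"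
proof -
  obtain \<mu> where prob: "prob_space \<mu>" and sets: "sets \<mu> = sets (seq_borel SigmaA)"
    and inv: "distr \<mu> \<mu> shift = \<mu>"
    and w: "\<And>n w. w \<in> words n \<Longrightarrow> measure \<mu> (wcyl w) = weight w"
    using invariant_measure_exists by metis
  interpret prob_space \<mu> by fact
  obtain C where C: "0 < C" "\<And>\<omega> n. \<omega> \<in> SigmaA \<Longrightarrow>
    inverse C \<le> l (\<omega> 0) * h (\<omega> n) * lam / m (\<omega> n) (\<omega> (Suc n)) \<and>
    l (\<omega> 0) * h (\<omega> n) * lam / m (\<omega> n) (\<omega> (Suc n)) \<le> C"
    using ratio_bounds by blast
  have "inverse C \<le> measure \<mu> (cylinder SigmaA n \<omega>) / exp (- real n * ln lam + (\<Sum>k<n. f ((shift ^^ k) \<omega>)))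
     \<and> measure \<mu> (cylinder SigmaA n \<omega>) / exp (- real n * ln lam + (\<Sum>k<n. f ((shift ^^ k) \<omega>))) \<le> C"
    if \<omega>: "\<omega> \<in> SigmaA" and n: "1 \<le> n" for \<omega> n
  proof -
    obtain k where k: "n = Suc k" using n by (cases n) auto
    show ?thesis
      using C(2)[OF \<omega>, of k]
      unfolding cylinder_eq_wcyl w[OF prefix_in_words[OF \<omega>]] L2_sum_eq_birkhoff[OF f \<omega>] k
        weight_ratio[OF \<omega>] .
  qed
  then have G: "gibbs_for SigmaA f \<mu>"
    unfolding gibbs_for_def Let_def using prob sets inv C(1) continuous_map_L2[OF f] by blast
  have "gibbs_measure SigmaA f = \<mu>"
    unfolding gibbs_measure_def
  proof (rule the_equality[where P = "gibbs_for SigmaA f", OF G])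
    fix \<nu> assume "gibbs_for SigmaA f \<nu>"
    then show "\<nu> = \<mu>"
    proof (rule gibbs_for_unique[OF G _ mixing_const_pos])
      fix v u :: "nat list" assume vu: "v \<noteq> []" "u \<noteq> []"
      show "mixing_const * measure \<mu> (wcyl v) * measure \<mu> (wcyl u) \<le> (\<Sum>x=1..3. measure \<mu> (wcyl (v @ [x] @ u)))"
      proof (cases "v \<in> words (length v) \<and> u \<in> words (length u)")
        case True
        then have v: "v \<in> words (length v)" and u: "u \<in> words (length u)" by auto
        have "v @ [x] @ u \<in> words (length v + Suc (length u))" if "x \<in> {1..3}" for x
          using v u that by (simp add: words_def)
        then have "(\<Sum>x=1..3. measure \<mu> (wcyl (v @ [x] @ u))) = (\<Sum>x=1..3. weight (v @ [x] @ u))"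
          by (intro sum.cong refl w)
        then show ?thesis using weight_quasi_bernoulli[OF v u vu] by (simp add: w[OF v] w[OF u])
      next
        case False
        then have "measure \<mu> (wcyl v) = 0 \<or> measure \<mu> (wcyl u) = 0" using wcyl_empty by auto
        then show ?thesis by (elim disjE) (simp_all add: sum_nonneg)
      qed
    qed
  qed
  then show "gibbs_for SigmaA f (gibbs_measure SigmaA f)"
    and "w \<in> words n \<Longrightarrow> measure (gibbs_measure SigmaA f) (wcyl w) = weight w"
    using G w by simp_all
qed

text \<open>By the Gibbs bounds, minus the logarithm of a cylinder's measure differs from the
  Birkhoff sum of \<open>ln lam - edge f\<close> by at most a constant, which disappears after
  division by \<open>n\<close>.\<close>

lemma level_set_eq_average_set:
  "level_set SigmaA (gibbs_measure SigmaA f) \<alpha> = average_set (\<lambda>i j. ln lam - edge f i j) \<alpha>"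
proof -
  let ?\<mu> = "gibbs_measure SigmaA f" and ?B = "\<lambda>\<omega>. birkhoff (\<lambda>i j. ln lam - edge f i j) \<omega>"
  obtain C where C: "0 < C" "\<And>\<omega> n. \<omega> \<in> SigmaA \<Longrightarrow>
    inverse C \<le> l (\<omega> 0) * h (\<omega> n) * lam / m (\<omega> n) (\<omega> (Suc n)) \<and>
    l (\<omega> 0) * h (\<omega> n) * lam / m (\<omega> n) (\<omega> (Suc n)) \<le> C"
    using ratio_bounds by blast
  have lim: "(\<lambda>n. - (1 / real n) * ln (measure ?\<mu> (cylinder SigmaA n \<omega>)) - ?B \<omega> n / real n) \<longlonglongrightarrow> 0"
    if \<omega>: "\<omega> \<in> SigmaA" for \<omega>
  proof -
    have est: "\<bar>- ln (measure ?\<mu> (cylinder SigmaA n \<omega>)) - ?B \<omega> n\<bar> \<le> \<bar>ln C\<bar>" if n: "0 < n" for n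
    proof -
      obtain k where k: "n = Suc k" using n by (cases n) auto
      let ?r = "l (\<omega> 0) * h (\<omega> k) * lam / m (\<omega> k) (\<omega> (Suc k))"
      have r: "inverse C \<le> ?r" "?r \<le> C" using C(2)[OF \<omega>] by auto
      then have "0 < ?r" using C(1) by (meson less_le_trans positive_imp_inverse_positive)
      have "measure ?\<mu> (cylinder SigmaA n \<omega>) = ?r * exp (- real n * ln lam + birkhoff (edge f) \<omega> n)"
        using weight_ratio[OF \<omega>, of k] unfolding cylinder_eq_wcyl measure_gibbs[OF prefix_in_words[OF \<omega>]] k
        by (simp add: field_simps)
      then have "ln (measure ?\<mu> (cylinder SigmaA n \<omega>)) = ln ?r + (- real n * ln lam + birkhoff (edge f) \<omega> n)"
        using \<open>0 < ?r\<close> by (simp only: ln_mult_pos exp_gt_zero ln_exp)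
      moreover have "?B \<omega> n = real n * ln lam - birkhoff (edge f) \<omega> n"
        by (simp add: birkhoff_def sum_subtractf)
      ultimately have "- ln (measure ?\<mu> (cylinder SigmaA n \<omega>)) - ?B \<omega> n = - ln ?r" by simp
      moreover have "- ln C \<le> ln ?r" "ln ?r \<le> ln C"
        using r \<open>0 < ?r\<close> C(1) by (simp_all flip: ln_inverse)
      ultimately show ?thesis by linarith
    qed
    have b: "(\<lambda>n. \<bar>ln C\<bar> / real n) \<longlonglongrightarrow> 0" by (rule lim_const_over_n)
    show ?thesis
    proof (rule Lim_null_comparison[OF _ b])
      show "\<forall>\<^sub>F n in sequentially. norm (- (1 / real n) * ln (measure ?\<mu> (cylinder SigmaA n \<omega>)) - ?B \<omega> n / real n) \<le> \<bar>ln C\<bar> / real n"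
        using eventually_gt_at_top[of 0]
      proof eventually_elim
        fix n :: nat assume n: "0 < n"
        have "- (1 / real n) * ln (measure ?\<mu> (cylinder SigmaA n \<omega>)) - ?B \<omega> n / real n
            = (- ln (measure ?\<mu> (cylinder SigmaA n \<omega>)) - ?B \<omega> n) / real n"
          by (simp add: diff_divide_distrib)
        then show "norm (- (1 / real n) * ln (measure ?\<mu> (cylinder SigmaA n \<omega>)) - ?B \<omega> n / real n) \<le> \<bar>ln C\<bar> / real n"
          using divide_right_mono[OF est[OF n], of "real n"] n by simp
      qed
    qed
  qed
  have "(\<lambda>n. - (1 / real n) * ln (measure ?\<mu> (cylinder SigmaA n \<omega>))) \<longlonglongrightarrow> \<alpha>
      \<longleftrightarrow> (\<lambda>n. ?B \<omega> n / real n) \<longlonglongrightarrow> \<alpha>" if "\<omega> \<in> SigmaA" for \<omega>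
    using tendsto_add[OF lim[OF that], of "\<lambda>n. ?B \<omega> n / real n" \<alpha>]
      tendsto_diff[OF _ lim[OF that], of "\<lambda>n. - (1 / real n) * ln (measure ?\<mu> (cylinder SigmaA n \<omega>))" \<alpha>]
    by fastforce
  then show ?thesis unfolding level_set_def average_set_def by blast
qed

lemma entropy_spectrum_eq:
  "entropy_spectrum SigmaA (gibbs_measure SigmaA f)
    = (\<lambda>\<alpha>. bowen_entropy SigmaA (average_set (\<lambda>i j. ln lam - edge f i j) \<alpha>))"
  by (simp add: entropy_spectrum_def level_set_eq_average_set)

end

subsection \<open>Perron eigenvectors\<close>

lemma sum_1_to_3: "(\<Sum>i=1..3. g i) = g 1 + g 2 + g (3 :: nat)" for g :: "nat \<Rightarrow> real"
  by (simp add: numeral_eq_Suc)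

text \<open>Pair the left eigenvector of \<open>m'\<close> with the right eigenvector of
  \<open>m\<close>: applying \<open>m'\<close> between them gives \<open>lam'\<close> times the
  pairing and, by \<open>le\<close>, at most \<open>K * lam\<close> times it. The pairing is
  positive.\<close>

lemma perron_root_le:
  assumes "perron m lam l h" "perron m' lam' l' h'"
    and le: "\<And>i j. i \<in> {1..3} \<Longrightarrow> j \<in> {1..3} \<Longrightarrow> m' i j \<le> K * m i j"
  shows "lam' \<le> K * lam"
proof -
  interpret A: perron m lam l h by fact
  interpret B: perron m' lam' l' h' by fact
  have "lam' * (\<Sum>j=1..3. l' j * h j) = (\<Sum>j=1..3. (\<Sum>i=1..3. l' i * m' i j) * h j)"
    unfolding sum_distrib_left by (intro sum.cong refl) (simp only: B.left mult.assoc)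
  also have "\<dots> \<le> (\<Sum>j=1..3. (\<Sum>i=1..3. l' i * (K * m i j)) * h j)"
    by (intro sum_mono mult_right_mono mult_left_mono le) (auto simp: less_imp_le A.h_pos B.l_pos)
  also have "\<dots> = K * (\<Sum>i=1..3. l' i * (\<Sum>j=1..3. m i j * h j))"
    unfolding sum_1_to_3 by (simp add: algebra_simps)
  also have "\<dots> = K * (\<Sum>i=1..3. l' i * (lam * h i))"
    by (intro arg_cong[where f = "(*) K"] sum.cong refl) (simp only: A.right)
  also have "\<dots> = (K * lam) * (\<Sum>j=1..3. l' j * h j)"
    unfolding sum_1_to_3 by (simp add: algebra_simps)
  finally show ?thesis
    using A.h_pos B.l_pos by (subst (asm) mult_le_cancel_right_pos) (auto intro!: sum_pos)
qed

lemma perron_transpose: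
  assumes "perron m lam l h"
  shows "perron (\<lambda>i j. m j i) lam h l"
proof -
  interpret perron m lam l h by fact
  show ?thesis
    by unfold_locales (use m_pos m_diag lam_pos l_pos h_pos left right norm in \<open>simp_all add: mult.commute\<close>)
qed

text \<open>The first row of the adjugate of \<open>lam - m\<close>.\<close>

definition adj :: "(nat \<Rightarrow> nat \<Rightarrow> real) \<Rightarrow> real \<Rightarrow> nat \<Rightarrow> real" where
  "adj m lam j = (if j = 1 then lam\<^sup>2 - m 2 3 * m 3 2
    else if j = 2 then lam * m 1 2 + m 1 3 * m 3 2 else lam * m 1 3 + m 1 2 * m 2 3)"

text \<open>A positive root of the characteristic polynomial; as the diagonal is zero, its
  coefficients are the sums of the weights of the cycles of length 2 and 3.\<close>

definition char_root :: "(nat \<Rightarrow> nat \<Rightarrow> real) \<Rightarrow> real \<Rightarrow> bool" where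
  "char_root m lam \<longleftrightarrow> 0 < lam \<and>
     lam ^ 3 = (m 1 2 * m 2 1 + m 1 3 * m 3 1 + m 2 3 * m 3 2) * lam
       + (m 1 2 * m 2 3 * m 3 1 + m 1 3 * m 3 2 * m 2 1)"

locale positive_matrix =
  fixes m :: "nat \<Rightarrow> nat \<Rightarrow> real"
  assumes m_pos: "\<And>i j. i \<in> {1..3} \<Longrightarrow> j \<in> {1..3} \<Longrightarrow> i \<noteq> j \<Longrightarrow> 0 < m i j"
    and m_diag: "\<And>i. m i i = 0"
begin

lemma entries: "0 < m 1 2" "0 < m 2 1" "0 < m 1 3" "0 < m 3 1" "0 < m 2 3" "0 < m 3 2"
  by (simp_all add: m_pos)

lemma char_root_exists: "\<exists>lam. char_root m lam"
proof -
  define X where "X = m 1 2 * m 2 1 + m 1 3 * m 3 1 + m 2 3 * m 3 2"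
  define C where "C = m 1 2 * m 2 3 * m 3 1 + m 1 3 * m 3 2 * m 2 1"
  have pos: "0 < X" "0 < C" using entries by (simp_all add: X_def C_def add_pos_pos)
  define p where "p t = t ^ 3 - X * t - C" for t
  \<comment> \<open>Large enough for \<open>p\<close> to be nonnegative there:
    \<open>t ^ 3 - X * t\<close> is at least \<open>t * (t - X) = t * (1 + C)\<close>, which exceeds
    \<open>C\<close>.\<close>
  define t where "t = 1 + X + C"
  have "1 \<le> t" using pos by (simp add: t_def)
  then have "t * t \<le> t ^ 3" "t \<le> t * t" by (simp_all add: power3_eq_cube)
  moreover have "t * (1 + C) = t * t - X * t" by (simp add: t_def algebra_simps)
  moreover have "1 * (1 + C) \<le> t * (1 + C)" using \<open>1 \<le> t\<close> pos by (intro mult_right_mono) auto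
  ultimately have "0 \<le> p t" by (simp add: p_def)
  moreover have "p 0 \<le> 0" using pos by (simp add: p_def)
  moreover have "continuous_on {0..t} p" unfolding p_def by (intro continuous_intros)
  ultimately obtain lam where lam: "0 \<le> lam" "p lam = 0"
    using IVT'[of p 0 0 t] \<open>1 \<le> t\<close> by auto
  then have "lam \<noteq> 0" using pos by (auto simp: p_def)
  with lam show ?thesis by (intro exI[of _ lam]) (simp add: char_root_def p_def X_def C_def)
qed

text \<open>Only the first entry contains a subtraction. It is positive because
  \<open>lam ^ 3\<close> exceeds \<open>m 2 3 * m 3 2 * lam\<close> by the remaining positive terms
  of the characteristic equation.\<close>

lemma adj_pos:
  assumes "char_root m lam" "j \<in> {1..3}"
  shows "0 < adj m lam j"
proof -
  have lam: "0 < lam" using assms(1) by (simp add: char_root_def)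
  have "m 2 3 * m 3 2 * lam < lam\<^sup>2 * lam"
  proof -
    have "lam\<^sup>2 * lam = lam ^ 3" by (simp add: power2_eq_square power3_eq_cube)
    moreover have "0 < m 1 2 * m 2 1 * lam" "0 < m 1 3 * m 3 1 * lam"
      "0 < m 1 2 * m 2 3 * m 3 1" "0 < m 1 3 * m 3 2 * m 2 1"
      using entries lam by simp_all
    ultimately show ?thesis using assms(1) unfolding char_root_def by (simp add: algebra_simps)
  qed
  then have "m 2 3 * m 3 2 < lam\<^sup>2" using lam by simp
  then show ?thesis using assms(2) entries lam by (simp add: adj_def add_pos_pos)
qed

lemma char_root_transpose: "char_root (\<lambda>i j. m j i) lam = char_root m lam"
  by (simp add: char_root_def ac_simps)

text \<open>The first row of the adjugate times \<open>lam - m\<close> is the determinant times the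
  first unit vector. Hence the first column needs the characteristic equation, while the other two
  are identities.\<close>

lemma adj_left:
  assumes "char_root m lam" "j \<in> {1..3}"
  shows "(\<Sum>i=1..3. adj m lam i * m i j) = lam * adj m lam j"
proof -
  have *: "lam ^ 3 = (m 1 2 * m 2 1 + m 1 3 * m 3 1 + m 2 3 * m 3 2) * lam
       + (m 1 2 * m 2 3 * m 3 1 + m 1 3 * m 3 2 * m 2 1)"
    using assms(1) by (simp add: char_root_def)
  from assms(2) consider "j = 1" | "j = 2" | "j = 3" unfolding alphabet by blast
  then show ?thesis
  proof cases
    case 1
    then show ?thesis using * unfolding sum_1_to_3
      by (simp add: adj_def m_diag[of 1] m_diag algebra_simps power2_eq_square power3_eq_cube)
  next
    case 2
    then show ?thesis unfolding sum_1_to_3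
      by (simp add: adj_def m_diag algebra_simps power2_eq_square)
  next
    case 3
    then show ?thesis unfolding sum_1_to_3
      by (simp add: adj_def m_diag algebra_simps power2_eq_square)
  qed
qed

lemma perron_adj:
  assumes "char_root m lam"
  defines "s \<equiv> \<Sum>i=1..3. adj m lam i * adj (\<lambda>i j. m j i) lam i"
  shows "perron m lam (\<lambda>i. adj m lam i / s) (adj (\<lambda>i j. m j i) lam)"
proof -
  interpret T: positive_matrix "\<lambda>i j. m j i"
    by unfold_locales (auto simp: m_pos m_diag)
  have r: "char_root (\<lambda>i j. m j i) lam" using assms by (simp add: char_root_transpose)
  have s: "0 < s"
    unfolding s_def using adj_pos[OF assms(1)] T.adj_pos[OF r] by (intro sum_pos) auto
  show ?thesis
  proof
    show "(\<Sum>i=1..3. adj m lam i / s * m i j) = lam * (adj m lam j / s)" if "j \<in> {1..3}" for j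
      using adj_left[OF assms(1) that] by (simp add: sum_divide_distrib[symmetric])
    show "(\<Sum>j=1..3. m i j * adj (\<lambda>i j. m j i) lam j) = lam * adj (\<lambda>i j. m j i) lam i" if "i \<in> {1..3}" for i
      using T.adj_left[OF r that] by (simp add: mult.commute)
    show "(\<Sum>i=1..3. adj m lam i / s * adj (\<lambda>i j. m j i) lam i) = 1"
      unfolding times_divide_eq_left sum_divide_distrib[symmetric] s_def[symmetric] using s by simp
    show "0 < lam" using assms by (simp add: char_root_def)
  qed (use m_pos m_diag adj_pos[OF assms(1)] T.adj_pos[OF r] s in \<open>auto\<close>)
qed

end

lemma positive_matrix_weight: "positive_matrix (weight_matrix f)"
  by unfold_locales (auto simp: weight_matrix_def)

definition root_of :: "((nat \<Rightarrow> nat) \<Rightarrow> real) \<Rightarrow> real" where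
  "root_of f = (SOME lam. char_root (weight_matrix f) lam)"

lemma char_root_of: "char_root (weight_matrix f) (root_of f)"
  unfolding root_of_def by (rule someI_ex) (rule positive_matrix.char_root_exists[OF positive_matrix_weight])

text \<open>The second conclusion records that the left eigenvector is, up to normalisation, an
  explicit polynomial in the entries and the root; continuity of the ratios rests on it.\<close>

lemma perron_potential_exists:
  assumes "f \<in> L2"
  obtains l h where "perron_potential f (root_of f) l h"
    "\<exists>s>0. \<forall>i. l i = adj (weight_matrix f) (root_of f) i / s"
proof -
  interpret positive_matrix "weight_matrix f" by (rule positive_matrix_weight)
  let ?a = "adj (weight_matrix f) (root_of f)" and ?b = "adj (\<lambda>i j. weight_matrix f j i) (root_of f)"
  let ?s = "\<Sum>i=1..3. ?a i * ?b i"
  have p: "perron (weight_matrix f) (root_of f) (\<lambda>i. ?a i / ?s) ?b"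
    by (rule perron_adj[OF char_root_of])
  then have "0 < ?a 1 / ?s" by (rule perron.l_pos) simp
  moreover have "0 < ?a 1" by (rule adj_pos[OF char_root_of]) simp
  ultimately have "0 < ?s" by (simp add: zero_less_divide_iff)
  then have "\<exists>s>0. \<forall>i. ?a i / ?s = ?a i / s" by blast
  moreover have "perron_potential f (root_of f) (\<lambda>i. ?a i / ?s) ?b"
    using p assms by (simp add: perron_potential_def perron_potential_axioms_def)
  ultimately show thesis by (intro that)
qed

subsection \<open>The reversed potential\<close>

definition reverse :: "((nat \<Rightarrow> nat) \<Rightarrow> real) \<Rightarrow> (nat \<Rightarrow> nat) \<Rightarrow> real" where
  "reverse f = (\<lambda>\<omega>\<in>SigmaA. edge f (\<omega> 1) (\<omega> 0))"

lemma reverse_L2: "reverse f \<in> L2"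
  by (auto simp: locally_const_def reverse_def)

lemma edge_reverse:
  "i \<in> {1..3} \<Longrightarrow> j \<in> {1..3} \<Longrightarrow> i \<noteq> j \<Longrightarrow> edge (reverse f) i j = edge f j i"
proof -
  assume "i \<in> {1..3}" "j \<in> {1..3}" "i \<noteq> j"
  then have "(\<lambda>n. if even n then i else j) \<in> SigmaA" by (rule alternating_SigmaA)
  then have "reverse f (\<lambda>n. if even n then i else j) = edge f j i" by (simp add: reverse_def)
  then show ?thesis by (simp only: edge_def[of "reverse f"])
qed

lemma weight_matrix_reverse: "weight_matrix (reverse f) = (\<lambda>i j. weight_matrix f j i)"
  by (intro ext) (simp add: weight_matrix_def edge_reverse del: atLeastAtMost_iff)

lemma perron_potential_reverse:
  "perron_potential f lam l h \<Longrightarrow> perron_potential (reverse f) lam h l"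
  unfolding perron_potential_def perron_potential_axioms_def weight_matrix_reverse
  by (simp add: perron_transpose reverse_L2)

lemma average_set_cong:
  assumes "\<And>i j. i \<in> {1..3} \<Longrightarrow> j \<in> {1..3} \<Longrightarrow> i \<noteq> j \<Longrightarrow> a i j = b i j"
  shows "average_set a \<alpha> = average_set b \<alpha>"
proof -
  have "birkhoff a \<omega> n = birkhoff b \<omega> n" if "\<omega> \<in> SigmaA" for \<omega> n
    unfolding birkhoff_def using SigmaA_mem[OF that] SigmaA_neq[OF that]
    by (intro sum.cong refl assms)
  then show ?thesis by (auto simp: average_set_def)
qed

text \<open>A matrix and its transpose share the eigenvalue, so the two families of level sets are
  the average sets of a function of two letters and of its transpose.\<close>

lemma entropy_spectrum_reverse:
  assumes "f \<in> L2"
  shows "entropy_spectrum SigmaA (gibbs_measure SigmaA (reverse f)) = entropy_spectrum SigmaA (gibbs_measure SigmaA f)"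
proof -
  obtain l h where p: "perron_potential f (root_of f) l h"
    using perron_potential_exists[OF assms] by blast
  interpret A: perron_potential f "root_of f" l h by (rule p)
  interpret B: perron_potential "reverse f" "root_of f" h l by (rule perron_potential_reverse[OF p])
  \<comment> \<open>Cutting off to 0 outside the alphabet makes the function bounded for all
    arguments and does not change the average sets.\<close>
  define a where "a i j = (if i \<in> {1..3} \<and> j \<in> {1..3} then ln (root_of f) - edge f i j else 0)" for i j
  define A where "A = (\<Sum>(i, j)\<in>{1..3} \<times> {1..3}. \<bar>a i j\<bar>)"
  have A: "\<bar>a i j\<bar> \<le> A" for i j
  proof (cases "i \<in> {1..3} \<and> j \<in> {1..3}")
    case True
    have "(case (i, j) of (i, j) \<Rightarrow> \<bar>a i j\<bar>) \<le> A"
      unfolding A_def using True by (intro member_le_sum) auto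
    then show ?thesis by simp
  next
    case False
    then have "a i j = 0" by (auto simp: a_def)
    moreover have "0 \<le> A" unfolding A_def by (intro sum_nonneg) auto
    ultimately show ?thesis by simp
  qed
  have 1: "average_set (\<lambda>i j. ln (root_of f) - edge f i j) \<alpha> = average_set a \<alpha>" for \<alpha>
    by (rule average_set_cong) (simp add: a_def)
  have 2: "average_set (\<lambda>i j. ln (root_of f) - edge (reverse f) i j) \<alpha> = average_set (\<lambda>i j. a j i) \<alpha>" for \<alpha>
    by (rule average_set_cong) (simp add: a_def edge_reverse)
  show ?thesis
    unfolding A.entropy_spectrum_eq B.entropy_spectrum_eq 1 2
    using bowen_entropy_average_reverse[of a A, OF A] by simp
qed

subsection \<open>Rigidity of isomorphisms\<close>

definition edges :: "(nat \<times> nat) set" where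
  "edges = {(i, j). i \<in> {1..3} \<and> j \<in> {1..3} \<and> i \<noteq> j}"

lemma finite_edges: "finite edges"
  by (rule finite_subset[of _ "{1..3} \<times> {1..3}"]) (auto simp: edges_def)

text \<open>The conditional probability that the letter before \<open>j\<close> is
  \<open>i\<close>.\<close>

definition ratio :: "((nat \<Rightarrow> nat) \<Rightarrow> real) \<Rightarrow> nat \<Rightarrow> nat \<Rightarrow> real" where
  "ratio f i j = measure (gibbs_measure SigmaA f) (wcyl [i, j]) / measure (gibbs_measure SigmaA f) (wcyl [j])"

text \<open>A branch of the inverse of the shift. Where \<open>i\<close> cannot be put in front, the
  point is left unchanged, so that the map is defined on all of \<open>SigmaA\<close> and stays in
  it.\<close>

definition prepend :: "nat \<Rightarrow> (nat \<Rightarrow> nat) \<Rightarrow> nat \<Rightarrow> nat" where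
  "prepend i \<omega> = (if \<omega> 0 = i then \<omega> else case_nat i \<omega>)"

lemma prepend_shift: "\<omega> \<in> SigmaA \<Longrightarrow> \<omega> 0 = i \<Longrightarrow> prepend i (shift \<omega>) = \<omega>"
  using SigmaA_neq[of \<omega> 0] by (auto simp: prepend_def shift_def fun_eq_iff split: nat.split)

lemma prepend_SigmaA:
  assumes "i \<in> {1..3}" "\<omega> \<in> SigmaA"
  shows "prepend i \<omega> \<in> SigmaA"
proof (cases "\<omega> 0 = i")
  case False
  have "case_nat i \<omega> n \<in> {1..3} \<and> case_nat i \<omega> n \<noteq> case_nat i \<omega> (Suc n)" for n
    using assms(1) False SigmaA_mem[OF assms(2)] SigmaA_neq[OF assms(2)] by (cases n) simp_all
  then show ?thesis using False unfolding SigmaA_iff prepend_def by simp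
qed (simp add: prepend_def assms)

lemma shift_prepend: "\<omega> 0 \<noteq> i \<Longrightarrow> shift (prepend i \<omega>) = \<omega>"
  by (simp add: prepend_def shift_def)

lemma SigmaA_sets [simp]: "SigmaA \<in> sets (seq_borel SigmaA)"
  using wcyl_sets[of "[]"] by simp

lemma prepend_measurable:
  assumes i: "i \<in> {1..3}"
  shows "prepend i \<in> seq_borel SigmaA \<rightarrow>\<^sub>M seq_borel SigmaA"
proof (rule measurable_into_seq_borel)
  show "prepend i \<in> space (seq_borel SigmaA) \<rightarrow> SigmaA" using prepend_SigmaA[OF i] by auto
  fix w
  show "prepend i -` wcyl w \<inter> space (seq_borel SigmaA) \<in> sets (seq_borel SigmaA)"
  proof (cases w)
    case Nil
    then have "prepend i -` wcyl w \<inter> space (seq_borel SigmaA) = SigmaA"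
      using prepend_SigmaA[OF i] by auto
    then show ?thesis by simp
  next
    case (Cons x v)
    have "prepend i \<omega> \<in> wcyl w \<longleftrightarrow> (\<omega> \<in> wcyl [i] \<and> \<omega> \<in> wcyl w) \<or> (\<omega> \<notin> wcyl [i] \<and> x = i \<and> \<omega> \<in> wcyl v)"
      if "\<omega> \<in> SigmaA" for \<omega>
    proof (cases "\<omega> 0 = i")
      case True
      then have "prepend i \<omega> = \<omega>" by (simp add: prepend_def)
      then show ?thesis using True that by (simp add: mem_wcyl_Cons shift_SigmaA)
    next
      case False
      then have "prepend i \<omega> 0 = i" by (simp add: prepend_def)
      then show ?thesis
        using False that prepend_SigmaA[OF i that] shift_prepend[of \<omega> i, OF False] by (auto simp: Cons mem_wcyl_Cons)
    qed
    then have "prepend i -` wcyl w \<inter> space (seq_borel SigmaA)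
        = (wcyl [i] \<inter> wcyl w) \<union> ((wcyl [] - wcyl [i]) \<inter> (if x = i then wcyl v else {}))"
      using wcyl_subset by (auto simp: Int_def)
    also have "\<dots> \<in> sets (seq_borel SigmaA)" by (intro sets.Un sets.Int sets.Diff) auto
    finally show ?thesis .
  qed
qed

section \<open>The Jacobian of the shift\<close>

context perron_potential
begin

abbreviation "\<mu> \<equiv> gibbs_measure SigmaA f"

lemma sets_\<mu> [simp]: "sets \<mu> = sets (seq_borel SigmaA)"
  and prob_\<mu>: "prob_space \<mu>"
  and invariant_\<mu>: "distr \<mu> \<mu> shift = \<mu>"
  using gibbs_forD[OF gibbs] by auto

sublocale prob_space \<mu> by (rule prob_\<mu>)

lemma space_\<mu> [simp]: "space \<mu> = SigmaA"
  using sets_eq_imp_space_eq[OF sets_\<mu>] by simp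

lemma measurable_\<mu>: "g \<in> \<mu> \<rightarrow>\<^sub>M \<mu> \<longleftrightarrow> g \<in> seq_borel SigmaA \<rightarrow>\<^sub>M seq_borel SigmaA"
  using measurable_cong_sets[OF sets_\<mu> sets_\<mu>] by auto

lemma measure_Cons_Cons:
  assumes "i \<in> {1..3}" "j # w \<in> words n"
  shows "measure \<mu> (wcyl (i # j # w)) = l i * m i j / (lam * l j) * measure \<mu> (wcyl (j # w))"
proof -
  have j: "j \<in> {1..3}" and "i # j # w \<in> words (Suc n)" using assms by (auto simp: words_def)
  then show ?thesis
    using measure_gibbs[of "i # j # w"] measure_gibbs[OF assms(2)] l_pos[OF j] by simp
qed

lemma measure_single: "j \<in> {1..3} \<Longrightarrow> measure \<mu> (wcyl [j]) = l j * h j"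
  using measure_gibbs[of "[j]" 1] by (simp add: words_def)

lemma ratio_eq:
  assumes "i \<in> {1..3}" "j \<in> {1..3}"
  shows "ratio f i j = l i * m i j / (lam * l j)"
  using measure_Cons_Cons[OF assms(1), of j "[]" 1] assms(2) measure_single[OF assms(2)]
    l_pos[OF assms(2)] h_pos[OF assms(2)]
  by (simp add: ratio_def words_def)

lemma measure_Cons_Cons':
  assumes "i \<in> {1..3}"
  shows "measure \<mu> (wcyl (i # j # w)) = ratio f i j * measure \<mu> (wcyl (j # w))"
proof (cases "j # w \<in> words (length (j # w))")
  case True
  then have "j \<in> {1..3}" by (simp add: words_def)
  then show ?thesis using measure_Cons_Cons[OF assms True] ratio_eq[OF assms] by simp
next
  case False
  then have "wcyl (j # w) = {}" by (rule wcyl_empty)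
  moreover from this have "wcyl (i # j # w) = {}" by (auto simp: mem_wcyl_Cons[of _ i])
  ultimately show ?thesis by simp
qed

lemma ratio_pos: "(i, j) \<in> edges \<Longrightarrow> 0 < ratio f i j"
  using ratio_eq[of i j] l_pos[of i] l_pos[of j] m_pos[of i j] lam_pos by (simp add: edges_def)

lemma measure_wcyl_pos:
  "i \<in> {1..3} \<Longrightarrow> 0 < measure \<mu> (wcyl [i])"
  "(i, j) \<in> edges \<Longrightarrow> 0 < measure \<mu> (wcyl [i, j])"
  "(i, j) \<in> edges \<Longrightarrow> (j, k) \<in> edges \<Longrightarrow> 0 < measure \<mu> (wcyl [i, j, k])"
proof -
  show 1: "0 < measure \<mu> (wcyl [i])" if "i \<in> {1..3}" for i
    using that measure_single l_pos h_pos by simp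
  show 2: "0 < measure \<mu> (wcyl [i, j])" if "(i, j) \<in> edges" for i j
    using that 1[of j] ratio_pos[OF that] measure_Cons_Cons'[of i j "[]"] by (simp add: edges_def)
  show "0 < measure \<mu> (wcyl [i, j, k])" if "(i, j) \<in> edges" "(j, k) \<in> edges"
    using that 2[of j k] ratio_pos[OF that(1)] measure_Cons_Cons'[of i j "[k]"] by (simp add: edges_def)
qed

text \<open>As functions of \<open>E\<close> both sides are finite measures, so cylinders suffice;
  there it is the Markov property \<open>measure_Cons_Cons'\<close>.\<close>

lemma measure_Int_shift_vimage:
  assumes ij: "(i, j) \<in> edges" and E: "E \<in> sets (seq_borel SigmaA)"
  shows "measure \<mu> (wcyl [i, j] \<inter> (shift -` E \<inter> SigmaA)) = ratio f i j * measure \<mu> (wcyl [j] \<inter> E)"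
proof -
  define M1 where "M1 = distr (density \<mu> (indicator (wcyl [i, j]))) (seq_borel SigmaA) shift"
  define M2 where "M2 = scale_measure (ennreal (ratio f i j)) (density \<mu> (indicator (wcyl [j])))"
  have sm: "shift \<in> density \<mu> (indicator (wcyl [i, j])) \<rightarrow>\<^sub>M seq_borel SigmaA"
  proof -
    have "sets (density \<mu> (indicator (wcyl [i, j]))) = sets (seq_borel SigmaA)" by simp
    from measurable_cong_sets[OF this refl] shift_measurable show ?thesis by blast
  qed
  have M1: "emeasure M1 A = ennreal (measure \<mu> (wcyl [i, j] \<inter> (shift -` A \<inter> SigmaA)))"
    if A: "A \<in> sets (seq_borel SigmaA)" for A
  proof -
    have "shift -` A \<inter> SigmaA \<in> sets (seq_borel SigmaA)"
      using measurable_sets[OF shift_measurable A] by simp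
    then show ?thesis
      unfolding M1_def using A by (simp add: emeasure_distr[OF sm] emeasure_restricted emeasure_eq_measure)
  qed
  have M2: "emeasure M2 A = ennreal (ratio f i j * measure \<mu> (wcyl [j] \<inter> A))"
    if A: "A \<in> sets (seq_borel SigmaA)" for A
    unfolding M2_def using A ratio_pos[OF ij]
    by (simp add: emeasure_restricted emeasure_eq_measure ennreal_mult)
  have "M1 = M2"
  proof (rule measure_eqI_wcyl)
    show "sets M1 = sets (seq_borel SigmaA)" "sets M2 = sets (seq_borel SigmaA)"
      by (simp_all add: M1_def M2_def)
    have "emeasure M1 SigmaA \<noteq> \<infinity>" using M1[of SigmaA] wcyl_sets[of "[]"] by simp
    then show "finite_measure M1" by (intro finite_measureI) (simp add: M1_def)
    fix w
    have "measure \<mu> (wcyl [i, j] \<inter> (shift -` wcyl w \<inter> SigmaA)) = ratio f i j * measure \<mu> (wcyl [j] \<inter> wcyl w)"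
    proof (cases w)
      case Nil
      then have "wcyl [i, j] \<inter> (shift -` wcyl w \<inter> SigmaA) = wcyl [i, j]" "wcyl [j] \<inter> wcyl w = wcyl [j]"
        using wcyl_subset shift_SigmaA by (auto simp: vimage_def)
      then show ?thesis using measure_Cons_Cons'[of i j "[]"] ij by (simp add: edges_def)
    next
      case (Cons y v)
      show ?thesis
      proof (cases "y = j")
        case True
        have "wcyl [i, j] \<inter> (shift -` wcyl w \<inter> SigmaA) = wcyl (i # j # v)" "wcyl [j] \<inter> wcyl w = wcyl (j # v)"
          using shift_SigmaA by (auto simp: Cons True mem_wcyl_Cons)
        then show ?thesis using measure_Cons_Cons'[of i j v] ij by (simp add: edges_def)
      next
        case False
        then have "wcyl [i, j] \<inter> (shift -` wcyl w \<inter> SigmaA) = {}" "wcyl [j] \<inter> wcyl w = {}"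
          by (auto simp: Cons mem_wcyl_Cons)
        then show ?thesis by simp
      qed
    qed
    then show "emeasure M1 (wcyl w) = emeasure M2 (wcyl w)" by (simp add: M1 M2)
  qed
  then have "ennreal (measure \<mu> (wcyl [i, j] \<inter> (shift -` E \<inter> SigmaA))) = ennreal (ratio f i j * measure \<mu> (wcyl [j] \<inter> E))"
    using M1[OF E] M2[OF E] by simp
  then show ?thesis using ratio_pos[OF ij] by simp
qed

text \<open>The Jacobian of the shift at \<open>\<omega>\<close> is the inverse of \<open>ratio f (\<omega> 0) (\<omega> 1)\<close>.\<close>

lemma measure_shift_image:
  assumes ij: "(i, j) \<in> edges" and B: "B \<in> sets (seq_borel SigmaA)" "B \<subseteq> wcyl [i, j]"
  shows "shift ` B \<in> sets (seq_borel SigmaA)" "measure \<mu> B = ratio f i j * measure \<mu> (shift ` B)"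
proof -
  have i: "i \<in> {1..3}" and "i \<noteq> j" using ij by (simp_all add: edges_def)
  have BD: "\<omega> \<in> SigmaA \<and> \<omega> 0 = i \<and> shift \<omega> \<in> wcyl [j]" if "\<omega> \<in> B" for \<omega>
    using B(2) that mem_wcyl_Cons by blast
  \<comment> \<open>The image under the shift is a preimage under a measurable branch of its
    inverse, hence measurable.\<close>
  have E: "shift ` B = wcyl [j] \<inter> (prepend i -` B \<inter> SigmaA)"
  proof (intro set_eqI iffI)
    fix \<omega> assume "\<omega> \<in> shift ` B"
    then obtain \<omega>' where "\<omega>' \<in> B" "\<omega> = shift \<omega>'" by blast
    then show "\<omega> \<in> wcyl [j] \<inter> (prepend i -` B \<inter> SigmaA)"
      using BD[of \<omega>'] prepend_shift[of \<omega>' i] shift_SigmaA by simp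
  next
    fix \<omega> assume \<omega>: "\<omega> \<in> wcyl [j] \<inter> (prepend i -` B \<inter> SigmaA)"
    then have "\<omega> 0 \<noteq> i" using \<open>i \<noteq> j\<close> by (simp add: mem_wcyl_Cons)
    then have "\<omega> = shift (prepend i \<omega>)" by (simp add: shift_prepend)
    then show "\<omega> \<in> shift ` B" using \<omega> by blast
  qed
  show s: "shift ` B \<in> sets (seq_borel SigmaA)"
    unfolding E using measurable_sets[OF prepend_measurable[OF i] B(1)] by simp
  have "wcyl [i, j] \<inter> (shift -` (shift ` B) \<inter> SigmaA) = B"
  proof (intro set_eqI iffI)
    fix \<omega> assume \<omega>: "\<omega> \<in> wcyl [i, j] \<inter> (shift -` (shift ` B) \<inter> SigmaA)"
    then obtain \<omega>' where \<omega>': "\<omega>' \<in> B" "shift \<omega> = shift \<omega>'" by blast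
    have "\<omega> = prepend i (shift \<omega>)" using \<omega> by (subst prepend_shift) (auto simp: mem_wcyl_Cons)
    also have "\<dots> = \<omega>'" unfolding \<omega>'(2) using BD[OF \<omega>'(1)] by (simp add: prepend_shift)
    finally show "\<omega> \<in> B" using \<omega>' by simp
  qed (use B(2) BD in auto)
  moreover have "wcyl [j] \<inter> shift ` B = shift ` B" using BD by auto
  ultimately show "measure \<mu> B = ratio f i j * measure \<mu> (shift ` B)"
    using measure_Int_shift_vimage[OF ij s] by simp
qed

lemma null_sets_shift_pow:
  assumes "N \<in> null_sets \<mu>"
  shows "(shift ^^ n) -` N \<inter> SigmaA \<in> null_sets \<mu>"
proof (induction n)
  case 0
  have "N \<subseteq> SigmaA" using sets.sets_into_space[OF null_setsD2[OF assms]] by simp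
  then show ?case using assms by (simp add: Int_absorb2)
next
  case (Suc n)
  have sm: "shift \<in> \<mu> \<rightarrow>\<^sub>M \<mu>" using shift_measurable by (simp add: measurable_\<mu>)
  let ?N = "(shift ^^ n) -` N \<inter> SigmaA"
  have N: "?N \<in> sets \<mu>" "emeasure \<mu> ?N = 0" using Suc by blast+
  have eq: "(shift ^^ Suc n) -` N \<inter> SigmaA = shift -` ?N \<inter> space \<mu>"
    using shift_SigmaA by (auto simp: funpow_swap1)
  show ?case
    unfolding eq
  proof (rule null_setsI)
    have "emeasure \<mu> (shift -` ?N \<inter> space \<mu>) = emeasure (distr \<mu> \<mu> shift) ?N"
      by (rule emeasure_distr[OF sm N(1), symmetric])
    then show "emeasure \<mu> (shift -` ?N \<inter> space \<mu>) = 0" unfolding invariant_\<mu> N(2) .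
    show "shift -` ?N \<inter> space \<mu> \<in> sets \<mu>" by (rule measurable_sets[OF sm N(1)])
  qed
qed

end

section \<open>Isomorphisms and permutations of the letters\<close>

lemma shift_pow_commute:
  assumes "\<And>\<omega>. \<omega> \<in> X \<Longrightarrow> \<Phi> (shift \<omega>) = shift (\<Phi> \<omega>)" "shift ` X \<subseteq> X" "\<omega> \<in> X"
  shows "(shift ^^ n) \<omega> \<in> X \<and> \<Phi> ((shift ^^ n) \<omega>) = (shift ^^ n) (\<Phi> \<omega>)"
  using assms by (induction n) (auto simp: image_subset_iff)

lemma shift_isomorphicE:
  assumes "shift_isomorphic S \<mu> \<nu>"
  obtains X Y \<Phi> where "X \<in> sets (seq_borel S)" "Y \<in> sets (seq_borel S)" "bij_betw \<Phi> X Y"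
    "shift ` X \<subseteq> X" "shift ` Y \<subseteq> Y" "measure \<mu> X = 1" "measure \<nu> Y = 1"
    "\<Phi> \<in> restrict_space (seq_borel S) X \<rightarrow>\<^sub>M restrict_space (seq_borel S) Y"
    "inv_into X \<Phi> \<in> restrict_space (seq_borel S) Y \<rightarrow>\<^sub>M restrict_space (seq_borel S) X"
    "\<forall>\<omega>\<in>X. \<Phi> (shift \<omega>) = shift (\<Phi> \<omega>)"
    "\<forall>B \<in> sets (seq_borel S). B \<subseteq> X \<longrightarrow> measure \<mu> B = measure \<nu> (\<Phi> ` B)"
  using assms unfolding shift_isomorphic_def by (elim bexE exE conjE) (rule that; assumption)

text \<open>Almost every point and its image have the same ratio at every position. Distinctness of
  the six ratios turns this into a bijection of the edges, and the overlap of consecutive edges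
  turns that into a bijection of the letters.\<close>

lemma isomorphism_rigid:
  assumes f: "f \<in> L2" and g: "g \<in> L2"
    and iso: "shift_isomorphic SigmaA (gibbs_measure SigmaA f) (gibbs_measure SigmaA g)"
    and inj: "inj_on (\<lambda>(i, j). ratio f i j) edges"
  obtains \<tau> where "bij_betw \<tau> {1..3} {1..3}"
    "\<And>n w. w \<in> words n \<Longrightarrow>
      measure (gibbs_measure SigmaA g) (wcyl (map \<tau> w)) = measure (gibbs_measure SigmaA f) (wcyl w)"
proof -
  obtain lf hf where "perron_potential f (root_of f) lf hf"
    using perron_potential_exists[OF f] by blast
  then interpret F: perron_potential f "root_of f" lf hf .
  obtain lg hg where "perron_potential g (root_of g) lg hg"
    using perron_potential_exists[OF g] by blast
  then interpret G: perron_potential g "root_of g" lg hg .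
  let ?\<mu> = "gibbs_measure SigmaA f" and ?\<nu> = "gibbs_measure SigmaA g" and ?B = "seq_borel SigmaA"
  obtain X Y \<Phi> where X: "X \<in> sets ?B" and Y: "Y \<in> sets ?B"
    and bij: "bij_betw \<Phi> X Y" and sX: "shift ` X \<subseteq> X" and sY: "shift ` Y \<subseteq> Y"
    and X1: "measure ?\<mu> X = 1" and Y1: "measure ?\<nu> Y = 1"
    and \<Phi>m: "\<Phi> \<in> restrict_space ?B X \<rightarrow>\<^sub>M restrict_space ?B Y"
    and im: "inv_into X \<Phi> \<in> restrict_space ?B Y \<rightarrow>\<^sub>M restrict_space ?B X"
    and comm': "\<forall>\<omega>\<in>X. \<Phi> (shift \<omega>) = shift (\<Phi> \<omega>)"
    and meas': "\<forall>B\<in>sets ?B. B \<subseteq> X \<longrightarrow> measure ?\<mu> B = measure ?\<nu> (\<Phi> ` B)"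
    using iso by (rule shift_isomorphicE)
  have comm: "\<Phi> (shift \<omega>) = shift (\<Phi> \<omega>)" if "\<omega> \<in> X" for \<omega>
    using comm' that by (rule bspec)
  have meas: "measure ?\<mu> B = measure ?\<nu> (\<Phi> ` B)" if "B \<in> sets ?B" "B \<subseteq> X" for B
    using bspec[OF meas' that(1)] that(2) by (rule mp)
  have subX: "X \<subseteq> SigmaA" and subY: "Y \<subseteq> SigmaA"
    using sets.sets_into_space[OF X] sets.sets_into_space[OF Y] by simp_all
  have Phi_Y: "\<Phi> \<omega> \<in> Y" if "\<omega> \<in> X" for \<omega> using bij that by (auto simp: bij_betw_def)
  have vimage: "{\<omega> \<in> X. \<Phi> \<omega> \<in> B} \<in> sets ?B" if B: "B \<in> sets ?B" for B
  proof -
    have "Y \<inter> B \<in> sets (restrict_space ?B Y)" using B by (auto simp: sets_restrict_space)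
    from measurable_sets[OF \<Phi>m this] have "\<Phi> -` (Y \<inter> B) \<inter> X \<in> sets (restrict_space ?B X)"
      using subX by (simp add: space_restrict_space Int_absorb2)
    then have "\<Phi> -` (Y \<inter> B) \<inter> X \<in> sets ?B"
      using X subX by (subst (asm) sets_restrict_space_iff) (auto simp: Int_absorb2 Int_absorb1)
    moreover have "\<Phi> -` (Y \<inter> B) \<inter> X = {\<omega> \<in> X. \<Phi> \<omega> \<in> B}" using Phi_Y by auto
    ultimately show ?thesis by simp
  qed
  have image: "\<Phi> ` B \<in> sets ?B" if B: "B \<in> sets ?B" "B \<subseteq> X" for B
  proof -
    have "B \<in> sets (restrict_space ?B X)" using B by (auto simp: sets_restrict_space)
    from measurable_sets[OF im this] have "inv_into X \<Phi> -` B \<inter> Y \<in> sets (restrict_space ?B Y)"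
      using subY by (simp add: space_restrict_space Int_absorb2)
    then have "inv_into X \<Phi> -` B \<inter> Y \<in> sets ?B"
      using Y subY by (subst (asm) sets_restrict_space_iff) (auto simp: Int_absorb2 Int_absorb1)
    moreover have "inv_into X \<Phi> -` B \<inter> Y = \<Phi> ` B"
    proof (intro set_eqI iffI)
      fix y assume y: "y \<in> inv_into X \<Phi> -` B \<inter> Y"
      then have "\<Phi> (inv_into X \<Phi> y) = y" using bij by (intro f_inv_into_f) (auto simp: bij_betw_def)
      then show "y \<in> \<Phi> ` B" using y by (metis IntD1 imageI vimageD)
    next
      fix y assume "y \<in> \<Phi> ` B"
      then obtain x where "x \<in> B" "y = \<Phi> x" by blast
      then show "y \<in> inv_into X \<Phi> -` B \<inter> Y"
        using B(2) Phi_Y bij inv_into_f_f[of \<Phi> X x] by (auto simp: bij_betw_def)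
    qed
    ultimately show ?thesis by simp
  qed
  \<comment> \<open>The points with first edge \<open>e\<close> whose images have first edge
    \<open>e'\<close>.\<close>
  define cell where "cell e e' = {\<omega> \<in> X \<inter> wcyl [fst e, snd e]. \<Phi> \<omega> \<in> wcyl [fst e', snd e']}" for e e'
  have cell_sets: "cell e e' \<in> sets ?B" for e e'
  proof -
    have "cell e e' = wcyl [fst e, snd e] \<inter> {\<omega> \<in> X. \<Phi> \<omega> \<in> wcyl [fst e', snd e']}"
      by (auto simp: cell_def)
    also have "\<dots> \<in> sets ?B" by (intro sets.Int vimage) simp_all
    finally show ?thesis .
  qed
  \<comment> \<open>The measure of the cell can be computed from that of its shift with either
    Jacobian, since \<Phi> preserves measure and commutes with the shift; if the two ratios differ,
    it must be 0.\<close>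
  have cell_null: "cell e e' \<in> null_sets ?\<mu>"
    if e: "e \<in> edges" "e' \<in> edges" and ne: "ratio f (fst e) (snd e) \<noteq> ratio g (fst e') (snd e')" for e e'
  proof -
    let ?A = "cell e e'"
    have AX: "?A \<subseteq> X" "?A \<subseteq> wcyl [fst e, snd e]" "\<Phi> ` ?A \<subseteq> wcyl [fst e', snd e']"
      by (auto simp: cell_def)
    have ed: "(fst e, snd e) \<in> edges" "(fst e', snd e') \<in> edges" using e by simp_all
    note sh = F.measure_shift_image[OF ed(1) cell_sets AX(2)]
    note sh' = G.measure_shift_image[OF ed(2) image[OF cell_sets AX(1)] AX(3)]
    have sub: "shift ` ?A \<subseteq> X" using AX(1) sX by blast
    have "shift ` \<Phi> ` ?A = \<Phi> ` shift ` ?A"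
      unfolding image_image using AX(1) by (intro image_cong refl comm[symmetric]) auto
    then have "ratio f (fst e) (snd e) * measure ?\<mu> (shift ` ?A) = ratio g (fst e') (snd e') * measure ?\<mu> (shift ` ?A)"
      using sh(2) sh'(2) meas[OF cell_sets AX(1)] meas[OF sh(1) sub] by auto
    then have "measure ?\<mu> (shift ` ?A) = 0" using ne by simp
    then have "measure ?\<mu> ?A = 0" using sh(2) by simp
    then show ?thesis using cell_sets by (simp add: null_sets_def F.emeasure_eq_measure)
  qed
  define N where "N = (\<Union>(e, e')\<in>{(e, e') \<in> edges \<times> edges. ratio f (fst e) (snd e) \<noteq> ratio g (fst e') (snd e')}. cell e e')"
  have N: "N \<in> null_sets ?\<mu>"
    unfolding N_def
  proof (rule null_sets_UN')
    show "countable {(e, e') \<in> edges \<times> edges. ratio f (fst e) (snd e) \<noteq> ratio g (fst e') (snd e')}"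
      by (intro countable_finite finite_subset[OF _ finite_cartesian_product[OF finite_edges finite_edges]]) auto
  qed (use cell_null in auto)
  \<comment> \<open>Removes the points whose orbit ever meets \<open>N\<close>, so that the ratios
    agree at all positions and not only at the first.\<close>
  define N' where "N' = (\<Union>n. (shift ^^ n) -` N \<inter> SigmaA)"
  have N': "N' \<in> null_sets ?\<mu>"
    unfolding N'_def by (rule null_sets_UN') (use F.null_sets_shift_pow[OF N] in auto)
  define X0 where "X0 = X - N'"
  have edge_mem: "(\<omega> k, \<omega> (Suc k)) \<in> edges" if "\<omega> \<in> SigmaA" for \<omega> k
    using SigmaA_mem[OF that] SigmaA_neq[OF that] by (simp add: edges_def)
  have ratio_eq: "ratio g (\<Phi> \<omega> k) (\<Phi> \<omega> (Suc k)) = ratio f (\<omega> k) (\<omega> (Suc k))" if \<omega>: "\<omega> \<in> X0" for \<omega> k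
  proof (rule ccontr)
    let ?s = "(shift ^^ k) \<omega>"
    assume ne: "ratio g (\<Phi> \<omega> k) (\<Phi> \<omega> (Suc k)) \<noteq> ratio f (\<omega> k) (\<omega> (Suc k))"
    have \<omega>X: "\<omega> \<in> X" and nN: "\<omega> \<notin> N'" using \<omega> by (auto simp: X0_def)
    then have \<omega>S: "\<omega> \<in> SigmaA" "\<Phi> \<omega> \<in> SigmaA" using subX subY Phi_Y by auto
    have s: "?s \<in> X" "\<Phi> ?s = (shift ^^ k) (\<Phi> \<omega>)"
      using shift_pow_commute[of X \<Phi> \<omega> k, OF comm sX \<omega>X] by auto
    have "?s \<in> wcyl [\<omega> k, \<omega> (Suc k)]" "\<Phi> ?s \<in> wcyl [\<Phi> \<omega> k, \<Phi> \<omega> (Suc k)]"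
      unfolding s(2) using shift_pow_SigmaA[OF \<omega>S(1), of k] shift_pow_SigmaA[OF \<omega>S(2), of k]
      by (auto simp: wcyl_def shift_pow nth_Cons split: nat.split)
    then have "?s \<in> cell (\<omega> k, \<omega> (Suc k)) (\<Phi> \<omega> k, \<Phi> \<omega> (Suc k))" using s(1) by (simp add: cell_def)
    then have "?s \<in> N"
      unfolding N_def using edge_mem[OF \<omega>S(1), of k] edge_mem[OF \<omega>S(2), of k] ne by force
    then have "\<omega> \<in> N'" using \<omega>S by (auto simp: N'_def)
    with nN show False by simp
  qed
  have meas_X0: "measure ?\<mu> (B \<inter> X0) = measure ?\<mu> B" if B: "B \<in> sets ?B" for B
  proof -
    have "AE \<omega> in ?\<mu>. \<omega> \<in> X"
      using F.AE_in_set_eq_1[of X] X X1 by simp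
    moreover have "AE \<omega> in ?\<mu>. \<omega> \<notin> N'" by (rule AE_not_in[OF N'])
    ultimately have "AE \<omega> in ?\<mu>. \<omega> \<in> B \<inter> X0 \<longleftrightarrow> \<omega> \<in> B"
      by eventually_elim (auto simp: X0_def)
    then show ?thesis
      by (rule F.finite_measure_eq_AE) (use B X N' in \<open>auto simp: X0_def\<close>)
  qed
  have X0_sub: "X0 \<subseteq> X" by (auto simp: X0_def)
  have X0_meets: "\<exists>\<omega>\<in>X0. \<omega> \<in> wcyl w" if "0 < measure ?\<mu> (wcyl w)" for w
  proof (rule ccontr)
    assume "\<not> ?thesis"
    then have "wcyl w \<inter> X0 = {}" by auto
    then show False using meas_X0[of "wcyl w"] that by simp
  qed
  let ?q = "\<lambda>(i, j). ratio f i j" and ?q' = "\<lambda>(i, j). ratio g i j"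
  \<comment> \<open>Each cylinder of an edge has positive measure and so meets \<open>X0\<close>;
    thus every ratio of \<open>f\<close> occurs among those of \<open>g\<close>.\<close>
  have "\<forall>e\<in>edges. \<exists>e'. e' \<in> edges \<and> ?q' e' = ?q e"
  proof
    fix e assume e: "e \<in> edges"
    then obtain i j where ij: "e = (i, j)" "(i, j) \<in> edges" by (cases e) auto
    obtain \<omega> where \<omega>: "\<omega> \<in> X0" "\<omega> \<in> wcyl [i, j]" using X0_meets[OF F.measure_wcyl_pos(2)[OF ij(2)]] by blast
    have "\<omega> 0 = i" "\<omega> (Suc 0) = j" using \<omega>(2) by (simp_all add: mem_wcyl_Cons shift_def)
    then show "\<exists>e'. e' \<in> edges \<and> ?q' e' = ?q e"
      using ratio_eq[OF \<omega>(1), of 0] edge_mem[of "\<Phi> \<omega>" 0] Phi_Y[of \<omega>] \<omega>(1) X0_sub subY ij(1)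
      by (intro exI[of _ "(\<Phi> \<omega> 0, \<Phi> \<omega> (Suc 0))"]) auto
  qed
  then obtain \<psi> where \<psi>: "\<And>e. e \<in> edges \<Longrightarrow> \<psi> e \<in> edges \<and> ?q' (\<psi> e) = ?q e"
    unfolding bchoice_iff by blast
  have inj\<psi>: "inj_on \<psi> edges"
  proof (rule inj_onI)
    fix a b assume ab: "a \<in> edges" "b \<in> edges" "\<psi> a = \<psi> b"
    then have "?q a = ?q b" using \<psi>[OF ab(1)] \<psi>[OF ab(2)] by simp
    then show "a = b" using inj_onD[OF inj] ab by blast
  qed
  have surj\<psi>: "\<psi> ` edges = edges"
    by (rule endo_inj_surj[OF finite_edges _ inj\<psi>]) (use \<psi> in blast)
  \<comment> \<open>The ratios of \<open>g\<close> take at least six values on six edges, so they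
    are distinct too.\<close>
  have inj': "inj_on ?q' edges"
  proof (rule inj_onI)
    fix a b assume ab: "a \<in> edges" "b \<in> edges" "?q' a = ?q' b"
    have "a \<in> \<psi> ` edges" "b \<in> \<psi> ` edges" using ab unfolding surj\<psi> by blast+
    then obtain a' b' where ab': "a = \<psi> a'" "a' \<in> edges" "b = \<psi> b'" "b' \<in> edges"
      by (elim imageE)
    have "?q a' = ?q b'" using \<psi>[OF ab'(2)] \<psi>[OF ab'(4)] ab(3) unfolding ab'(1,3) by argo
    then have "a' = b'" by (rule inj_onD[OF inj _ ab'(2,4)])
    then show "a = b" unfolding ab'(1,3) by (rule arg_cong)
  qed
  have \<psi>_eq: "(\<Phi> \<omega> k, \<Phi> \<omega> (Suc k)) = \<psi> (\<omega> k, \<omega> (Suc k))" if \<omega>: "\<omega> \<in> X0" for \<omega> k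
  proof (rule inj_onD[OF inj'])
    have S: "\<omega> \<in> SigmaA" "\<Phi> \<omega> \<in> SigmaA" using \<omega> X0_sub subX subY Phi_Y by auto
    show "?q' (\<Phi> \<omega> k, \<Phi> \<omega> (Suc k)) = ?q' (\<psi> (\<omega> k, \<omega> (Suc k)))"
      using \<psi>[OF edge_mem[OF S(1), of k]] ratio_eq[OF \<omega>, of k] by simp
    show "(\<Phi> \<omega> k, \<Phi> \<omega> (Suc k)) \<in> edges" by (rule edge_mem[OF S(2)])
    show "\<psi> (\<omega> k, \<omega> (Suc k)) \<in> edges" using \<psi>[OF edge_mem[OF S(1), of k]] by blast
  qed
  \<comment> \<open>Some point of \<open>X0\<close> begins with \<open>i\<close>, \<open>j\<close>,
    \<open>k\<close>; the images of its first two edges are consecutive edges of one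
    sequence.\<close>
  have match: "snd (\<psi> (i, j)) = fst (\<psi> (j, k))" if e: "(i, j) \<in> edges" "(j, k) \<in> edges" for i j k
  proof -
    obtain \<omega> where \<omega>: "\<omega> \<in> X0" "\<omega> \<in> wcyl [i, j, k]" using X0_meets[OF F.measure_wcyl_pos(3)[OF e]] by blast
    have "\<omega> 0 = i" "\<omega> (Suc 0) = j" "\<omega> (Suc (Suc 0)) = k"
      using \<omega>(2) by (simp_all add: mem_wcyl_Cons shift_def)
    then show ?thesis using \<psi>_eq[OF \<omega>(1), of 0] \<psi>_eq[OF \<omega>(1), of "Suc 0"] by (metis fst_conv snd_conv)
  qed
  \<comment> \<open>The new name of \<open>j\<close> is read off from any edge leaving
    \<open>j\<close>; \<open>connector j j\<close> is just some other letter.\<close>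
  define \<tau> where "\<tau> j = fst (\<psi> (j, connector j j))" for j
  have con: "(j, connector j j) \<in> edges" "(connector j j, j) \<in> edges" if "j \<in> {1..3}" for j
    using that connector[of j j] by (auto simp: edges_def)
  have \<psi>_\<tau>: "\<psi> (i, j) = (\<tau> i, \<tau> j)" if ij: "(i, j) \<in> edges" for i j
  proof -
    have i: "i \<in> {1..3}" and j: "j \<in> {1..3}" using ij by (simp_all add: edges_def)
    have "fst (\<psi> (i, j)) = snd (\<psi> (connector i i, i))" using match[OF con(2)[OF i] ij] by simp
    also have "\<dots> = \<tau> i" unfolding \<tau>_def by (rule match[OF con(2)[OF i] con(1)[OF i]])
    finally have "fst (\<psi> (i, j)) = \<tau> i" .
    moreover have "snd (\<psi> (i, j)) = \<tau> j" unfolding \<tau>_def by (rule match[OF ij con(1)[OF j]])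
    ultimately show ?thesis by (metis prod.collapse)
  qed
  have \<tau>_edges: "(\<tau> i, \<tau> j) \<in> edges" if "(i, j) \<in> edges" for i j
    using \<psi>[OF that] \<psi>_\<tau>[OF that] by simp
  have \<tau>_mem: "\<tau> i \<in> {1..3}" if "i \<in> {1..3}" for i
    using \<tau>_edges[OF con(1)[OF that]] by (simp add: edges_def)
  have \<tau>_inj: "inj_on \<tau> {1..3}"
  proof (rule inj_onI, rule ccontr)
    fix i j assume ij: "i \<in> {1..3}" "j \<in> {1..3}" "\<tau> i = \<tau> j" "i \<noteq> j"
    then have "(\<tau> i, \<tau> j) \<in> edges" by (intro \<tau>_edges) (simp add: edges_def)
    then show False using ij(3) by (simp add: edges_def)
  qed
  have \<tau>: "bij_betw \<tau> {1..3} {1..3}"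
    unfolding bij_betw_def using \<tau>_inj endo_inj_surj[OF _ _ \<tau>_inj] \<tau>_mem by blast
  have \<Phi>_\<tau>: "\<Phi> \<omega> k = \<tau> (\<omega> k)" if \<omega>: "\<omega> \<in> X0" for \<omega> k
    using \<psi>_eq[OF \<omega>, of k] \<psi>_\<tau>[OF edge_mem[of \<omega> k]] \<omega> X0_sub subX by auto
  \<comment> \<open>The image of the part of the cylinder in \<open>X0\<close> is only known to lie
    inside the renamed cylinder, which gives an inequality.\<close>
  have le: "measure ?\<mu> (wcyl w) \<le> measure ?\<nu> (wcyl (map \<tau> w))" for w
  proof -
    have B: "wcyl w \<inter> X0 \<in> sets ?B" using X N' by (auto simp: X0_def)
    have "measure ?\<mu> (wcyl w) = measure ?\<mu> (wcyl w \<inter> X0)" using meas_X0[of "wcyl w"] by simp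
    also have "\<dots> = measure ?\<nu> (\<Phi> ` (wcyl w \<inter> X0))" using B X0_sub by (intro meas) auto
    also have "\<dots> \<le> measure ?\<nu> (wcyl (map \<tau> w))"
    proof (rule G.finite_measure_mono)
      show "\<Phi> ` (wcyl w \<inter> X0) \<subseteq> wcyl (map \<tau> w)"
      proof (rule image_subsetI)
        fix \<omega> assume \<omega>: "\<omega> \<in> wcyl w \<inter> X0"
        then have "\<Phi> \<omega> \<in> SigmaA" using X0_sub Phi_Y subY by auto
        then show "\<Phi> \<omega> \<in> wcyl (map \<tau> w)" using \<omega> \<Phi>_\<tau> by (simp add: wcyl_def)
      qed
    qed simp
    finally show ?thesis .
  qed
  have inj_words: "inj_on (map \<tau>) (words n)" for n
  proof (rule inj_onI)
    fix v w assume vw: "v \<in> words n" "w \<in> words n" "map \<tau> v = map \<tau> w"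
    have "inj_on \<tau> (set v \<union> set w)"
      by (rule inj_on_subset[OF \<tau>_inj]) (use vw in \<open>auto simp: words_def\<close>)
    with vw(3) show "v = w" by (rule map_inj_on)
  qed
  have "map \<tau> ` words n \<subseteq> words n" for n
    using \<tau>_mem by (force simp: words_def)
  from endo_inj_surj[OF finite_words this inj_words]
  have map_words: "map \<tau> ` words n = words n" for n .
  \<comment> \<open>Both sides of the inequality sum to 1 over the words of length \<open>n\<close>,
    so it is an equality for each word.\<close>
  have eq: "measure ?\<nu> (wcyl (map \<tau> w)) = measure ?\<mu> (wcyl w)" if w: "w \<in> words n" for n w
  proof -
    have "(\<Sum>w\<in>words n. measure ?\<mu> (wcyl w)) = (\<Sum>w\<in>words n. measure ?\<nu> (wcyl (map \<tau> w)))"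
      using sum.reindex[OF inj_words[of n], of "\<lambda>w. measure ?\<nu> (wcyl w)"]
        sum_measure_wcyl[OF F.prob_\<mu> F.sets_\<mu>, of n] sum_measure_wcyl[OF G.prob_\<mu> G.sets_\<mu>, of n]
      by (simp add: map_words)
    from sum_mono_inv[OF this le w finite_words] show ?thesis by simp
  qed
  show thesis by (rule that[OF \<tau> eq])
qed

section \<open>Entropy spectra under renaming of the letters\<close>

lemma entropy_spectrum_permute_le:
  assumes \<tau>: "bij_betw \<tau> {1..3} {1..3}"
    and eq: "\<And>n w. w \<in> words n \<Longrightarrow> measure \<nu> (wcyl (map \<tau> w)) = measure \<mu> (wcyl w)"
  shows "entropy_spectrum SigmaA \<mu> \<alpha> \<le> entropy_spectrum SigmaA \<nu> \<alpha>"
  unfolding entropy_spectrum_def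
proof (rule bowen_entropy_le[where \<Psi> = "\<lambda>\<omega>. \<tau> \<circ> \<omega>" and r = "\<lambda>n. n"])
  have inj: "inj_on \<tau> {1..3}" using \<tau> by (simp add: bij_betw_def)
  show "(\<lambda>\<omega>. \<tau> \<circ> \<omega>) ` level_set SigmaA \<mu> \<alpha> \<subseteq> level_set SigmaA \<nu> \<alpha>"
  proof (rule image_subsetI)
    fix \<omega> assume \<omega>: "\<omega> \<in> level_set SigmaA \<mu> \<alpha>"
    then have S: "\<omega> \<in> SigmaA" by (simp add: level_set_def)
    have "\<tau> (\<omega> n) \<in> {1..3} \<and> \<tau> (\<omega> n) \<noteq> \<tau> (\<omega> (Suc n))" for n
      using SigmaA_mem[OF S] SigmaA_neq[OF S] inj_onD[OF inj] bij_betwE[OF \<tau>] by metis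
    then have S': "\<tau> \<circ> \<omega> \<in> SigmaA" unfolding SigmaA_iff by simp
    have "measure \<nu> (cylinder SigmaA n (\<tau> \<circ> \<omega>)) = measure \<mu> (cylinder SigmaA n \<omega>)" for n
      using eq[OF prefix_in_words[OF S], of n] by (simp add: cylinder_eq_wcyl comp_def)
    then show "\<tau> \<circ> \<omega> \<in> level_set SigmaA \<nu> \<alpha>" using \<omega> S' by (simp add: level_set_def)
  qed
  show "\<forall>k<n. \<omega> k = \<omega>' k"
    if "\<omega> \<in> level_set SigmaA \<mu> \<alpha>" "\<omega>' \<in> level_set SigmaA \<mu> \<alpha>" "\<forall>k<n. (\<tau> \<circ> \<omega>) k = (\<tau> \<circ> \<omega>') k" for \<omega> \<omega>' n
  proof -
    have "\<omega> \<in> SigmaA" "\<omega>' \<in> SigmaA" using that by (simp_all add: level_set_def)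
    then show ?thesis using that(3) inj_onD[OF inj] SigmaA_mem by (simp del: atLeastAtMost_iff)
  qed
  \<comment> \<open>The quotient is 0 for \<open>n = 0\<close>, so it equals 1 only from 1
    on.\<close>
  have "(\<lambda>n. real n / real n) \<longlonglongrightarrow> 1 \<longleftrightarrow> (\<lambda>n. 1 :: real) \<longlonglongrightarrow> 1"
    by (rule filterlim_cong) (auto intro: eventually_mono[OF eventually_gt_at_top[of 0]])
  then show "(\<lambda>n. real n / real n) \<longlonglongrightarrow> 1" by simp
qed (auto simp: level_set_def)

lemma entropy_spectrum_permute:
  assumes \<tau>: "bij_betw \<tau> {1..3} {1..3}"
    and eq: "\<And>n w. w \<in> words n \<Longrightarrow> measure \<nu> (wcyl (map \<tau> w)) = measure \<mu> (wcyl w)"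
  shows "entropy_spectrum SigmaA \<mu> = entropy_spectrum SigmaA \<nu>"
proof
  let ?\<sigma> = "inv_into {1..3} \<tau>"
  have \<sigma>: "bij_betw ?\<sigma> {1..3} {1..3}" by (rule bij_betw_inv_into[OF \<tau>])
  have "measure \<mu> (wcyl (map ?\<sigma> w)) = measure \<nu> (wcyl w)" if w: "w \<in> words n" for n w
  proof -
    have "map ?\<sigma> w \<in> words n" using w bij_betwE[OF \<sigma>] by (force simp: words_def)
    moreover have "map \<tau> (map ?\<sigma> w) = w"
      unfolding map_map using w bij_betw_inv_into_right[OF \<tau>] by (intro map_idI) (auto simp: words_def)
    ultimately show ?thesis using eq by metis
  qed
  then show "entropy_spectrum SigmaA \<mu> \<alpha> = entropy_spectrum SigmaA \<nu> \<alpha>" for \<alpha>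
    using entropy_spectrum_permute_le[OF \<tau>, of \<nu> \<mu> \<alpha>] eq
      entropy_spectrum_permute_le[OF \<sigma>, of \<mu> \<nu> \<alpha>]
    by (intro order_antisym) auto
qed

subsection \<open>Generic potentials\<close>

text \<open>The cycles of length 2 and 3 are tested on the ratios, where their products are those of
  the weight matrix up to a power of the eigenvalue. The ratios, unlike the Perron data, can be
  prescribed directly when density is proved.\<close>

definition generic :: "(nat \<Rightarrow> nat \<Rightarrow> real) \<Rightarrow> bool" where
  "generic q \<longleftrightarrow> inj_on (\<lambda>(i, j). q i j) edges
    \<and> q 1 2 * q 2 1 \<noteq> q 1 3 * q 3 1 \<and> q 1 2 * q 2 1 \<noteq> q 2 3 * q 3 2 \<and> q 1 3 * q 3 1 \<noteq> q 2 3 * q 3 2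
    \<and> q 1 2 * q 2 3 * q 3 1 \<noteq> q 1 3 * q 3 2 * q 2 1"

context perron_potential
begin

text \<open>Around a cycle the eigenvector factors cancel.\<close>

lemma ratio_cycle_2:
  assumes "i \<in> {1..3}" "j \<in> {1..3}"
  shows "ratio f i j * ratio f j i = m i j * m j i / lam\<^sup>2"
  using l_pos[OF assms(1)] l_pos[OF assms(2)] lam_pos
  unfolding ratio_eq[OF assms] ratio_eq[OF assms(2,1)] by (simp add: power2_eq_square)

lemma ratio_cycle_3:
  assumes "i \<in> {1..3}" "j \<in> {1..3}" "k \<in> {1..3}"
  shows "ratio f i j * ratio f j k * ratio f k i = m i j * m j k * m k i / lam ^ 3"
  using l_pos[OF assms(1)] l_pos[OF assms(2)] l_pos[OF assms(3)] lam_pos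
  unfolding ratio_eq[OF assms(1,2)] ratio_eq[OF assms(2,3)] ratio_eq[OF assms(3,1)]
  by (simp add: power3_eq_cube)

lemma sum_ratio:
  assumes "j \<in> {1..3}"
  shows "(\<Sum>i=1..3. ratio f i j) = 1"
proof -
  have "(\<Sum>i=1..3. ratio f i j) = (\<Sum>i=1..3. l i * m i j) / (lam * l j)"
    unfolding sum_divide_distrib by (intro sum.cong refl ratio_eq assms)
  then show ?thesis using left[OF assms] lam_pos l_pos[OF assms] by simp
qed

end

text \<open>Both the permutation \<tau> given by rigidity and the reversal preserve the products
  over cycles of length 2. As these three are distinct, \<tau> fixes every pair of letters, hence
  every letter, and the ratios of \<open>f\<close> and its reversal coincide. But reversal exchanges
  the products over the two cycles of length 3, which would make them equal.\<close>

lemma not_isomorphic_reverse: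
  assumes f: "f \<in> L2" and generic: "generic (ratio f)"
  shows "\<not> shift_isomorphic SigmaA (gibbs_measure SigmaA f) (gibbs_measure SigmaA (reverse f))"
proof
  assume iso: "shift_isomorphic SigmaA (gibbs_measure SigmaA f) (gibbs_measure SigmaA (reverse f))"
  obtain l h where p: "perron_potential f (root_of f) l h"
    using perron_potential_exists[OF f] by blast
  interpret F: perron_potential f "root_of f" l h by (rule p)
  interpret R: perron_potential "reverse f" "root_of f" h l by (rule perron_potential_reverse[OF p])
  have "inj_on (\<lambda>(i, j). ratio f i j) edges" using generic by (simp add: generic_def)
  then obtain \<tau> where \<tau>: "bij_betw \<tau> {1..3} {1..3}"
    and eq: "\<And>n w. w \<in> words n \<Longrightarrow>
      measure (gibbs_measure SigmaA (reverse f)) (wcyl (map \<tau> w)) = measure (gibbs_measure SigmaA f) (wcyl w)"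
    using isomorphism_rigid[OF f reverse_L2 iso] by blast
  have ratio: "ratio (reverse f) (\<tau> i) (\<tau> j) = ratio f i j" if "i \<in> {1..3}" "j \<in> {1..3}" for i j
    using eq[of "[i, j]" 2] eq[of "[j]" 1] that by (simp add: ratio_def words_def)
  have \<tau>_mem: "\<tau> i \<in> {1..3}" if "i \<in> {1..3}" for i using bij_betwE[OF \<tau>] that by blast
  define x where "x i j = ratio f i j * ratio f j i" for i j
  have x_sym: "x i j = x j i" for i j by (simp add: x_def)
  have x_rev: "ratio (reverse f) i j * ratio (reverse f) j i = x i j" if "i \<in> {1..3}" "j \<in> {1..3}" for i j
    unfolding x_def F.ratio_cycle_2[OF that] R.ratio_cycle_2[OF that] by (simp add: weight_matrix_reverse)
  have x_\<tau>: "x (\<tau> i) (\<tau> j) = x i j" if "i \<in> {1..3}" "j \<in> {1..3}" for i j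
    using x_rev[OF \<tau>_mem[OF that(1)] \<tau>_mem[OF that(2)]] ratio[OF that] ratio[OF that(2,1)]
    by (simp add: x_def)
  have ne: "x 1 2 \<noteq> x 1 3" "x 1 2 \<noteq> x 2 3" "x 1 3 \<noteq> x 2 3"
    using generic by (simp_all add: generic_def x_def)
  have "\<tau> 1 = 1 \<and> \<tau> 2 = 2 \<and> \<tau> 3 = 3"
  proof -
    have dist: "\<tau> 1 \<noteq> \<tau> 2" "\<tau> 1 \<noteq> \<tau> 3" "\<tau> 2 \<noteq> \<tau> 3"
      using \<tau> by (auto simp: bij_betw_def dest!: inj_onD)
    have e: "x (\<tau> 1) (\<tau> 2) = x 1 2" "x (\<tau> 1) (\<tau> 3) = x 1 3" "x (\<tau> 2) (\<tau> 3) = x 2 3"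
      by (intro x_\<tau>; simp)+
    have s: "x 2 1 = x 1 2" "x 3 1 = x 1 3" "x 3 2 = x 2 3" by (rule x_sym)+
    have m: "\<tau> 1 = 1 \<or> \<tau> 1 = 2 \<or> \<tau> 1 = 3" "\<tau> 2 = 1 \<or> \<tau> 2 = 2 \<or> \<tau> 2 = 3" "\<tau> 3 = 1 \<or> \<tau> 3 = 2 \<or> \<tau> 3 = 3"
      using \<tau>_mem[of 1] \<tau>_mem[of 2] \<tau>_mem[of 3] unfolding alphabet by simp_all
    then show ?thesis
      using dist e ne s by (elim disjE) simp_all
  qed
  then have "ratio (reverse f) i j = ratio f i j" if "i \<in> {1..3}" "j \<in> {1..3}" for i j
    using ratio[OF that] that unfolding alphabet by (elim disjE) simp_all
  then have "ratio f 1 2 * ratio f 2 3 * ratio f 3 1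
      = ratio (reverse f) 1 2 * ratio (reverse f) 2 3 * ratio (reverse f) 3 1" by simp
  also have "\<dots> = ratio f 1 3 * ratio f 3 2 * ratio f 2 1"
    using R.ratio_cycle_3[of 1 2 3] F.ratio_cycle_3[of 1 3 2] by (simp add: weight_matrix_reverse)
  finally show False using generic by (simp add: generic_def)
qed

lemma isomorphism_class_psubset:
  assumes f: "f \<in> L2" and generic: "generic (ratio f)"
  shows "isomorphism_class SigmaA L2 f \<subset> spectrum_class SigmaA L2 f"
proof
  show "isomorphism_class SigmaA L2 f \<subseteq> spectrum_class SigmaA L2 f"
  proof
    fix g assume "g \<in> isomorphism_class SigmaA L2 f"
    then have g: "g \<in> L2" and iso: "shift_isomorphic SigmaA (gibbs_measure SigmaA f) (gibbs_measure SigmaA g)"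
      unfolding isomorphism_class_def by blast+
    have "inj_on (\<lambda>(i, j). ratio f i j) edges" using generic by (simp add: generic_def)
    then obtain \<tau> where "bij_betw \<tau> {1..3} {1..3}"
      "\<And>n w. w \<in> words n \<Longrightarrow>
        measure (gibbs_measure SigmaA g) (wcyl (map \<tau> w)) = measure (gibbs_measure SigmaA f) (wcyl w)"
      using isomorphism_rigid[OF f g iso] by blast
    then have "entropy_spectrum SigmaA (gibbs_measure SigmaA f) = entropy_spectrum SigmaA (gibbs_measure SigmaA g)"
      by (rule entropy_spectrum_permute)
    with g show "g \<in> spectrum_class SigmaA L2 f" unfolding spectrum_class_def by blast
  qed
  have "reverse f \<in> spectrum_class SigmaA L2 f"
    unfolding spectrum_class_def using reverse_L2 entropy_spectrum_reverse[OF f] by simp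
  moreover have "reverse f \<notin> isomorphism_class SigmaA L2 f"
    using not_isomorphic_reverse[OF f generic] unfolding isomorphism_class_def by blast
  ultimately show "isomorphism_class SigmaA L2 f \<noteq> spectrum_class SigmaA L2 f" by blast
qed

subsection \<open>Openness\<close>

interpretation L2: Metric_space L2 "sup_dist SigmaA"
  by (rule Metric_space_locally_const)

lemma L2_diff_le:
  assumes "f \<in> L2" "g \<in> L2" "\<omega> \<in> SigmaA"
  shows "\<bar>f \<omega> - g \<omega>\<bar> \<le> sup_dist SigmaA f g"
proof -
  have "(\<lambda>x. \<bar>f x - g x\<bar>) ` SigmaA \<subseteq> (\<lambda>(a, b). \<bar>a - b\<bar>) ` (f ` SigmaA \<times> g ` SigmaA)"
    by auto
  moreover have "finite ((\<lambda>(a, b). \<bar>a - b\<bar>) ` (f ` SigmaA \<times> g ` SigmaA))"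
    using assms finite_range_locally_const by blast
  ultimately have "bdd_above ((\<lambda>x. \<bar>f x - g x\<bar>) ` SigmaA)"
    by (rule bdd_above_finite[OF finite_subset])
  moreover have "SigmaA \<noteq> {}" using assms(3) by blast
  ultimately show ?thesis
    unfolding sup_dist_def using cSUP_upper[OF assms(3)] by simp
qed

lemma sup_dist_le:
  assumes "\<And>\<omega>. \<omega> \<in> SigmaA \<Longrightarrow> \<bar>f \<omega> - g \<omega>\<bar> \<le> e" "0 \<le> e"
  shows "sup_dist SigmaA f g \<le> e"
  unfolding sup_dist_def using assms by (auto intro: cSUP_least)

lemma edge_diff_le:
  assumes "f \<in> L2" "g \<in> L2" "(i, j) \<in> edges"
  shows "\<bar>edge f i j - edge g i j\<bar> \<le> sup_dist SigmaA f g"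
  unfolding edge_def by (rule L2_diff_le[OF assms(1,2)], rule alternating_SigmaA) (use assms(3) in \<open>auto simp: edges_def\<close>)

lemma root_of_pos: "0 < root_of f"
  using char_root_of[of f] by (simp add: char_root_def)

text \<open>Changing the potential by at most \<open>sup_dist SigmaA f g\<close> changes each matrix
  entry by at most the exponential of that as a factor, and \<open>perron_root_le\<close> carries
  this over to the eigenvalue.\<close>

lemma ln_root_diff_le:
  assumes f: "f \<in> L2" and g: "g \<in> L2"
  shows "\<bar>ln (root_of f) - ln (root_of g)\<bar> \<le> sup_dist SigmaA f g"
proof -
  have le: "ln (root_of f) \<le> sup_dist SigmaA f g + ln (root_of g)" if f: "f \<in> L2" and g: "g \<in> L2" for f g
  proof -
    obtain l h where F: "perron_potential f (root_of f) l h" using perron_potential_exists[OF f] by blast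
    obtain l' h' where G: "perron_potential g (root_of g) l' h'" using perron_potential_exists[OF g] by blast
    have "weight_matrix f i j \<le> exp (sup_dist SigmaA f g) * weight_matrix g i j" for i j
    proof (cases "(i, j) \<in> edges")
      case True
      have "edge f i j \<le> sup_dist SigmaA f g + edge g i j" using edge_diff_le[OF f g True] by linarith
      then show ?thesis using True by (simp add: weight_matrix_def edges_def exp_add[symmetric])
    next
      case False
      then have "weight_matrix f i j = 0" "weight_matrix g i j = 0" by (auto simp: weight_matrix_def edges_def)
      then show ?thesis by simp
    qed
    then have "root_of f \<le> exp (sup_dist SigmaA f g) * root_of g"
      by (rule perron_root_le[OF perron_potential.axioms(1)[OF G] perron_potential.axioms(1)[OF F]])
    then have "ln (root_of f) \<le> ln (exp (sup_dist SigmaA f g) * root_of g)"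
      using root_of_pos[of f] root_of_pos[of g] by (subst ln_le_cancel_iff) auto
    then show ?thesis using root_of_pos[of g] by (simp add: ln_mult_pos)
  qed
  show ?thesis using le[OF f g] le[OF g f] L2.commute[of f g] by linarith
qed

lemma eventually_nhdsin_L2:
  assumes "f \<in> L2" "0 < d" "\<And>g. g \<in> L2 \<Longrightarrow> sup_dist SigmaA f g < d \<Longrightarrow> P g"
  shows "eventually P (nhdsin L2_topology f)"
proof -
  have "openin L2_topology (L2.mball f d)" "f \<in> L2.mball f d" "\<forall>g\<in>L2.mball f d. P g"
    using assms by (auto simp: L2_topology_def)
  then show ?thesis unfolding eventually_nhdsin using openin_subset by blast
qed

lemma tendsto_nhdsin_L2:
  fixes G :: "_ \<Rightarrow> real"
  assumes "f \<in> L2" "\<And>g. g \<in> L2 \<Longrightarrow> \<bar>G f - G g\<bar> \<le> sup_dist SigmaA f g"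
  shows "(G \<longlongrightarrow> G f) (nhdsin L2_topology f)"
proof (rule tendstoI)
  fix e :: real assume "0 < e"
  then show "\<forall>\<^sub>F g in nhdsin L2_topology f. dist (G g) (G f) < e"
    by (intro eventually_nhdsin_L2[OF assms(1)]) (use assms(2) in \<open>fastforce simp: dist_real_def abs_minus_commute\<close>)+
qed

text \<open>The normalisation of the eigenvector cancels in the ratio, which leaves a rational
  expression in the matrix entries and the eigenvalue.\<close>

lemma tendsto_ratio:
  assumes f: "f \<in> L2" and ij: "i \<in> {1..3}" "j \<in> {1..3}"
  shows "((\<lambda>g. ratio g i j) \<longlongrightarrow> ratio f i j) (nhdsin L2_topology f)"
proof -
  let ?F = "nhdsin L2_topology f"
  have "((\<lambda>g. exp (ln (root_of g))) \<longlongrightarrow> exp (ln (root_of f))) ?F"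
    by (intro tendsto_exp tendsto_nhdsin_L2 f ln_root_diff_le)
  then have root: "(root_of \<longlongrightarrow> root_of f) ?F" by (simp add: root_of_pos)
  have W: "((\<lambda>g. weight_matrix g i j) \<longlongrightarrow> weight_matrix f i j) ?F" for i j
  proof (cases "(i, j) \<in> edges")
    case True
    have "((\<lambda>g. exp (edge g i j)) \<longlongrightarrow> exp (edge f i j)) ?F"
      by (intro tendsto_exp tendsto_nhdsin_L2[where G = "\<lambda>g. edge g i j"] f edge_diff_le True)
    then show ?thesis using True by (simp add: weight_matrix_def edges_def)
  next
    case False
    then have "weight_matrix g i j = 0" for g by (auto simp: weight_matrix_def edges_def)
    then show ?thesis by simp
  qed
  have adj: "((\<lambda>g. adj (weight_matrix g) (root_of g) i) \<longlongrightarrow> adj (weight_matrix f) (root_of f) i) ?F" for i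
    unfolding adj_def by (cases "i = 1"; cases "i = 2") (auto intro!: tendsto_intros W root)
  have adj_pos: "0 < adj (weight_matrix g) (root_of g) j" for g
    by (rule positive_matrix.adj_pos[OF positive_matrix_weight char_root_of ij(2)])
  let ?r = "\<lambda>g. adj (weight_matrix g) (root_of g) i * weight_matrix g i j / (root_of g * adj (weight_matrix g) (root_of g) j)"
  have r: "ratio g i j = ?r g" if g: "g \<in> L2" for g
  proof -
    obtain l h where p: "perron_potential g (root_of g) l h"
      and "\<exists>s>0. \<forall>i. l i = adj (weight_matrix g) (root_of g) i / s"
      using perron_potential_exists[OF g] by blast
    then obtain s where "0 < s" "\<And>i. l i = adj (weight_matrix g) (root_of g) i / s" by blast
    then show ?thesis using perron_potential.ratio_eq[OF p ij] by simp
  qed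
  have "(?r \<longlongrightarrow> ?r f) ?F"
    by (intro tendsto_intros W root adj) (use adj_pos[of f] root_of_pos[of f] in simp)
  moreover have "\<forall>\<^sub>F g in ?F. ?r g = ratio g i j"
    by (rule eventually_nhdsin_L2[OF f zero_less_one]) (simp add: r)
  ultimately show ?thesis unfolding r[OF f] by (rule Lim_transform_eventually)
qed

lemma eventually_neq:
  fixes u v :: "_ \<Rightarrow> real"
  assumes "(u \<longlongrightarrow> a) F" "(v \<longlongrightarrow> b) F" "a \<noteq> b"
  shows "\<forall>\<^sub>F x in F. u x \<noteq> v x"
  using tendsto_imp_eventually_ne[OF tendsto_diff[OF assms(1,2)], of 0] assms(3) by simp

lemma openin_generic: "openin L2_topology {f \<in> L2. generic (ratio f)}"
proof (subst openin_subopen, intro ballI)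
  fix f assume "f \<in> {f \<in> L2. generic (ratio f)}"
  then have f: "f \<in> L2" and gen: "generic (ratio f)" by auto
  let ?F = "nhdsin L2_topology f"
  have t: "((\<lambda>g. ratio g i j) \<longlongrightarrow> ratio f i j) ?F" if "(i, j) \<in> edges" for i j
    using that by (intro tendsto_ratio f) (simp_all add: edges_def)
  have "\<forall>\<^sub>F g in ?F. \<forall>p\<in>{(a, b) \<in> edges \<times> edges. a \<noteq> b}.
      ratio g (fst (fst p)) (snd (fst p)) \<noteq> ratio g (fst (snd p)) (snd (snd p))"
  proof (rule eventually_ball_finite)
    show "finite {(a, b) \<in> edges \<times> edges. a \<noteq> b}"
      by (rule finite_subset[OF _ finite_cartesian_product[OF finite_edges finite_edges]]) auto
    show "\<forall>p\<in>{(a, b) \<in> edges \<times> edges. a \<noteq> b}. \<forall>\<^sub>F g in ?F.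
        ratio g (fst (fst p)) (snd (fst p)) \<noteq> ratio g (fst (snd p)) (snd (snd p))"
    proof
      fix p assume "p \<in> {(a, b) \<in> edges \<times> edges. a \<noteq> b}"
      then obtain a b where p: "p = (a, b)" "a \<in> edges" "b \<in> edges" "a \<noteq> b" by blast
      have "ratio f (fst a) (snd a) \<noteq> ratio f (fst b) (snd b)"
        using gen p inj_onD[of "\<lambda>(i, j). ratio f i j" edges a b] by (auto simp: generic_def split_beta)
      then show "\<forall>\<^sub>F g in ?F. ratio g (fst (fst p)) (snd (fst p)) \<noteq> ratio g (fst (snd p)) (snd (snd p))"
        unfolding p(1) fst_conv snd_conv
        using p(2,3) by (intro eventually_neq[OF t t]) simp_all
    qed
  qed
  note distinct = this
  have e: "(1, 2) \<in> edges" "(2, 1) \<in> edges" "(1, 3) \<in> edges" "(3, 1) \<in> edges" "(2, 3) \<in> edges" "(3, 2) \<in> edges"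
    by (simp_all add: edges_def)
  note t' = e[THEN t]
  have "\<forall>\<^sub>F g in ?F. ratio g 1 2 * ratio g 2 1 \<noteq> ratio g 1 3 * ratio g 3 1"
    by (rule eventually_neq[OF tendsto_mult[OF t'(1,2)] tendsto_mult[OF t'(3,4)]])
      (use gen in \<open>simp add: generic_def\<close>)
  moreover have "\<forall>\<^sub>F g in ?F. ratio g 1 2 * ratio g 2 1 \<noteq> ratio g 2 3 * ratio g 3 2"
    by (rule eventually_neq[OF tendsto_mult[OF t'(1,2)] tendsto_mult[OF t'(5,6)]])
      (use gen in \<open>simp add: generic_def\<close>)
  moreover have "\<forall>\<^sub>F g in ?F. ratio g 1 3 * ratio g 3 1 \<noteq> ratio g 2 3 * ratio g 3 2"
    by (rule eventually_neq[OF tendsto_mult[OF t'(3,4)] tendsto_mult[OF t'(5,6)]])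
      (use gen in \<open>simp add: generic_def\<close>)
  moreover have "\<forall>\<^sub>F g in ?F. ratio g 1 2 * ratio g 2 3 * ratio g 3 1 \<noteq> ratio g 1 3 * ratio g 3 2 * ratio g 2 1"
    by (rule eventually_neq[OF tendsto_mult[OF tendsto_mult[OF t'(1,5)] t'(4)]
          tendsto_mult[OF tendsto_mult[OF t'(3,6)] t'(2)]])
      (use gen in \<open>simp add: generic_def\<close>)
  moreover have "\<forall>\<^sub>F g in ?F. g \<in> L2"
    by (rule eventually_nhdsin_L2[OF f zero_less_one])
  moreover note distinct
  ultimately have "\<forall>\<^sub>F g in ?F. g \<in> {f \<in> L2. generic (ratio f)}"
  proof eventually_elim
    case (elim g)
    have "inj_on (\<lambda>(i, j). ratio g i j) edges"
    proof (rule inj_onI, rule ccontr)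
      fix a b assume ab: "a \<in> edges" "b \<in> edges" "a \<noteq> b"
        and eq: "(case a of (i, j) \<Rightarrow> ratio g i j) = (case b of (i, j) \<Rightarrow> ratio g i j)"
      then have "(a, b) \<in> {(a, b) \<in> edges \<times> edges. a \<noteq> b}" by blast
      from bspec[OF elim(6) this] show False using eq by (simp add: split_beta)
    qed
    then show ?case using elim by (simp add: generic_def)
  qed
  moreover have "f \<in> topspace L2_topology" using f by (simp add: L2_topology_def)
  ultimately show "\<exists>T. openin L2_topology T \<and> f \<in> T \<and> T \<subseteq> {f \<in> L2. generic (ratio f)}"
    unfolding eventually_nhdsin by blast
qed

subsection \<open>Density\<close>

text \<open>A positive left eigenvector determines the ratios on its own: pairing it with the right
  eigenvector of the Perron data forces \<open>lam = root_of f\<close>, and rescaling makes the two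
  a normalised pair.\<close>

lemma ratio_eqI:
  assumes f: "f \<in> L2" and lam: "0 < lam" and l: "\<And>i. i \<in> {1..3} \<Longrightarrow> 0 < l i"
    and left: "\<And>j. j \<in> {1..3} \<Longrightarrow> (\<Sum>i=1..3. l i * weight_matrix f i j) = lam * l j"
    and ij: "i \<in> {1..3}" "j \<in> {1..3}"
  shows "ratio f i j = l i * weight_matrix f i j / (lam * l j)"
proof -
  obtain l' h where "perron_potential f (root_of f) l' h"
    using perron_potential_exists[OF f] by blast
  then interpret F: perron_potential f "root_of f" l' h .
  define s where "s = (\<Sum>i=1..3. l i * h i)"
  have s: "0 < s" unfolding s_def using l F.h_pos by (intro sum_pos) auto
  have "lam * s = (\<Sum>j=1..3. (\<Sum>i=1..3. l i * weight_matrix f i j) * h j)"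
    unfolding s_def sum_distrib_left by (intro sum.cong refl) (simp only: left mult.assoc)
  also have "\<dots> = (\<Sum>i=1..3. l i * (\<Sum>j=1..3. weight_matrix f i j * h j))"
    unfolding sum_1_to_3 by (simp add: algebra_simps)
  also have "\<dots> = (\<Sum>i=1..3. l i * (root_of f * h i))"
    by (intro sum.cong refl) (simp only: F.right)
  also have "\<dots> = root_of f * s"
    unfolding s_def sum_1_to_3 by (simp add: algebra_simps)
  finally have eq: "lam = root_of f" using s by simp
  have pp: "perron_potential f lam (\<lambda>i. l i / s) h"
  proof
    show "(\<Sum>i=1..3. l i / s * weight_matrix f i j) = lam * (l j / s)" if "j \<in> {1..3}" for j
      using left[OF that] by (simp add: sum_divide_distrib[symmetric])
    show "(\<Sum>i=1..3. l i / s * h i) = 1"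
      unfolding times_divide_eq_left sum_divide_distrib[symmetric] s_def[symmetric] using s by simp
    show "(\<Sum>j=1..3. weight_matrix f i j * h j) = lam * h i" if "i \<in> {1..3}" for i
      unfolding eq by (rule F.right[OF that])
    show "0 < l i / s" if "i \<in> {1..3}" for i using l[OF that] s by simp
  qed (fact F.m_pos F.m_diag F.h_pos lam f)+
  show ?thesis using perron_potential.ratio_eq[OF pp ij] s by simp
qed

text \<open>The ratios of a potential are changed to prescribed ones without changing the eigenvalue and
  the left eigenvector.\<close>

lemma ratio_prescribed:
  assumes f: "f \<in> L2" and Q_pos: "\<And>i j. (i, j) \<in> edges \<Longrightarrow> 0 < Q i j" and Q_diag: "\<And>i. Q i i = 0"
    and Q_sum: "\<And>j. j \<in> {1..3} \<Longrightarrow> (\<Sum>i=1..3. Q i j) = 1"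
    and close: "\<And>i j. (i, j) \<in> edges \<Longrightarrow> \<bar>ln (Q i j) - ln (ratio f i j)\<bar> \<le> e" and e: "0 \<le> e"
  obtains g where "g \<in> L2" "sup_dist SigmaA f g \<le> e"
    "\<And>i j. i \<in> {1..3} \<Longrightarrow> j \<in> {1..3} \<Longrightarrow> ratio g i j = Q i j"
proof -
  obtain l h where "perron_potential f (root_of f) l h"
    using perron_potential_exists[OF f] by blast
  then interpret F: perron_potential f "root_of f" l h .
  \<comment> \<open>Each weight is multiplied by \<open>Q i j / ratio f i j\<close>, so that
    \<open>l i\<close> times the new weight is \<open>root_of f * l j * Q i j\<close>. Since the
    columns of \<open>Q\<close> sum to one, \<open>l\<close> remains a left eigenvector for the same
    eigenvalue.\<close>
  define g where "g = (\<lambda>\<omega>\<in>SigmaA. f \<omega> + (ln (Q (\<omega> 0) (\<omega> 1)) - ln (ratio f (\<omega> 0) (\<omega> 1))))"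
  have "g \<omega> = g \<omega>'" if "\<omega> \<in> SigmaA" "\<omega>' \<in> SigmaA" "\<forall>k<2. \<omega> k = \<omega>' k" for \<omega> \<omega>'
    using that L2_agree[OF f that(1,2)] by (simp add: g_def)
  moreover have "g \<in> SigmaA \<rightarrow>\<^sub>E UNIV" by (simp add: g_def)
  ultimately have g: "g \<in> L2" unfolding locally_const_def by blast
  have edge: "edge g i j = edge f i j + (ln (Q i j) - ln (ratio f i j))" if ij: "(i, j) \<in> edges" for i j
  proof -
    have "(\<lambda>n. if even n then i else j) \<in> SigmaA"
      by (rule alternating_SigmaA) (use ij in \<open>auto simp: edges_def\<close>)
    then show ?thesis by (simp add: edge_def g_def)
  qed
  have W: "l i * weight_matrix g i j = root_of f * l j * Q i j" if ij: "i \<in> {1..3}" "j \<in> {1..3}" for i j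
  proof (cases "i = j")
    case True
    then show ?thesis by (simp add: weight_matrix_def Q_diag)
  next
    case False
    then have e: "(i, j) \<in> edges" using ij by (simp add: edges_def)
    have "weight_matrix g i j = weight_matrix f i j * (Q i j / ratio f i j)"
      using ij False Q_pos[OF e] F.ratio_pos[OF e]
      by (simp add: weight_matrix_def edge[OF e] exp_add exp_diff)
    then show ?thesis
      using F.l_pos[OF ij(1)] F.l_pos[OF ij(2)] F.lam_pos F.m_pos[OF ij False]
      unfolding F.ratio_eq[OF ij] by (simp add: field_simps)
  qed
  have ratio: "ratio g i j = Q i j" if ij: "i \<in> {1..3}" "j \<in> {1..3}" for i j
  proof -
    have "ratio g i j = l i * weight_matrix g i j / (root_of f * l j)"
    proof (rule ratio_eqI[OF g F.lam_pos F.l_pos _ ij])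
      fix j assume j: "j \<in> {1..3::nat}"
      have "(\<Sum>i=1..3. l i * weight_matrix g i j) = (\<Sum>i=1..3. root_of f * l j * Q i j)"
        by (intro sum.cong refl W j)
      also have "\<dots> = root_of f * l j"
        unfolding sum_distrib_left[symmetric] Q_sum[OF j] by simp
      finally show "(\<Sum>i=1..3. l i * weight_matrix g i j) = root_of f * l j" .
    qed simp
    then show ?thesis using W[OF ij] F.lam_pos F.l_pos[OF ij(2)] by simp
  qed
  have "sup_dist SigmaA f g \<le> e"
  proof (rule sup_dist_le[OF _ e])
    fix \<omega> assume \<omega>: "\<omega> \<in> SigmaA"
    then have "(\<omega> 0, \<omega> 1) \<in> edges" using SigmaA_mem[OF \<omega>] SigmaA_neq[OF \<omega>, of 0] by (simp add: edges_def)
    from close[OF this] show "\<bar>f \<omega> - g \<omega>\<bar> \<le> e" using \<omega> by (simp add: g_def abs_minus_commute)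
  qed
  with g ratio show thesis by (intro that)
qed

lemma avoid_finite:
  fixes x d :: real
  assumes "0 < d" "finite B"
  obtains t where "\<bar>t - x\<bar> < d" "t \<notin> B"
proof -
  have "infinite {x - d<..<x + d}" using assms(1) by (simp add: infinite_Ioo)
  then have "infinite ({x - d<..<x + d} - B)" using assms(2) by simp
  then obtain t where "t \<in> {x - d<..<x + d} - B" by (metis all_not_in_conv finite.emptyI)
  then show thesis by (intro that[of t]) auto
qed

text \<open>The columns of the matrix of ratios sum to one, so that three entries determine it.\<close>

definition column_matrix :: "real \<Rightarrow> real \<Rightarrow> real \<Rightarrow> nat \<Rightarrow> nat \<Rightarrow> real" where
  "column_matrix a b c i j =
     (if (i, j) = (2, 1) then a else if (i, j) = (3, 1) then 1 - a
      else if (i, j) = (1, 2) then b else if (i, j) = (3, 2) then 1 - b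
      else if (i, j) = (1, 3) then c else if (i, j) = (2, 3) then 1 - c else 0)"

lemma edges_eq: "edges = {(2, 1), (3, 1), (1, 2), (3, 2), (1, 3), (2, 3)}"
  unfolding edges_def alphabet by auto

text \<open>For fixed \<open>b\<close> and \<open>c\<close>, each forbidden coincidence that
  involves \<open>a\<close> is a linear equation in \<open>a\<close> with a single solution, and
  these solutions are the excluded values. The coincidences among \<open>b\<close>,
  \<open>c\<close>, \<open>1 - b\<close> and \<open>1 - c\<close> are excluded by the conditions on
  \<open>b\<close> and \<open>c\<close>.\<close>

lemma generic_column_matrix:
  assumes pos: "0 < a" "a < 1" "0 < b" "b < 1" "0 < c" "c < 1"
    and c: "c \<noteq> 1 / 2" and b: "b \<notin> {1 / 2, c, 1 - c}"
    and a: "a \<notin> {1 / 2, b, c, 1 - b, 1 - c, c / (b + c), (1 - b) * (1 - c) / b,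
      1 - (1 - b) * (1 - c) / c, b * (1 - c) / (b * (1 - c) + c * (1 - b))}"
  shows "generic (column_matrix a b c)"
proof -
  have "b * a \<noteq> c * (1 - a)"
  proof
    assume "b * a = c * (1 - a)"
    then have "a * (b + c) = c" by (simp add: algebra_simps)
    then have "a = c / (b + c)" using pos by (simp add: eq_divide_eq)
    then show False using a by simp
  qed
  moreover have "b * a \<noteq> (1 - c) * (1 - b)"
  proof
    assume "b * a = (1 - c) * (1 - b)"
    then have "a = (1 - b) * (1 - c) / b" using pos by (simp add: eq_divide_eq mult.commute)
    then show False using a by simp
  qed
  moreover have "c * (1 - a) \<noteq> (1 - c) * (1 - b)"
  proof
    assume "c * (1 - a) = (1 - c) * (1 - b)"
    then have "1 - a = (1 - b) * (1 - c) / c" using pos by (simp add: eq_divide_eq mult.commute)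
    then have "a = 1 - (1 - b) * (1 - c) / c" by linarith
    then show False using a by simp
  qed
  moreover have "b * (1 - c) * (1 - a) \<noteq> c * (1 - b) * a"
  proof
    assume "b * (1 - c) * (1 - a) = c * (1 - b) * a"
    then have "a * (b * (1 - c) + c * (1 - b)) = b * (1 - c)" by (simp add: algebra_simps)
    moreover have "0 < b * (1 - c) + c * (1 - b)" using pos by (simp add: add_pos_pos)
    ultimately have "a = b * (1 - c) / (b * (1 - c) + c * (1 - b))" by (simp add: eq_divide_eq)
    then show False using a by simp
  qed
  moreover have "inj_on (\<lambda>(i, j). column_matrix a b c i j) edges"
  proof -
    have "a \<noteq> 1 / 2" "b \<noteq> 1 / 2" using a b by simp_all
    with c have half: "a \<noteq> 1 - a" "b \<noteq> 1 - b" "c \<noteq> 1 - c" by linarith+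
    have ne: "a \<noteq> b" "a \<noteq> 1 - b" "a \<noteq> c" "a \<noteq> 1 - c" "b \<noteq> c" "b \<noteq> 1 - c"
      using a b by simp_all
    then have "1 - a \<noteq> b" "1 - a \<noteq> c" "1 - b \<noteq> c" by linarith+
    with half ne show ?thesis unfolding edges_eq by (simp add: column_matrix_def)
  qed
  ultimately show ?thesis by (simp add: generic_def column_matrix_def)
qed

text \<open>Moving the ratios by less than a small \<open>d\<close> keeps them positive and their
  logarithms within \<open>e\<close>. The free entries are moved in the order \<open>c\<close>,
  \<open>b\<close>, \<open>a\<close>, since the values to be avoided by each depend on those chosen
  before.\<close>

lemma generic_dense:
  assumes f: "f \<in> L2" and e: "0 < e"
  obtains g where "g \<in> L2" "generic (ratio g)" "sup_dist SigmaA f g \<le> e"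
proof -
  obtain l h where "perron_potential f (root_of f) l h"
    using perron_potential_exists[OF f] by blast
  then interpret F: perron_potential f "root_of f" l h .
  let ?q = "ratio f"
  have "\<forall>\<^sub>F d in at_right 0. \<forall>p\<in>edges. \<forall>t. \<bar>t - ?q (fst p) (snd p)\<bar> < d \<longrightarrow>
      0 < t \<and> \<bar>ln t - ln (?q (fst p) (snd p))\<bar> \<le> e"
  proof (intro eventually_ball_finite finite_edges ballI)
    fix p assume "p \<in> edges"
    then have q: "0 < ?q (fst p) (snd p)" by (intro F.ratio_pos) simp
    have "\<forall>\<^sub>F t in nhds (?q (fst p) (snd p)). dist (ln t) (ln (?q (fst p) (snd p))) < e"
      using q by (intro tendstoD[OF tendsto_ln[OF filterlim_ident] e]) simp
    moreover have "\<forall>\<^sub>F t in nhds (?q (fst p) (snd p)). 0 < t"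
      using q by (rule eventually_nhds_in_open[OF open_greaterThan, unfolded greaterThan_iff])
    ultimately have "\<forall>\<^sub>F t in nhds (?q (fst p) (snd p)). 0 < t \<and> \<bar>ln t - ln (?q (fst p) (snd p))\<bar> \<le> e"
      by eventually_elim (simp add: dist_real_def)
    then obtain d0 where "0 < d0" "\<And>t. dist t (?q (fst p) (snd p)) < d0 \<Longrightarrow>
        0 < t \<and> \<bar>ln t - ln (?q (fst p) (snd p))\<bar> \<le> e"
      unfolding eventually_nhds_metric by blast
    then show "\<forall>\<^sub>F d in at_right 0. \<forall>t. \<bar>t - ?q (fst p) (snd p)\<bar> < d \<longrightarrow>
      0 < t \<and> \<bar>ln t - ln (?q (fst p) (snd p))\<bar> \<le> e"
      unfolding eventually_at_right_field dist_real_def by (intro exI[of _ d0]) force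
  qed
  then obtain d1 where d1: "0 < d1" "\<And>d. 0 < d \<Longrightarrow> d < d1 \<Longrightarrow> \<forall>p\<in>edges. \<forall>t. \<bar>t - ?q (fst p) (snd p)\<bar> < d \<longrightarrow>
      0 < t \<and> \<bar>ln t - ln (?q (fst p) (snd p))\<bar> \<le> e"
    unfolding eventually_at_right_field by blast
  define d where "d = d1 / 2"
  have d: "0 < d" and near: "\<And>i j t. (i, j) \<in> edges \<Longrightarrow> \<bar>t - ?q i j\<bar> < d \<Longrightarrow> 0 < t \<and> \<bar>ln t - ln (?q i j)\<bar> \<le> e"
    using d1(1) d1(2)[of d] by (auto simp: d_def)
  obtain c where c: "\<bar>c - ?q 1 3\<bar> < d" "c \<notin> {1 / 2}"
    by (rule avoid_finite[OF d, of "{1 / 2}"]) auto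
  obtain b where b: "\<bar>b - ?q 1 2\<bar> < d" "b \<notin> {1 / 2, c, 1 - c}"
    by (rule avoid_finite[OF d, of "{1 / 2, c, 1 - c}"]) auto
  let ?B = "{1 / 2, b, c, 1 - b, 1 - c, c / (b + c), (1 - b) * (1 - c) / b,
      1 - (1 - b) * (1 - c) / c, b * (1 - c) / (b * (1 - c) + c * (1 - b))}"
  obtain a where a: "\<bar>a - ?q 2 1\<bar> < d" "a \<notin> ?B"
    by (rule avoid_finite[OF d, of ?B]) auto
  let ?Q = "column_matrix a b c"
  have q0: "?q i i = 0" if "i \<in> {1..3}" for i
    unfolding F.ratio_eq[OF that that] by (simp add: weight_matrix_def)
  have sums: "?q 2 1 + ?q 3 1 = 1" "?q 1 2 + ?q 3 2 = 1" "?q 1 3 + ?q 2 3 = 1"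
    using F.sum_ratio[of 1] F.sum_ratio[of 2] F.sum_ratio[of 3] q0[of 1] q0[of 2] q0[of 3]
    unfolding sum_1_to_3 by simp_all
  \<comment> \<open>The columns of \<open>ratio f\<close> sum to one as well, so the complementary
    entries move by the same amount.\<close>
  have a': "\<bar>(1 - a) - ?q 3 1\<bar> < d" using sums(1) a(1) by linarith
  have b': "\<bar>(1 - b) - ?q 3 2\<bar> < d" using sums(2) b(1) by linarith
  have c': "\<bar>(1 - c) - ?q 2 3\<bar> < d" using sums(3) c(1) by linarith
  have Qd: "\<bar>?Q i j - ?q i j\<bar> < d" if ij: "(i, j) \<in> edges" for i j
  proof -
    consider "i = 2 \<and> j = 1" | "i = 3 \<and> j = 1" | "i = 1 \<and> j = 2" | "i = 3 \<and> j = 2" | "i = 1 \<and> j = 3" | "i = 2 \<and> j = 3"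
      using ij unfolding edges_eq by blast
    then show ?thesis
    proof cases
      case 1 then show ?thesis using a(1) by (simp add: column_matrix_def)
    next
      case 2 then show ?thesis using a' by (simp add: column_matrix_def)
    next
      case 3 then show ?thesis using b(1) by (simp add: column_matrix_def)
    next
      case 4 then show ?thesis using b' by (simp add: column_matrix_def)
    next
      case 5 then show ?thesis using c(1) by (simp add: column_matrix_def)
    next
      case 6 then show ?thesis using c' by (simp add: column_matrix_def)
    qed
  qed
  have Q: "0 < ?Q i j \<and> \<bar>ln (?Q i j) - ln (?q i j)\<bar> \<le> e" if "(i, j) \<in> edges" for i j
    by (rule near[OF that Qd[OF that]])
  have "0 < ?Q 2 1" "0 < ?Q 3 1" "0 < ?Q 1 2" "0 < ?Q 3 2" "0 < ?Q 1 3" "0 < ?Q 2 3"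
    by (rule Q[THEN conjunct1], simp add: edges_eq)+
  then have pos: "0 < a" "a < 1" "0 < b" "b < 1" "0 < c" "c < 1"
    by (simp_all add: column_matrix_def)
  have gen: "generic ?Q" using pos c(2) b(2) a(2) by (intro generic_column_matrix) auto
  obtain g where g: "g \<in> L2" "sup_dist SigmaA f g \<le> e"
    "\<And>i j. i \<in> {1..3} \<Longrightarrow> j \<in> {1..3} \<Longrightarrow> ratio g i j = ?Q i j"
  proof (rule ratio_prescribed[OF f, of ?Q e])
    show "(\<Sum>i=1..3. ?Q i j) = 1" if "j \<in> {1..3}" for j
      using that unfolding alphabet sum_1_to_3 by (auto simp: column_matrix_def)
    show "?Q i i = 0" for i by (auto simp: column_matrix_def)
  qed (use Q e in auto)
  have "inj_on (\<lambda>(i, j). ratio g i j) edges \<longleftrightarrow> inj_on (\<lambda>(i, j). ?Q i j) edges"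
    by (rule inj_on_cong) (auto simp: edges_def g(3))
  then have "generic (ratio g) \<longleftrightarrow> generic ?Q" unfolding generic_def by (simp add: g(3))
  then show thesis using that g(1,2) gen by blast
qed

theorem corollaryA7:
  shows "\<exists>U. U \<subseteq> {f \<in> L2. isomorphism_class SigmaA L2 f \<subset> spectrum_class SigmaA L2 f} \<and>
             openin L2_topology U \<and> L2_topology closure_of U = L2"
proof (intro exI conjI)
  let ?U = "{f \<in> L2. generic (ratio f)}"
  show "?U \<subseteq> {f \<in> L2. isomorphism_class SigmaA L2 f \<subset> spectrum_class SigmaA L2 f}"
    using isomorphism_class_psubset by blast
  show "openin L2_topology ?U" by (rule openin_generic)
  have "\<exists>g\<in>?U. g \<in> L2.mball f r" if f: "f \<in> L2" and r: "0 < r" for f r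
  proof -
    obtain g where g: "g \<in> L2" "generic (ratio g)" "sup_dist SigmaA f g \<le> r / 2"
      using generic_dense[OF f, of "r / 2"] r by auto
    then have "g \<in> L2.mball f r" using f r by simp
    with g show ?thesis by blast
  qed
  then show "L2_topology closure_of ?U = L2"
    unfolding L2_topology_def L2.metric_closure_of by auto
qed

end
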